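(* Assume that $l\in L^1_{loc}(\mathbb R_+)$ is completely positive. Let $\delta_1,\delta_2\in(0,1)$ with $\delta_1+\delta_2\ge1$, let $\gamma\in\mathbb R_+$, and let $r_\gamma\in L^1_{loc}(\mathbb R_+)$ be the solution of $r_\gamma(t)+\gamma(l*r_\gamma)(t)=l(t)$, $t>0$. Then there exists a completely positive function $h_{\delta_1,\delta_2,\gamma}:(0,\infty)\to(0,\infty)$ whose Laplace transform is given by $$\widehat h_{\delta_1,\delta_2,\gamma}(\lambda)=\Gamma(1-\delta_1)\Gamma(1-\delta_2)\,\widehat l(\lambda)^{1-\delta_1}\,\widehat r_\gamma(\lambda)^{1-\delta_2}.$$ Moreover, if $l$ is also nonincreasing, then there exists $C_{\delta_1,\delta_2}>0$ depending solely on $\delta_1,\delta_2$ such that $$h_{\delta_1,\delta_2,\gamma}(t)\le C_{\delta_1,\delta_2}\,l\big(\tfrac t2\big)\Big[(1*l)\big(\tfrac t2\big)\Big]^{1-(\delta_1+\delta_2)},\quad t>0.$$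
   Context: $\mathbb R_+=[0,\infty)$; $(f*g)(t)=\int_0^tf(t-\zeta)g(\zeta)\,\mathrm d\zeta$, so $(1*l)(t)=\int_0^tl(\zeta)\,\mathrm d\zeta$; $\widehat f(\lambda)=\int_0^\infty e^{-\lambda t}f(t)\,\mathrm dt$ is the Laplace transform; $\Gamma$ is the Gamma function. A function $l\in L^1_{loc}(\mathbb R_+)$ is completely positive if for every $\gamma\ge0$ the solutions $s_\gamma$ of $s_\gamma+\gamma(l*s_\gamma)=1$ and $r_\gamma$ of $r_\gamma+\gamma(l*r_\gamma)=l$ are nonnegative; equivalently, there exist $k_0\ge0$ and a nonnegative nonincreasing $k_1\in L^1_{loc}(\mathbb R_+)$ with $k_0l(t)+(k_1*l)(t)=1$ for $t>0$. *)

theory Defs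
  imports "HOL-Analysis.Analysis"
begin

text \<open>
  Elements of \<open>L\<^sup>1\<^sub>l\<^sub>o\<^sub>c\<close> on the half-line are represented by functions on the whole real line;
  only their values on the positive half-line, and up to null sets, matter. Accordingly
  integral equations and nonnegativity of such elements are required almost everywhere.
\<close>

definition L1_loc :: "(real \<Rightarrow> real) set" where
  "L1_loc = {f. \<forall>T>0. set_integrable lebesgue {0..T} f}"

definition conv :: "(real \<Rightarrow> real) \<Rightarrow> (real \<Rightarrow> real) \<Rightarrow> real \<Rightarrow> real" where
  "conv f g t = (LINT z:{0..t}|lebesgue. f (t - z) * g z)"

definition laplace_convergent :: "(real \<Rightarrow> real) \<Rightarrow> real \<Rightarrow> bool" where
  "laplace_convergent f x \<longleftrightarrow> set_integrable lebesgue {0..} (\<lambda>t. exp (- x * t) * f t)"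

definition laplace :: "(real \<Rightarrow> real) \<Rightarrow> real \<Rightarrow> real" where
  "laplace f x = (LINT t:{0..}|lebesgue. exp (- x * t) * f t)"

definition volterra_solution ::
    "(real \<Rightarrow> real) \<Rightarrow> real \<Rightarrow> (real \<Rightarrow> real) \<Rightarrow> (real \<Rightarrow> real) \<Rightarrow> bool" where
  "volterra_solution l \<gamma> f u \<longleftrightarrow>
     u \<in> L1_loc \<and> (AE t in lebesgue. 0 < t \<longrightarrow> u t + \<gamma> * conv l u t = f t)"

text \<open>
  For \<open>l\<close> and \<open>f\<close> in \<open>L\<^sup>1\<^sub>l\<^sub>o\<^sub>c\<close> the solution of the Volterra equation exists and is unique up to null
  sets, so "the solution is nonnegative" is expressed by the existence of a nonnegative solution.
  The kernel 0, whose resolvents 1 and 0 are nonnegative, is excluded, as usual: without this the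
  characterization by \<open>k\<^sub>0 l + k\<^sub>1 * l = 1\<close> would fail to be equivalent.
\<close>

definition completely_positive :: "(real \<Rightarrow> real) \<Rightarrow> bool" where
  "completely_positive l \<longleftrightarrow>
     l \<in> L1_loc \<and> \<not> (AE t in lebesgue. 0 < t \<longrightarrow> l t = 0) \<and>
     (\<forall>\<gamma>\<ge>0.
        (\<exists>s. volterra_solution l \<gamma> (\<lambda>_. 1) s \<and> (AE t in lebesgue. 0 < t \<longrightarrow> 0 \<le> s t)) \<and>
        (\<exists>r. volterra_solution l \<gamma> l r \<and> (AE t in lebesgue. 0 < t \<longrightarrow> 0 \<le> r t)))"

end

(*
  Put phi = 1 / (Laplace transform of l), a = 1 - delta1 and b = 1 - delta2. The resolvents r_u and
  s_u of l have transforms 1 / (phi + u) and phi / (x (phi + u)). As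
  x^(-a) = const * integral of u^(-a) / (x + u) du, the mixtures of r_(u + gamma) with weight u^(-a)
  have transforms (phi + gamma)^(-a), and h is a multiple of the convolution of two such mixtures:
  its transform is a constant over Psi(phi), Psi(x) = x^a (x + gamma)^b.

  The resolvents of h exist as signed Neumann series. Their transforms 1 / (Psi(phi) + beta) and
  Psi(phi) / (x (Psi(phi) + beta)) belong to the cone generated from those of r_u and s_u by sums,
  products and limits, because Psi is a Bernstein function for a + b <= 1. A function whose Laplace
  transform is completely monotone along an arithmetic progression is nonnegative almost
  everywhere (Bernstein polynomials in exp(-t)), so the resolvents of h are nonnegative. The same
  criterion shows that Laplace transforms determine functions, which replaces all algebra of
  convolutions.

  If l is nonincreasing, then r_u(t) <= l(t) / (1 + u (1 * l)(t)). Integrating over u bounds the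
  mixtures by l (1 * l)^(a - 1), and splitting the convolution at t / 2 gives the estimate.
*)
theory Submission
  imports Defs
begin

section \<open>Completely monotone sequences\<close>

text \<open>Complete monotonicity is sampled at \<open>x + k\<close>: finite differences replace
  derivatives, and a Laplace transform becomes a moment sequence in exp (- t). The hypothesis
  \<delta>1 + \<delta>2 \<ge> 1 enters only through the Bernstein property of Psi, which grows with
  exponent a + b at infinity, while a Bernstein function grows at most linearly. Two demands reach
  beyond transforms. Positivity of h is asked at every t > 0, although resolvents are known only up
  to null sets. It suffices that both mixtures be positive almost everywhere; this rests on the
  resolvents having mass in every neighbourhood of 0 and on a Steinhaus argument. And the constant
  must not depend on \<gamma>: the estimate for the resolvent at u + \<gamma> remains true with u in
  its place, so the shift is dropped. The constant is 4 Gamma(1 - \<delta>1) Gamma(1 - \<delta>2),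
  each half of the convolution contributing 2.\<close>

definition diff_seq :: "(nat \<Rightarrow> real) \<Rightarrow> nat \<Rightarrow> real" where
  "diff_seq a k = a k - a (Suc k)"

text \<open>Hausdorff's condition, which characterizes the moment sequences of finite measures on
  [0, 1]. As \<open>diff_seq\<close> is the negated forward difference, no alternating signs
  appear.\<close>

definition cm_seq :: "(nat \<Rightarrow> real) \<Rightarrow> bool" where
  "cm_seq a \<longleftrightarrow> (\<forall>m k. 0 \<le> (diff_seq ^^ m) a k)"

lemma cm_seqD: "cm_seq a \<Longrightarrow> 0 \<le> (diff_seq ^^ m) a k"
  by (simp add: cm_seq_def)

lemma cm_seq_nonneg: "cm_seq a \<Longrightarrow> 0 \<le> a k"
  using cm_seqD[of a 0 k] by simp

lemma funpow_diff_seq_add: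
  "(diff_seq ^^ m) (\<lambda>k. a k + b k) = (\<lambda>k. (diff_seq ^^ m) a k + (diff_seq ^^ m) b k)"
  by (induction m) (simp_all add: diff_seq_def fun_eq_iff)

lemma funpow_diff_seq_cmult: "(diff_seq ^^ m) (\<lambda>k. c * a k) = (\<lambda>k. c * (diff_seq ^^ m) a k)"
  by (induction m) (simp_all add: diff_seq_def fun_eq_iff algebra_simps)

lemma funpow_diff_seq_power:
  "(diff_seq ^^ m) (\<lambda>k. y ^ k) = (\<lambda>k. y ^ k * (1 - y) ^ m)"
  by (induction m) (simp_all add: diff_seq_def fun_eq_iff algebra_simps)

lemma funpow_diff_seq_shift:
  "(diff_seq ^^ m) (\<lambda>k. a (Suc k)) = (\<lambda>k. (diff_seq ^^ m) a (Suc k))"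
  by (induction m) (simp_all add: diff_seq_def fun_eq_iff)

lemma cm_seq_const: "0 \<le> c \<Longrightarrow> cm_seq (\<lambda>_. c)"
  unfolding cm_seq_def
proof safe
  fix m k :: nat assume "0 \<le> c"
  have "(diff_seq ^^ m) (\<lambda>_. c) k = (if m = 0 then c else 0)"
    by (induction m arbitrary: k) (simp_all add: diff_seq_def)
  with \<open>0 \<le> c\<close> show "0 \<le> (diff_seq ^^ m) (\<lambda>_. c) k" by simp
qed

lemma cm_seq_add: "cm_seq a \<Longrightarrow> cm_seq b \<Longrightarrow> cm_seq (\<lambda>k. a k + b k)"
  by (simp add: cm_seq_def funpow_diff_seq_add)

lemma cm_seq_cmult: "0 \<le> c \<Longrightarrow> cm_seq a \<Longrightarrow> cm_seq (\<lambda>k. c * a k)"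
  by (simp add: cm_seq_def funpow_diff_seq_cmult)

lemma cm_seq_sum: "finite S \<Longrightarrow> (\<And>i. i \<in> S \<Longrightarrow> cm_seq (a i)) \<Longrightarrow> cm_seq (\<lambda>k. \<Sum>i\<in>S. a i k)"
  by (induction S rule: finite_induct) (auto intro: cm_seq_add cm_seq_const)

lemma cm_seq_shift: "cm_seq a \<Longrightarrow> cm_seq (\<lambda>k. a (Suc k))"
  by (simp add: cm_seq_def funpow_diff_seq_shift)

lemma cm_seq_diff_seq: "cm_seq a \<Longrightarrow> cm_seq (diff_seq a)"
  unfolding cm_seq_def by (metis funpow_Suc_right o_apply)

text \<open>The Leibniz rule for differences shifts one factor. Both of its terms are again products
  of completely monotone sequences, so the induction on the order \<open>m\<close> runs over all
  pairs.\<close>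

lemma cm_seq_mult:
  assumes "cm_seq a" "cm_seq b"
  shows "cm_seq (\<lambda>k. a k * b k)"
proof -
  have "0 \<le> (diff_seq ^^ m) (\<lambda>k. a k * b k) k" if "cm_seq a" "cm_seq b" for m k a b
    using that
  proof (induction m arbitrary: a b k)
    case 0
    then show ?case by (simp add: cm_seq_nonneg)
  next
    case (Suc m)
    have "diff_seq (\<lambda>k. a k * b k) = (\<lambda>k. diff_seq a k * b k + a (Suc k) * diff_seq b k)"
      by (simp add: diff_seq_def fun_eq_iff algebra_simps)
    then have "(diff_seq ^^ Suc m) (\<lambda>k. a k * b k) k
        = (diff_seq ^^ m) (\<lambda>k. diff_seq a k * b k) k + (diff_seq ^^ m) (\<lambda>k. a (Suc k) * diff_seq b k) k"
      by (simp only: funpow_Suc_right o_apply funpow_diff_seq_add)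
    then show ?case
      using Suc.IH[OF cm_seq_diff_seq[OF Suc.prems(1)] Suc.prems(2), of k]
        Suc.IH[OF cm_seq_shift[OF Suc.prems(1)] cm_seq_diff_seq[OF Suc.prems(2)], of k] by simp
  qed
  with assms show ?thesis by (simp add: cm_seq_def)
qed

lemma cm_seq_power: "cm_seq a \<Longrightarrow> cm_seq (\<lambda>k. a k ^ n)"
  by (induction n) (auto intro: cm_seq_mult cm_seq_const)

text \<open>Each iterated difference involves finitely many terms, so pointwise limits suffice. The
  approximants of a reciprocal are known to be completely monotone for large \<open>n\<close>
  only.\<close>

lemma cm_seq_LIMSEQ:
  assumes "\<forall>\<^sub>F n in sequentially. cm_seq (a n)" and lim: "\<And>k. (\<lambda>n. a n k) \<longlonglongrightarrow> b k"
  shows "cm_seq b"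
proof -
  have "(\<lambda>n. (diff_seq ^^ m) (a n) k) \<longlonglongrightarrow> (diff_seq ^^ m) b k" for m k
    by (induction m arbitrary: k) (auto simp: diff_seq_def intro!: tendsto_diff lim)
  moreover have "\<forall>\<^sub>F n in sequentially. 0 \<le> (diff_seq ^^ m) (a n) k" for m k
    using assms(1) by eventually_elim (simp add: cm_seqD)
  ultimately show ?thesis
    unfolding cm_seq_def using tendsto_lowerbound sequentially_bot by blast
qed

lemma funpow_diff_seq_integral:
  assumes int: "\<And>k. integrable M (\<lambda>x. a x k)"
  shows "integrable M (\<lambda>x. (diff_seq ^^ m) (a x) k)
       \<and> (diff_seq ^^ m) (\<lambda>k. LINT x|M. a x k) k = (LINT x|M. (diff_seq ^^ m) (a x) k)"
  by (induction m arbitrary: k) (auto simp: diff_seq_def int)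

lemma cm_seq_integral:
  assumes "\<And>k. integrable M (\<lambda>x. a x k)" "\<And>x. x \<in> space M \<Longrightarrow> cm_seq (a x)"
  shows "cm_seq (\<lambda>k. LINT x|M. a x k)"
  using assms funpow_diff_seq_integral[OF assms(1)]
  by (auto simp: cm_seq_def intro!: Bochner_Integration.integral_nonneg)

section \<open>Hausdorff's moment criterion for nonnegativity\<close>

lemma integral_Bernstein:
  fixes w :: "'a \<Rightarrow> real"
  assumes int: "\<And>k. integrable M (\<lambda>x. w x * y x ^ k)" and "j \<le> n"
  shows "integrable M (\<lambda>x. w x * Bernstein n j (y x))"
    and "(LINT x|M. w x * Bernstein n j (y x))
       = real (n choose j) * (diff_seq ^^ (n - j)) (\<lambda>k. LINT x|M. w x * y x ^ k) j"
proof -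
  note * = funpow_diff_seq_integral[where a="\<lambda>x k. w x * y x ^ k" and M=M and m="n - j" and k=j, OF int]
  \<comment> \<open>Differencing powers of \<open>y\<close> produces factors 1 - y, so the integrals
    of the Bernstein basis are iterated differences of the moments.\<close>
  have eq: "(diff_seq ^^ (n - j)) (\<lambda>k. w x * y x ^ k) j = w x * (y x ^ j * (1 - y x) ^ (n - j))" for x
    by (simp add: funpow_diff_seq_cmult funpow_diff_seq_power)
  show "integrable M (\<lambda>x. w x * Bernstein n j (y x))"
    using integrable_mult_right[of "real (n choose j)", OF conjunct1[OF *]]
    by (simp add: eq Bernstein_def mult_ac)
  have "(LINT x|M. w x * Bernstein n j (y x)) = (LINT x|M. real (n choose j) * (w x * (y x ^ j * (1 - y x) ^ (n - j))))"
    by (simp add: Bernstein_def mult_ac)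
  also have "\<dots> = real (n choose j) * (diff_seq ^^ (n - j)) (\<lambda>k. LINT x|M. w x * y x ^ k) j"
    using conjunct2[OF *]
    by (simp add: eq)
  finally show "(LINT x|M. w x * Bernstein n j (y x))
       = real (n choose j) * (diff_seq ^^ (n - j)) (\<lambda>k. LINT x|M. w x * y x ^ k) j" .
qed

text \<open>The Bernstein polynomials of g \<ge> 0 have nonnegative coefficients, so the moments
  alone make their integrals nonnegative. They converge uniformly to \<open>g\<close>, and the error
  is at most \<open>e\<close> times the integral of |w|, whatever the sign of
  \<open>w\<close>.\<close>

lemma cm_moments_integral_nonneg:
  fixes w :: "'a \<Rightarrow> real"
  assumes w: "integrable M w" and [measurable]: "y \<in> borel_measurable M"
    and y: "\<And>x. x \<in> space M \<Longrightarrow> y x \<in> {0..1}"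
    and cm: "cm_seq (\<lambda>k. LINT x|M. w x * y x ^ k)"
    and g: "continuous_on UNIV g" and g0: "\<And>z. 0 \<le> g z"
  shows "0 \<le> (LINT x|M. w x * g (y x))"
proof -
  have [measurable]: "g \<in> borel_measurable borel" "w \<in> borel_measurable M"
    using g w by (auto intro: borel_measurable_continuous_onI)
  have int: "integrable M (\<lambda>x. w x * y x ^ k)" for k
    using w by (rule Bochner_Integration.integrable_bound)
      (use y in \<open>auto simp: abs_mult power_abs intro!: AE_I2 mult_left_le power_le_one\<close>)
  define B where "B n z = (\<Sum>k\<le>n. g (k / n) * Bernstein n k z)" for n :: nat and z :: real
  have intB: "integrable M (\<lambda>x. w x * B n (y x))" for n
    unfolding B_def sum_distrib_left
    using integral_Bernstein(1)[OF int]
    by (auto simp: mult.left_commute[of "w _"] intro!: Bochner_Integration.integrable_sum)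
  have B_nonneg: "0 \<le> (LINT x|M. w x * B n (y x))" for n
  proof -
    have "(LINT x|M. w x * B n (y x)) = (\<Sum>k\<le>n. LINT x|M. g (k / n) * (w x * Bernstein n k (y x)))"
      unfolding B_def sum_distrib_left
      by (subst Bochner_Integration.integral_sum[symmetric])
        (use integral_Bernstein(1)[OF int] in \<open>auto simp: mult.left_commute[of "w _"]\<close>)
    also have "\<dots> = (\<Sum>k\<le>n. g (k / n) * (real (n choose k) * (diff_seq ^^ (n - k)) (\<lambda>k. LINT x|M. w x * y x ^ k) k))"
      using integral_Bernstein(2)[OF int] by (intro sum.cong) auto
    also have "\<dots> \<ge> 0"
      by (intro sum_nonneg mult_nonneg_nonneg g0 cm_seqD cm) auto
    finally show ?thesis .
  qed
  have intg: "integrable M (\<lambda>x. w x * g (y x))"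
  proof -
    have "bounded (g ` {0..1})"
      using g by (intro compact_imp_bounded compact_continuous_image) (auto intro: continuous_on_subset)
    then obtain K where K: "\<And>z. z \<in> {0..1} \<Longrightarrow> \<bar>g z\<bar> \<le> K"
      unfolding bounded_iff by (metis imageI real_norm_def)
    show ?thesis
      by (rule Bochner_Integration.integrable_bound[of M "\<lambda>x. K * w x"])
        (use w order_trans[OF K abs_ge_self] y in \<open>auto simp: abs_mult mult.commute[of _ "\<bar>w _\<bar>"] intro!: AE_I2 mult_left_mono\<close>)
  qed
  have "- (e * (LINT x|M. \<bar>w x\<bar>)) \<le> (LINT x|M. w x * g (y x))" if e: "e > 0" for e
  proof -
    obtain N where N: "\<And>n z. N \<le> n \<Longrightarrow> z \<in> {0..1} \<Longrightarrow> \<bar>g z - B n z\<bar> < e"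
      using Bernstein_Weierstrass[OF continuous_on_subset[OF g subset_UNIV] e] unfolding B_def by blast
    have "\<bar>(LINT x|M. w x * g (y x)) - (LINT x|M. w x * B N (y x))\<bar>
        = \<bar>LINT x|M. w x * (g (y x) - B N (y x))\<bar>"
      using intg intB by (simp add: algebra_simps)
    also have "\<dots> \<le> (LINT x|M. e * \<bar>w x\<bar>)"
    proof (rule order_trans[OF integral_abs_bound], rule integral_mono)
      show "integrable M (\<lambda>x. \<bar>w x * (g (y x) - B N (y x))\<bar>)"
        using Bochner_Integration.integrable_diff[OF intg intB[of N]] by (simp add: algebra_simps)
      show "integrable M (\<lambda>x. e * \<bar>w x\<bar>)" using w by simp
      show "\<bar>w x * (g (y x) - B N (y x))\<bar> \<le> e * \<bar>w x\<bar>" if "x \<in> space M" for x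
        using N[of N "y x"] y[OF that] by (simp add: abs_mult mult.commute[of e] mult_left_mono)
    qed
    finally show ?thesis using B_nonneg[of N] by simp
  qed
  note * = this
  have "((\<lambda>e. - (e * (LINT x|M. \<bar>w x\<bar>))) \<longlongrightarrow> - (0 * (LINT x|M. \<bar>w x\<bar>))) (at_right 0)"
    by (intro tendsto_intros)
  moreover have "\<forall>\<^sub>F e in at_right 0. - (e * (LINT x|M. \<bar>w x\<bar>)) \<le> (LINT x|M. w x * g (y x))"
    by (rule eventually_at_rightI[of 0 1]) (simp_all add: *)
  ultimately show ?thesis
    using tendsto_upperbound[of _ _ "at_right (0::real)"] by fastforce
qed

text \<open>Nonnegativity of the integrals passes from continuous functions of \<open>y\<close> to
  indicators of open sets and, by outer regularity, of Borel sets. As exp (- t) is injective, these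
  account for all Borel sets of \<open>t\<close> in the half-line.\<close>

lemma cm_moments_AE_nonneg:
  fixes w :: "real \<Rightarrow> real"
  assumes w: "integrable lborel w" and supp: "\<And>t. t < 0 \<Longrightarrow> w t = 0"
    and cm: "cm_seq (\<lambda>k. LINT t|lborel. w t * exp (- (real k * t)))"
  shows "AE t in lborel. 0 \<le> w t"
proof -
  have [measurable]: "w \<in> borel_measurable borel" using w by auto
  \<comment> \<open>Clipping keeps \<open>y\<close> in [0, 1] on the whole line and changes nothing
    where \<open>w\<close> is nonzero.\<close>
  define y where "y t = exp (- max 0 t)" for t :: real
  have [measurable]: "y \<in> borel_measurable borel" unfolding y_def by measurable
  have y01: "y t \<in> {0..1}" for t by (auto simp: y_def)
  have "w t * exp (- (real k * t)) = w t * y t ^ k" for k t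
    using supp[of t] by (cases "t < 0") (auto simp: y_def exp_of_nat_mult[symmetric])
  with cm have cm': "cm_seq (\<lambda>k. LINT t|lborel. w t * y t ^ k)" by simp
  have cont: "0 \<le> (LINT t|lborel. w t * g (y t))" if "continuous_on UNIV g" "\<And>z. 0 \<le> g z" for g :: "real \<Rightarrow> real"
    using cm_moments_integral_nonneg[OF w _ _ cm' that] y01 by simp
  have opn: "0 \<le> (LINT t|lborel. w t * indicator U (y t))" if U: "open U" for U :: "real set"
  proof (cases "U = UNIV")
    case True
    then show ?thesis using cont[of "\<lambda>_. 1"] by simp
  next
    case False
    have [measurable]: "U \<in> sets borel" using U by simp
    have [measurable]: "(\<lambda>z. infdist z (- U)) \<in> borel_measurable borel"
      by (intro borel_measurable_continuous_onI continuous_intros)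
    \<comment> \<open>\<open>G n\<close> rises to the indicator of \<open>U\<close>. The case of the
      whole line is separate because \<open>infdist\<close> to the empty set is 0.\<close>
    define G where "G n z = min 1 (real n * infdist z (- U))" for n z
    have "(\<lambda>n. LINT t|lborel. w t * G n (y t)) \<longlonglongrightarrow> (LINT t|lborel. w t * indicator U (y t))"
    proof (rule integral_dominated_convergence[where w="\<lambda>t. \<bar>w t\<bar>"])
      show "AE t in lborel. (\<lambda>n. w t * G n (y t)) \<longlonglongrightarrow> w t * indicator U (y t)"
      proof (intro AE_I2 tendsto_mult tendsto_const)
        fix t
        have "(\<lambda>n. G n z) \<longlonglongrightarrow> indicator U z" for z
        proof (cases "z \<in> U")
          case True
          have pos: "0 < infdist z (- U)"
            using True U False by (intro infdist_pos_not_in_closed) (auto simp: closed_Compl)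
          obtain N where "1 < real N * infdist z (- U)"
            using reals_Archimedean3[OF pos] by blast
          then have "\<forall>\<^sub>F n in sequentially. G n z = 1"
            using pos by (intro eventually_sequentiallyI[of N])
              (auto simp: G_def min_def intro: order_trans[OF less_imp_le mult_right_mono])
          then show ?thesis using True by (auto intro: tendsto_eventually)
        next
          case False
          then show ?thesis by (simp add: G_def)
        qed
        then show "(\<lambda>n. G n (y t)) \<longlonglongrightarrow> indicator U (y t)" .
      qed
    qed (use w U in \<open>auto simp: G_def abs_mult infdist_nonneg intro!: AE_I2 mult_left_le\<close>)
    moreover have "0 \<le> (LINT t|lborel. w t * G n (y t))" for n
      by (rule cont) (auto simp: G_def infdist_nonneg intro!: continuous_intros)
    ultimately show ?thesis by (intro LIMSEQ_le_const) auto
  qed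
  \<comment> \<open>The image of |w| dt under \<open>y\<close> is a finite, hence outer regular,
    measure; it controls the signed integral over \<open>U - B\<close>.\<close>
  define M where "M = distr (density lborel (\<lambda>t. ennreal \<bar>w t\<bar>)) borel y"
  have M: "emeasure M B = (\<integral>\<^sup>+t. ennreal (\<bar>w t\<bar> * indicator B (y t)) \<partial>lborel)" if "B \<in> sets borel" for B
    unfolding M_def using that
    by (subst emeasure_distr, simp, simp, subst emeasure_density)
      (auto simp: measurable_sets_borel[of y borel] indicator_def intro!: nn_integral_cong)
  have intB: "integrable lborel (\<lambda>t. w t * indicator B (y t))" if "B \<in> sets borel" for B
    using w by (rule Bochner_Integration.integrable_bound) (use that in \<open>auto simp: indicator_def\<close>)
  have finM: "emeasure M B < \<infinity>" if "B \<in> sets borel" for B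
    using intB[OF that] M[OF that] by (simp add: integrable_iff_bounded abs_mult)
  have bor: "0 \<le> (LINT t|lborel. w t * indicator B (y t))" if B: "B \<in> sets borel" for B
  proof (rule field_le_epsilon)
    fix e :: real assume "e > 0"
    have "emeasure M B = (INF U \<in> {U. B \<subseteq> U \<and> open U}. emeasure M U)"
      using finM[of UNIV] B by (intro outer_regular) (auto simp: M_def)
    moreover have "emeasure M B < emeasure M B + ennreal e"
      using finM[OF B] \<open>e > 0\<close>
      by (cases "emeasure M B") (auto simp: ennreal_lessI simp flip: ennreal_plus)
    ultimately obtain U where U: "B \<subseteq> U" "open U" "emeasure M U < emeasure M B + ennreal e"
      by (metis (no_types, lifting) INF_less_iff mem_Collect_eq)
    have [measurable]: "U \<in> sets borel" "B \<in> sets borel" using U B by auto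
    have "emeasure M U = emeasure M B + emeasure M (U - B)"
      using U by (subst plus_emeasure) (auto simp: M_def Un_absorb1)
    with U(3) finM[OF B] have "emeasure M (U - B) < ennreal e"
      by (simp add: ennreal_add_left_cancel_less)
    then have "(LINT t|lborel. \<bar>w t * indicator (U - B) (y t)\<bar>) < e"
      using M[of "U - B"] intB[of "U - B"] \<open>e > 0\<close>
        nn_integral_eq_integral[OF integrable_abs[OF intB[of "U - B"]]]
      by (simp add: abs_mult ennreal_less_iff)
    then have "\<bar>LINT t|lborel. w t * indicator (U - B) (y t)\<bar> < e"
      using integral_abs_bound[of lborel "\<lambda>t. w t * indicator (U - B) (y t)"] by linarith
    moreover have "(LINT t|lborel. w t * indicator U (y t))
        = (LINT t|lborel. w t * indicator B (y t)) + (LINT t|lborel. w t * indicator (U - B) (y t))"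
    proof -
      have "w t * indicator U (y t) = w t * indicator B (y t) + w t * indicator (U - B) (y t)" for t
        using U(1) by (auto simp: indicator_def)
      then show ?thesis
        using Bochner_Integration.integral_add[OF intB[of B] intB[of "U - B"]] by simp
    qed
    ultimately show "0 \<le> (LINT t|lborel. w t * indicator B (y t)) + e"
      using opn[OF U(2)] by linarith
  qed
  show ?thesis
  proof (rule sigma_finite_measure.density_nonneg[OF lborel.sigma_finite_measure_axioms w])
    fix A :: "real set" assume A: "A \<in> sets lborel"
    \<comment> \<open>The image of the nonnegative part of \<open>A\<close> under exp (- t): for t
      \<ge> 0, \<open>y t \<in> B\<close> holds exactly if \<open>t \<in> A\<close>.\<close>
    define B where "B = {0<..1} \<inter> (\<lambda>z. - ln z) -` A"
    have [measurable]: "A \<in> sets borel" using A by simp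
    have B: "B \<in> sets borel"
    proof -
      have "(\<lambda>z::real. - ln z) -` A \<inter> space borel \<in> sets borel" by measurable
      then show ?thesis unfolding B_def by auto
    qed
    have "w t * indicator B (y t) = indicator A t * w t" for t
      using supp[of t] by (cases "t < 0") (auto simp: B_def y_def indicator_def)
    with bor[OF B] show "0 \<le> set_lebesgue_integral lborel A w"
      by (simp add: set_lebesgue_integral_def)
  qed
qed

section \<open>Convolution and Laplace transform of nonnegative functions\<close>

text \<open>Integration runs over the whole line, so that reflections and Tonelli's theorem involve
  no limits of integration. For functions vanishing off the positive half-line this is the
  convolution over (0, t).\<close>

definition nnconv :: "(real \<Rightarrow> ennreal) \<Rightarrow> (real \<Rightarrow> ennreal) \<Rightarrow> real \<Rightarrow> ennreal" where
  "nnconv f g t = (\<integral>\<^sup>+z. f (t - z) * g z \<partial>lborel)"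

definition nnlap :: "(real \<Rightarrow> ennreal) \<Rightarrow> real \<Rightarrow> ennreal" where
  "nnlap f x = (\<integral>\<^sup>+t. ennreal (exp (- x * t)) * f t \<partial>lborel)"

lemma nn_integral_lborel_shift:
  fixes f :: "real \<Rightarrow> ennreal"
  assumes "f \<in> borel_measurable borel"
  shows "(\<integral>\<^sup>+x. f (x - c) \<partial>lborel) = (\<integral>\<^sup>+x. f x \<partial>lborel)"
  using nn_integral_real_affine[of f 1 "- c"] assms by simp

lemma measurable_nnconv [measurable]:
  assumes [measurable]: "f \<in> borel_measurable borel" "g \<in> borel_measurable borel"
  shows "nnconv f g \<in> borel_measurable borel"
proof -
  have "(\<lambda>t. \<integral>\<^sup>+z. f (t - z) * g z \<partial>lborel) \<in> borel_measurable borel"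
    by measurable
  then show ?thesis unfolding nnconv_def .
qed

lemma nnlap_nnconv:
  assumes [measurable]: "f \<in> borel_measurable borel" "g \<in> borel_measurable borel"
  shows "nnlap (nnconv f g) x = nnlap f x * nnlap g x"
proof -
  have "nnlap (nnconv f g) x
      = (\<integral>\<^sup>+t. (\<integral>\<^sup>+z. ennreal (exp (- x * t)) * (f (t - z) * g z) \<partial>lborel) \<partial>lborel)"
    by (simp add: nnlap_def nnconv_def nn_integral_cmult)
  also have "\<dots> = (\<integral>\<^sup>+z. (\<integral>\<^sup>+t. ennreal (exp (- x * t)) * (f (t - z) * g z) \<partial>lborel) \<partial>lborel)"
    by (intro lborel_pair.Fubini') measurable
  also have "\<dots> = (\<integral>\<^sup>+z. (\<integral>\<^sup>+t. (ennreal (exp (- x * z)) * g z) * (ennreal (exp (- x * (t - z))) * f (t - z)) \<partial>lborel) \<partial>lborel)"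
  proof (intro nn_integral_cong)
    fix z t
    have "exp (- x * t) = exp (- x * z) * exp (- x * (t - z))"
      by (simp add: mult_exp_exp algebra_simps)
    then have "ennreal (exp (- x * t)) = ennreal (exp (- x * z)) * ennreal (exp (- x * (t - z)))"
      by (simp add: ennreal_mult')
    then show "ennreal (exp (- x * t)) * (f (t - z) * g z)
        = (ennreal (exp (- x * z)) * g z) * (ennreal (exp (- x * (t - z))) * f (t - z))"
      by (simp only: mult.assoc mult.left_commute mult.commute)
  qed
  also have "\<dots> = (\<integral>\<^sup>+z. (ennreal (exp (- x * z)) * g z) * nnlap f x \<partial>lborel)"
  proof (intro nn_integral_cong)
    fix z
    show "(\<integral>\<^sup>+t. (ennreal (exp (- x * z)) * g z) * (ennreal (exp (- x * (t - z))) * f (t - z)) \<partial>lborel)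
      = (ennreal (exp (- x * z)) * g z) * nnlap f x"
      unfolding nnlap_def
      by (subst nn_integral_cmult, measurable)
        (subst nn_integral_lborel_shift[where f="\<lambda>t. ennreal (exp (- x * t)) * f t"], measurable)
  qed
  also have "\<dots> = nnlap f x * nnlap g x"
    by (subst nn_integral_multc) (simp_all add: nnlap_def mult.commute)
  finally show ?thesis .
qed

lemma nnconv_commute:
  assumes [measurable]: "f \<in> borel_measurable borel" "g \<in> borel_measurable borel"
  shows "nnconv f g = nnconv g f"
proof
  fix t
  show "nnconv f g t = nnconv g f t"
    unfolding nnconv_def
    by (subst nn_integral_real_affine[where c="-1" and t=t]) (simp_all add: mult.commute)
qed

lemma nnconv_cong_AE:
  assumes "AE z in lborel. g z = g' z"
  shows "nnconv f g t = nnconv f g' t"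
  unfolding nnconv_def using assms by (intro nn_integral_cong_AE) auto

lemma nnconv_mono_AE:
  assumes "AE z in lborel. g z \<le> g' z"
  shows "nnconv f g t \<le> nnconv f g' t"
  unfolding nnconv_def
  by (intro nn_integral_mono_AE eventually_mono[OF assms]) (auto intro: mult_left_mono)

lemma nnconv_add:
  assumes [measurable]: "f \<in> borel_measurable borel" "g \<in> borel_measurable borel" "h \<in> borel_measurable borel"
  shows "nnconv f (\<lambda>z. g z + h z) t = nnconv f g t + nnconv f h t"
  unfolding nnconv_def distrib_left by (rule nn_integral_add) measurable

lemma nnconv_suminf:
  assumes [measurable]: "f \<in> borel_measurable borel" "\<And>n. g n \<in> borel_measurable borel"
  shows "nnconv f (\<lambda>z. \<Sum>n. g n z) t = (\<Sum>n. nnconv f (g n) t)"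
  unfolding nnconv_def ennreal_suminf_cmult[symmetric] by (rule nn_integral_suminf) measurable

lemma nnconv_nonpos:
  assumes "\<And>t. t \<le> 0 \<Longrightarrow> f t = 0" "\<And>t. t \<le> 0 \<Longrightarrow> g t = 0" "t \<le> 0"
  shows "nnconv f g t = 0"
proof -
  have "(\<lambda>z. f (t - z) * g z) = (\<lambda>_. 0)"
  proof
    fix z show "f (t - z) * g z = 0"
      using assms by (cases "z \<le> 0") auto
  qed
  then show ?thesis by (simp add: nnconv_def)
qed

lemma nnlap_cong_AE: "AE t in lborel. f t = g t \<Longrightarrow> nnlap f x = nnlap g x"
  unfolding nnlap_def by (intro nn_integral_cong_AE) auto

lemma nnlap_mono_AE:
  assumes "AE t in lborel. f t \<le> g t"
  shows "nnlap f x \<le> nnlap g x"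
  unfolding nnlap_def
  by (intro nn_integral_mono_AE eventually_mono[OF assms]) (auto intro: mult_left_mono)

lemma nnlap_add:
  assumes [measurable]: "f \<in> borel_measurable borel" "g \<in> borel_measurable borel"
  shows "nnlap (\<lambda>t. f t + g t) x = nnlap f x + nnlap g x"
  unfolding nnlap_def distrib_left by (rule nn_integral_add) measurable

lemma nnlap_cmult:
  assumes [measurable]: "f \<in> borel_measurable borel"
  shows "nnlap (\<lambda>t. c * f t) x = c * nnlap f x"
  unfolding nnlap_def by (subst nn_integral_cmult[symmetric]) (auto simp: mult_ac)

lemma nnlap_suminf:
  assumes [measurable]: "\<And>n. f n \<in> borel_measurable borel"
  shows "nnlap (\<lambda>t. \<Sum>n. f n t) x = (\<Sum>n. nnlap (f n) x)"
  unfolding nnlap_def ennreal_suminf_cmult[symmetric] by (rule nn_integral_suminf) measurable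

lemma nnlap_nn_integral:
  assumes [measurable]: "(\<lambda>(u, t). F u t) \<in> borel_measurable (borel \<Otimes>\<^sub>M borel)"
  shows "nnlap (\<lambda>t. \<integral>\<^sup>+u. F u t \<partial>lborel) x = (\<integral>\<^sup>+u. nnlap (F u) x \<partial>lborel)"
proof -
  have "nnlap (\<lambda>t. \<integral>\<^sup>+u. F u t \<partial>lborel) x
      = (\<integral>\<^sup>+t. (\<integral>\<^sup>+u. ennreal (exp (- x * t)) * F u t \<partial>lborel) \<partial>lborel)"
    by (simp add: nnlap_def nn_integral_cmult)
  also have "\<dots> = (\<integral>\<^sup>+u. (\<integral>\<^sup>+t. ennreal (exp (- x * t)) * F u t \<partial>lborel) \<partial>lborel)"
    by (intro lborel_pair.Fubini') measurable
  finally show ?thesis by (simp add: nnlap_def)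
qed

lemma exp_weight_mono:
  fixes f :: "real \<Rightarrow> ennreal"
  assumes "\<And>t. t \<le> 0 \<Longrightarrow> f t = 0" "x \<le> y"
  shows "ennreal (exp (- y * t)) * f t \<le> ennreal (exp (- x * t)) * f t"
proof (cases "t \<le> 0")
  case False
  then have "- y * t \<le> - x * t" using assms(2) by simp
  then show ?thesis by (intro mult_right_mono ennreal_leI) auto
qed (simp add: assms)

lemma nnlap_antimono:
  assumes "\<And>t. t \<le> 0 \<Longrightarrow> f t = 0" "x \<le> y"
  shows "nnlap f y \<le> nnlap f x"
  unfolding nnlap_def
  by (rule nn_integral_mono) (rule exp_weight_mono[OF assms])

lemma nnlap_eq_0_iff:
  assumes [measurable]: "f \<in> borel_measurable borel"
  shows "nnlap f x = 0 \<longleftrightarrow> (AE t in lborel. f t = 0)"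
proof -
  have "nnlap f x = 0 \<longleftrightarrow> (AE t in lborel. ennreal (exp (- x * t)) * f t = 0)"
    unfolding nnlap_def by (subst nn_integral_0_iff_AE) auto
  then show ?thesis by (simp add: ennreal_eq_0_iff not_le)
qed

lemma nnlap_finite_AE:
  assumes [measurable]: "f \<in> borel_measurable borel" and fin: "nnlap f x < \<infinity>"
  shows "AE t in lborel. f t < \<infinity>"
proof -
  have "AE t in lborel. ennreal (exp (- x * t)) * f t \<noteq> \<infinity>"
    using fin unfolding nnlap_def by (intro nn_integral_PInf_AE) auto
  then show ?thesis
    by eventually_elim (auto simp: ennreal_mult_eq_top_iff less_top)
qed

lemma nnlap_indicator:
  assumes "0 < x"
  shows "nnlap (indicator {0<..}) x = ennreal (1 / x)"
proof -
  have "nnlap (indicator {0<..}) x = (\<integral>\<^sup>+t. ennreal (exp (- x * t)) * indicator {0..} t \<partial>lborel)"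
    unfolding nnlap_def
    by (intro nn_integral_cong_AE eventually_mono[OF AE_lborel_singleton[of 0]]) (auto simp: indicator_def)
  also have "\<dots> = ennreal (0 - (- exp (- x * 0) / x))"
  proof (rule nn_integral_FTC_atLeast)
    show "((\<lambda>t. - exp (- x * t) / x) has_real_derivative exp (- x * t)) (at t)" for t
      using assms by (auto intro!: derivative_eq_intros)
    have "filterlim (\<lambda>t. - x * t) at_bot at_top"
      using assms by (intro filterlim_tendsto_neg_mult_at_bot[where c="-x"] tendsto_const filterlim_ident) auto
    then have "((\<lambda>t. exp (- x * t)) \<longlongrightarrow> 0) at_top"
      by (rule filterlim_compose[OF exp_at_bot])
    from tendsto_divide[OF tendsto_minus[OF this] tendsto_const[of x]]
    show "((\<lambda>t. - exp (- x * t) / x) \<longlongrightarrow> 0) at_top" using assms by simp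
  qed auto
  finally show ?thesis by simp
qed

text \<open>Provides an abscissa beyond which Neumann series converge and Volterra operators
  contract.\<close>

lemma nnlap_tendsto_0:
  assumes [measurable]: "f \<in> borel_measurable borel" and supp: "\<And>t. t \<le> 0 \<Longrightarrow> f t = 0"
    and fin: "nnlap f x < \<infinity>"
  shows "(\<lambda>n. nnlap f (x + real n)) \<longlonglongrightarrow> 0"
proof -
  have "(\<lambda>n. \<integral>\<^sup>+t. ennreal (exp (- (x + real n) * t)) * f t \<partial>lborel) \<longlonglongrightarrow> (\<integral>\<^sup>+t. 0 \<partial>(lborel::real measure))"
  proof (rule nn_integral_dominated_convergence[where w="\<lambda>t. ennreal (exp (- x * t)) * f t"])
    show "AE t in lborel. ennreal (exp (- (x + real n) * t)) * f t \<le> ennreal (exp (- x * t)) * f t" for n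
      by (rule AE_I2, rule exp_weight_mono[OF supp]) auto
    have "AE t in lborel. f t < \<infinity>" by (rule nnlap_finite_AE[OF _ fin]) simp
    then show "AE t in lborel. (\<lambda>n. ennreal (exp (- (x + real n) * t)) * f t) \<longlonglongrightarrow> 0"
    proof eventually_elim
      case (elim t)
      show ?case
      proof (cases "t \<le> 0")
        case True
        then show ?thesis using supp by simp
      next
        case False
        have "(\<lambda>n. exp (- (x + real n) * t)) = (\<lambda>n. exp (- x * t) * exp (- t) ^ n)"
          by (auto simp: fun_eq_iff algebra_simps exp_of_nat_mult[symmetric] mult_exp_exp)
        moreover have "(\<lambda>n. exp (- x * t) * exp (- t) ^ n) \<longlonglongrightarrow> exp (- x * t) * 0"
          using False by (intro tendsto_intros LIMSEQ_power_zero) auto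
        ultimately have "(\<lambda>n. ennreal (exp (- (x + real n) * t))) \<longlonglongrightarrow> ennreal 0"
          by (intro tendsto_ennrealI) simp
        then have "(\<lambda>n. ennreal (exp (- (x + real n) * t)) * f t) \<longlonglongrightarrow> ennreal 0 * f t"
          using elim by (intro tendsto_mult_ennreal tendsto_const) auto
        then show ?thesis by simp
      qed
    qed
  qed (use fin in \<open>auto simp: nnlap_def\<close>)
  then show ?thesis by (simp add: nnlap_def)
qed

text \<open>The moments in exp (- t) of exp (- x t) (f - g) are the differences of the transforms at
  \<open>x + k\<close>, so Hausdorff's criterion applies. Two functions are compared because
  \<open>ennreal\<close> carries no signs.\<close>

lemma nnlap_cm_diff:
  assumes [measurable]: "f \<in> borel_measurable borel" "g \<in> borel_measurable borel"
    and supp: "\<And>t. t \<le> 0 \<Longrightarrow> f t = 0" "\<And>t. t \<le> 0 \<Longrightarrow> g t = 0"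
    and fin: "nnlap f x < \<infinity>" "nnlap g x < \<infinity>"
    and cm: "cm_seq (\<lambda>k. enn2real (nnlap f (x + real k)) - enn2real (nnlap g (x + real k)))"
  shows "AE t in lborel. g t \<le> f t"
proof -
  define W where "W h t = exp (- x * t) * enn2real (h t)" for h t
  have *: "integrable lborel (\<lambda>t. W h t * exp (- (real k * t)))"
    "(LINT t|lborel. W h t * exp (- (real k * t))) = enn2real (nnlap h (x + real k))"
    if [measurable]: "h \<in> borel_measurable borel" and supp: "\<And>t. t \<le> 0 \<Longrightarrow> h t = 0" and fin: "nnlap h x < \<infinity>" for h k
  proof -
    have eq: "(\<integral>\<^sup>+t. ennreal (W h t * exp (- (real k * t))) \<partial>lborel) = nnlap h (x + real k)"
      unfolding nnlap_def
    proof (intro nn_integral_cong_AE eventually_mono[OF nnlap_finite_AE[OF _ fin]])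
      fix t assume "h t < \<infinity>"
      then have "h t = ennreal (enn2real (h t))" by (simp add: less_top)
      then have "ennreal (exp (- (x + real k) * t)) * h t = ennreal (exp (- (x + real k) * t) * enn2real (h t))"
        by (metis ennreal_mult' exp_ge_zero)
      also have "exp (- (x + real k) * t) * enn2real (h t) = W h t * exp (- (real k * t))"
        by (simp add: W_def mult_exp_exp algebra_simps)
      finally show "ennreal (W h t * exp (- (real k * t))) = ennreal (exp (- (x + real k) * t)) * h t" ..
    qed simp
    have fin': "nnlap h (x + real k) < \<infinity>"
      using nnlap_antimono[where f=h and x=x and y="x + real k", OF supp] fin by (auto intro: le_less_trans)
    show "integrable lborel (\<lambda>t. W h t * exp (- (real k * t)))"
      by (rule integrableI_nonneg) (use eq fin' in \<open>auto simp: W_def\<close>)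
    show "(LINT t|lborel. W h t * exp (- (real k * t))) = enn2real (nnlap h (x + real k))"
      by (subst integral_eq_nn_integral) (use eq in \<open>auto simp: W_def\<close>)
  qed
  note f = *[OF _ supp(1) fin(1), simplified] and g = *[OF _ supp(2) fin(2), simplified]
  have "AE t in lborel. 0 \<le> W f t - W g t"
  proof (rule cm_moments_AE_nonneg)
    show "integrable lborel (\<lambda>t. W f t - W g t)"
      using f(1)[of 0] g(1)[of 0] by simp
    show "W f t - W g t = 0" if "t < 0" for t
      using supp that by (simp add: W_def)
    show "cm_seq (\<lambda>k. LINT t|lborel. (W f t - W g t) * exp (- (real k * t)))"
      using cm f g by (simp add: left_diff_distrib)
  qed
  moreover have "AE t in lborel. f t < \<infinity>" "AE t in lborel. g t < \<infinity>"
    by (rule nnlap_finite_AE[OF _ fin(1)], measurable) (rule nnlap_finite_AE[OF _ fin(2)], measurable)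
  ultimately show ?thesis
  proof eventually_elim
    case (elim t)
    then have "enn2real (g t) \<le> enn2real (f t)" by (simp add: W_def)
    then have "ennreal (enn2real (g t)) \<le> ennreal (enn2real (f t))" by (rule ennreal_leI)
    with elim show ?case by (simp add: less_top)
  qed
qed

text \<open>Lerch's theorem: the difference of the transforms is the zero sequence, which is
  completely monotone whichever function is subtracted.\<close>

lemma nnlap_inj:
  assumes "f \<in> borel_measurable borel" "g \<in> borel_measurable borel"
    and "\<And>t. t \<le> 0 \<Longrightarrow> f t = 0" "\<And>t. t \<le> 0 \<Longrightarrow> g t = 0"
    and fin: "nnlap f x < \<infinity>" and eq: "\<And>y. x \<le> y \<Longrightarrow> nnlap f y = nnlap g y"
  shows "AE t in lborel. f t = g t"
proof -
  have "AE t in lborel. g t \<le> f t" "AE t in lborel. f t \<le> g t"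
    by (rule nnlap_cm_diff[of _ _ x]; use assms in \<open>simp add: cm_seq_const\<close>)+
  then show ?thesis by eventually_elim simp
qed

text \<open>For t > 0 the values exp (- (x + k) t) form a geometric sequence with ratio in (0, 1),
  and integration in \<open>t\<close> preserves complete monotonicity.\<close>

lemma nnlap_cm_seq:
  assumes [measurable]: "f \<in> borel_measurable borel" and supp: "\<And>t. t \<le> 0 \<Longrightarrow> f t = 0"
    and fin: "nnlap f x < \<infinity>"
  shows "cm_seq (\<lambda>k. enn2real (nnlap f (x + real k)))"
proof -
  define W where "W t k = exp (- (x + real k) * t) * enn2real (f t)" for t and k :: nat
  have *: "integrable lborel (\<lambda>t. W t k)" "(LINT t|lborel. W t k) = enn2real (nnlap f (x + real k))" for k
  proof -
    have eq: "(\<integral>\<^sup>+t. ennreal (W t k) \<partial>lborel) = nnlap f (x + real k)"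
      unfolding nnlap_def
    proof (intro nn_integral_cong_AE eventually_mono[OF nnlap_finite_AE[OF _ fin]])
      fix t assume "f t < \<infinity>"
      then have "f t = ennreal (enn2real (f t))" by (simp add: less_top)
      then show "ennreal (W t k) = ennreal (exp (- (x + real k) * t)) * f t"
        unfolding W_def by (metis ennreal_mult' exp_ge_zero)
    qed simp
    have fin': "nnlap f (x + real k) < \<infinity>"
      using nnlap_antimono[where f=f and x=x and y="x + real k", OF supp] fin by (auto intro: le_less_trans)
    show "integrable lborel (\<lambda>t. W t k)"
      by (rule integrableI_nonneg) (use eq fin' in \<open>auto simp: W_def\<close>)
    show "(LINT t|lborel. W t k) = enn2real (nnlap f (x + real k))"
      by (subst integral_eq_nn_integral) (use eq in \<open>auto simp: W_def\<close>)
  qed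
  have "cm_seq (W t)" for t
  proof (cases "t \<le> 0")
    case True
    then show ?thesis using supp by (simp add: W_def[abs_def] cm_seq_const)
  next
    case False
    have "cm_seq (\<lambda>k. exp (- t) ^ k)"
      using False by (simp add: cm_seq_def funpow_diff_seq_power)
    then have "cm_seq (\<lambda>k. (exp (- x * t) * enn2real (f t)) * exp (- t) ^ k)"
      by (intro cm_seq_cmult) auto
    also have "(\<lambda>k. (exp (- x * t) * enn2real (f t)) * exp (- t) ^ k) = W t"
      by (auto simp: W_def fun_eq_iff algebra_simps exp_of_nat_mult[symmetric] mult_exp_exp)
    finally show ?thesis .
  qed
  then have "cm_seq (\<lambda>k. LINT t|lborel. W t k)"
    using * by (intro cm_seq_integral) auto
  with * show ?thesis by simp
qed

section \<open>Nonnegative versions of locally integrable functions\<close>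

text \<open>
  Borel measurable, \<open>[0, \<infinity>]\<close>-valued versions vanishing off the positive half-line let
  Tonelli's theorem apply to convolutions and Laplace transforms without integrability conditions.
\<close>

definition ennreal_version :: "(real \<Rightarrow> real) \<Rightarrow> (real \<Rightarrow> ennreal) \<Rightarrow> bool" where
  "ennreal_version f F \<longleftrightarrow> F \<in> borel_measurable borel \<and> (\<forall>t\<le>0. F t = 0)
     \<and> (\<forall>T. (\<integral>\<^sup>+t. F t * indicator {..T} t \<partial>lborel) < \<infinity>)
     \<and> (AE t in lborel. 0 < t \<longrightarrow> 0 \<le> f t \<and> F t = ennreal (f t))"

lemma ennreal_version_measurable: "ennreal_version f F \<Longrightarrow> F \<in> borel_measurable borel"
  by (simp add: ennreal_version_def)

lemma ennreal_version_nonpos: "ennreal_version f F \<Longrightarrow> t \<le> 0 \<Longrightarrow> F t = 0"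
  by (simp add: ennreal_version_def)

lemma ennreal_version_locally_finite: "ennreal_version f F \<Longrightarrow> (\<integral>\<^sup>+t. F t * indicator {..T} t \<partial>lborel) < \<infinity>"
  by (simp add: ennreal_version_def)

lemma ennreal_version_AE: "ennreal_version f F \<Longrightarrow> AE t in lborel. 0 < t \<longrightarrow> 0 \<le> f t \<and> F t = ennreal (f t)"
  by (simp add: ennreal_version_def)

lemma ennreal_version_cong_AE:
  assumes "ennreal_version f F" "AE t in lborel. 0 < t \<longrightarrow> f' t = f t"
  shows "ennreal_version f' F"
proof -
  have "AE t in lborel. 0 < t \<longrightarrow> 0 \<le> f' t \<and> F t = ennreal (f' t)"
    using ennreal_version_AE[OF assms(1)] assms(2) by eventually_elim auto
  with assms(1) show ?thesis by (simp add: ennreal_version_def)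
qed

lemma AE_finite_of_locally_finite:
  assumes [measurable]: "F \<in> borel_measurable borel"
    and fin: "\<And>T. (\<integral>\<^sup>+t. F t * indicator {..T} t \<partial>lborel) < \<infinity>"
  shows "AE t::real in lborel. F t < (\<infinity>::ennreal)"
proof -
  have "AE t in lborel. F t * indicator {..real n} t \<noteq> \<infinity>" for n :: nat
    using fin[of "real n"] by (intro nn_integral_PInf_AE) auto
  then have "AE t in lborel. \<forall>n::nat. F t * indicator {..real n} t \<noteq> \<infinity>"
    by (simp add: AE_all_countable)
  then show ?thesis
  proof eventually_elim
    case (elim t)
    obtain n where "t \<le> real n" using real_arch_simple by blast
    with elim[rule_format, of n] show ?case by (simp add: less_top)
  qed
qed

lemma ennreal_version_enn2real:
  assumes "F \<in> borel_measurable borel" "\<And>t. t \<le> 0 \<Longrightarrow> F t = 0"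
    and "\<And>T. (\<integral>\<^sup>+t. F t * indicator {..T} t \<partial>lborel) < \<infinity>"
  shows "ennreal_version (\<lambda>t. enn2real (F t)) F"
  using assms AE_finite_of_locally_finite[OF assms(1,3)]
  by (auto simp: ennreal_version_def elim: eventually_mono)

lemma locally_finite_of_nnlap:
  assumes [measurable]: "F \<in> borel_measurable borel" and supp: "\<And>t. t \<le> 0 \<Longrightarrow> F t = 0"
    and fin: "nnlap F x < \<infinity>" and "0 \<le> x"
  shows "(\<integral>\<^sup>+t. F t * indicator {..T} t \<partial>lborel) < \<infinity>"
proof -
  have "(\<integral>\<^sup>+t. F t * indicator {..T} t \<partial>lborel)
      \<le> (\<integral>\<^sup>+t. ennreal (exp (x * T)) * (ennreal (exp (- x * t)) * F t) \<partial>lborel)"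
  proof (rule nn_integral_mono)
    fix t
    show "F t * indicator {..T} t \<le> ennreal (exp (x * T)) * (ennreal (exp (- x * t)) * F t)"
    proof (cases "t \<le> T")
      case True
      then have "1 \<le> exp (x * T) * exp (- x * t)"
        using \<open>0 \<le> x\<close> by (simp add: mult_exp_exp mult_left_mono)
      then have "1 * F t \<le> ennreal (exp (x * T) * exp (- x * t)) * F t"
        by (intro mult_right_mono) (auto simp flip: ennreal_1 intro: ennreal_leI)
      then show ?thesis using True by (simp add: ennreal_mult' mult.assoc)
    qed simp
  qed
  also have "\<dots> = ennreal (exp (x * T)) * nnlap F x"
    by (subst nn_integral_cmult) (auto simp: nnlap_def)
  also have "\<dots> < \<infinity>" using fin by (simp add: ennreal_mult_less_top)
  finally show ?thesis .
qed

text \<open>The bridge between the completed measure of the given definitions and the Borel setting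
  in which Tonelli's theorem is used.\<close>

lemma lebesgue_AE_eq_borel:
  fixes f g :: "real \<Rightarrow> real"
  assumes [measurable]: "g \<in> borel_measurable borel" and eq: "AE t in lborel. f t = g t"
  shows "f \<in> borel_measurable lebesgue"
    and "integrable lebesgue f \<longleftrightarrow> integrable lborel g"
    and "(LINT t|lebesgue. f t) = (LINT t|lborel. g t)"
proof -
  have g: "g \<in> borel_measurable lebesgue" by (rule measurable_completion) simp
  have eq': "AE t in lebesgue. g t = f t"
    using AE_completion[OF eq] by eventually_elim simp
  show f: "f \<in> borel_measurable lebesgue"
    by (rule borel_measurable_AE[OF g eq'])
  show "integrable lebesgue f \<longleftrightarrow> integrable lborel g"
    using integrable_cong_AE[OF g f eq'] by (simp add: integrable_completion)
  show "(LINT t|lebesgue. f t) = (LINT t|lborel. g t)"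
    using integral_cong_AE[OF g f eq'] by (simp add: integral_completion)
qed

lemma ennreal_version_set_integrable:
  assumes F: "ennreal_version f F"
  shows "set_integrable lebesgue {0..T} f"
proof -
  note [measurable] = ennreal_version_measurable[OF F]
  have "AE t in lborel. indicator {0..T} t *\<^sub>R f t = indicator {..T} t * enn2real (F t)"
    using ennreal_version_AE[OF F] AE_lborel_singleton[of 0]
  proof eventually_elim
    case (elim t)
    then show ?case using ennreal_version_nonpos[OF F, of t] by (cases "t < 0") (auto simp: indicator_def)
  qed
  moreover have "integrable lborel (\<lambda>t. indicator {..T} t * enn2real (F t))"
  proof (rule integrableI_nonneg)
    have "(\<integral>\<^sup>+t. ennreal (indicator {..T} t * enn2real (F t)) \<partial>lborel)
        \<le> (\<integral>\<^sup>+t. F t * indicator {..T} t \<partial>lborel)"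
      by (intro nn_integral_mono) (auto simp: indicator_def ennreal_enn2real_if)
    also have "\<dots> < \<infinity>" by (rule ennreal_version_locally_finite[OF F])
    finally show "(\<integral>\<^sup>+t. ennreal (indicator {..T} t * enn2real (F t)) \<partial>lborel) < \<infinity>" .
  qed auto
  ultimately show ?thesis
    unfolding set_integrable_def by (subst lebesgue_AE_eq_borel(2)) auto
qed

lemma ennreal_version_L1_loc: "ennreal_version f F \<Longrightarrow> f \<in> L1_loc"
  by (simp add: L1_loc_def ennreal_version_set_integrable)

lemma L1_loc_AE_eq_borel:
  assumes "f \<in> L1_loc"
  obtains g where "g \<in> borel_measurable borel" "AE t in lborel. 0 < t \<longrightarrow> f t = g t"
proof -
  have "(\<lambda>t. indicator {0..real n + 1} t *\<^sub>R f t) \<in> borel_measurable lebesgue" for n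
    using assms by (auto simp: L1_loc_def set_integrable_def intro!: borel_measurable_integrable)
  moreover have "(\<lambda>n. indicator {0..real n + 1} t *\<^sub>R f t) \<longlonglongrightarrow> indicator {0..} t *\<^sub>R f t" for t
  proof (rule tendsto_eventually)
    obtain N where "t \<le> real N" using real_arch_simple by blast
    then show "\<forall>\<^sub>F n in sequentially. indicator {0..real n + 1} t *\<^sub>R f t = indicator {0..} t *\<^sub>R f t"
      by (intro eventually_sequentiallyI[of N]) (auto simp: indicator_def)
  qed
  ultimately have "(\<lambda>t. indicator {0..} t *\<^sub>R f t) \<in> borel_measurable lebesgue"
    by (rule borel_measurable_LIMSEQ_real[rotated])
  from completion_ex_borel_measurable_real[OF this]
  obtain g where "g \<in> borel_measurable lborel" "AE t in lborel. indicator {0..} t *\<^sub>R f t = g t"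
    by auto
  moreover from this(2) have "AE t in lborel. 0 < t \<longrightarrow> f t = g t"
    by eventually_elim auto
  ultimately show thesis using that by auto
qed

lemma ennreal_version_exists:
  assumes f: "f \<in> L1_loc" and nonneg: "AE t in lebesgue. 0 < t \<longrightarrow> 0 \<le> f t"
  shows "\<exists>F. ennreal_version f F"
proof -
  obtain g where [measurable]: "g \<in> borel_measurable borel" and g: "AE t in lborel. 0 < t \<longrightarrow> f t = g t"
    using L1_loc_AE_eq_borel[OF f] by blast
  define F where "F t = ennreal (g t) * indicator {0<..} t" for t
  have [measurable]: "F \<in> borel_measurable borel" unfolding F_def by measurable
  have ae: "AE t in lborel. 0 < t \<longrightarrow> 0 \<le> f t \<and> F t = ennreal (f t)"
    using nonneg[unfolded AE_completion_iff] g by eventually_elim (auto simp: F_def)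
  have "(\<integral>\<^sup>+t. F t * indicator {..T} t \<partial>lborel) < \<infinity>" for T
  proof -
    have "set_integrable lebesgue {0..max 1 T} f"
      using f by (auto simp: L1_loc_def)
    then have fin: "(\<integral>\<^sup>+t. ennreal (norm (indicator {0..max 1 T} t *\<^sub>R f t)) \<partial>lborel) < \<infinity>"
      by (simp add: set_integrable_def integrable_iff_bounded nn_integral_completion)
    have "(\<integral>\<^sup>+t. F t * indicator {..T} t \<partial>lborel) \<le> (\<integral>\<^sup>+t. ennreal (norm (indicator {0..max 1 T} t *\<^sub>R f t)) \<partial>lborel)"
    proof (intro nn_integral_mono_AE eventually_mono[OF ae])
      fix t assume "0 < t \<longrightarrow> 0 \<le> f t \<and> F t = ennreal (f t)"
      then show "F t * indicator {..T} t \<le> ennreal (norm (indicator {0..max 1 T} t *\<^sub>R f t))"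
        by (cases "0 < t") (auto simp: indicator_def F_def)
    qed
    with fin show ?thesis by (rule le_less_trans[rotated])
  qed
  then have "ennreal_version f F" using ae by (auto simp: ennreal_version_def F_def)
  then show ?thesis by blast
qed

lemma AE_lborel_reflect:
  assumes "AE z in lborel. P z"
  shows "AE z in lborel. P (t - z :: real)"
proof -
  obtain N where N: "{z. \<not> P z} \<subseteq> N" "emeasure lborel N = 0" "N \<in> sets lborel"
    using AE_E[OF assms] by auto
  then have [measurable]: "N \<in> sets borel" by simp
  have "AE z in lborel. z \<notin> N"
    using N by (intro AE_not_in) auto
  then have "AE z in lborel. t + (- 1) * z \<notin> N"
    by (intro AE_borel_affine) auto
  then show ?thesis by (rule eventually_mono) (use N(1) in auto)
qed

lemma nnconv_truncate_le:
  assumes "\<And>t. t \<le> 0 \<Longrightarrow> F t = 0" "\<And>t. t \<le> 0 \<Longrightarrow> G t = 0"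
  shows "nnconv F G t * indicator {..T} t
       \<le> nnconv (\<lambda>t. F t * indicator {..T} t) (\<lambda>t. G t * indicator {..T} t) t"
proof (cases "t \<le> T")
  case True
  have "F (t - z) * G z \<le> F (t - z) * indicator {..T} (t - z) * (G z * indicator {..T} z)" for z
    using assms(1)[of "t - z"] assms(2)[of z] True by (cases "z \<le> 0 \<or> t \<le> z") (auto simp: indicator_def)
  then show ?thesis using True by (auto simp: nnconv_def intro!: nn_integral_mono)
qed simp

text \<open>Up to \<open>T\<close> the convolution sees only truncated factors. Their masses are
  finite, and the mass of a convolution, its transform at 0, is the product of the masses.\<close>

lemma nnconv_locally_finite:
  assumes [measurable]: "F \<in> borel_measurable borel" "G \<in> borel_measurable borel"
    and "\<And>t. t \<le> 0 \<Longrightarrow> F t = 0" "\<And>t. t \<le> 0 \<Longrightarrow> G t = 0"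
    and fin: "(\<integral>\<^sup>+t. F t * indicator {..T} t \<partial>lborel) < \<infinity>" "(\<integral>\<^sup>+t. G t * indicator {..T} t \<partial>lborel) < \<infinity>"
  shows "(\<integral>\<^sup>+t. nnconv F G t * indicator {..T} t \<partial>lborel) < \<infinity>"
proof -
  have "(\<integral>\<^sup>+t. nnconv F G t * indicator {..T} t \<partial>lborel)
      \<le> nnlap (nnconv (\<lambda>t. F t * indicator {..T} t) (\<lambda>t. G t * indicator {..T} t)) 0"
    unfolding nnlap_def using nnconv_truncate_le[OF assms(3,4)] by (auto intro!: nn_integral_mono)
  also have "\<dots> = nnlap (\<lambda>t. F t * indicator {..T} t) 0 * nnlap (\<lambda>t. G t * indicator {..T} t) 0"
    by (rule nnlap_nnconv) measurable
  also have "\<dots> < \<infinity>"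
    using fin by (simp add: nnlap_def ennreal_mult_less_top)
  finally show ?thesis .
qed

lemma conv_eq_nnconv:
  assumes F: "ennreal_version f F" and G: "ennreal_version g G" and fin: "nnconv F G t < \<infinity>"
  shows "conv f g t = enn2real (nnconv F G t)"
proof -
  note [measurable] = ennreal_version_measurable[OF F] ennreal_version_measurable[OF G]
  note supp = ennreal_version_nonpos[OF F] ennreal_version_nonpos[OF G]
  have ae: "AE z in lborel. indicator {0..t} z *\<^sub>R (f (t - z) * g z) = enn2real (F (t - z) * G z)"
    using AE_lborel_reflect[OF ennreal_version_AE[OF F], of t] ennreal_version_AE[OF G]
      AE_lborel_singleton[of 0] AE_lborel_singleton[of t]
  proof eventually_elim
    case (elim z)
    show ?case
    proof (cases "0 < z \<and> z < t")
      case True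
      with elim have "F (t - z) * G z = ennreal (f (t - z) * g z)" "0 \<le> f (t - z) * g z"
        by (auto simp: ennreal_mult)
      with True show ?thesis by simp
    next
      case False
      with elim supp(1)[of "t - z"] supp(2)[of z] show ?thesis by auto
    qed
  qed
  have "conv f g t = (LINT z|lborel. enn2real (F (t - z) * G z))"
    unfolding conv_def set_lebesgue_integral_def
    by (rule lebesgue_AE_eq_borel(3)[OF _ ae]) measurable
  also have "\<dots> = enn2real (\<integral>\<^sup>+z. ennreal (enn2real (F (t - z) * G z)) \<partial>lborel)"
    by (rule integral_eq_nn_integral) auto
  also have "(\<integral>\<^sup>+z. ennreal (enn2real (F (t - z) * G z)) \<partial>lborel) = nnconv F G t"
    unfolding nnconv_def
  proof (rule nn_integral_cong_AE)
    have "AE z in lborel. F (t - z) * G z \<noteq> \<infinity>"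
      using fin unfolding nnconv_def by (intro nn_integral_PInf_AE) auto
    then show "AE z in lborel. ennreal (enn2real (F (t - z) * G z)) = F (t - z) * G z"
      by eventually_elim (simp add: less_top)
  qed
  finally show ?thesis .
qed

lemma ennreal_version_conv:
  assumes F: "ennreal_version f F" and G: "ennreal_version g G"
  shows "ennreal_version (conv f g) (nnconv F G)"
proof -
  note [measurable] = ennreal_version_measurable[OF F] ennreal_version_measurable[OF G]
  note supp = ennreal_version_nonpos[OF F] ennreal_version_nonpos[OF G]
  have lf: "(\<integral>\<^sup>+t. nnconv F G t * indicator {..T} t \<partial>lborel) < \<infinity>" for T
    using supp ennreal_version_locally_finite[OF F] ennreal_version_locally_finite[OF G]
    by (intro nnconv_locally_finite) auto
  have "AE t in lborel. nnconv F G t < \<infinity>"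
    by (rule AE_finite_of_locally_finite[OF _ lf]) measurable
  then have "AE t in lborel. 0 < t \<longrightarrow> 0 \<le> conv f g t \<and> nnconv F G t = ennreal (conv f g t)"
    by (rule eventually_mono) (simp add: conv_eq_nnconv[OF F G])
  then show ?thesis
    using lf nnconv_nonpos[OF supp] by (simp add: ennreal_version_def)
qed

lemma ennreal_version_one: "ennreal_version (\<lambda>_. 1) (indicator {0<..})"
proof -
  have "(\<integral>\<^sup>+t. indicator {0<..} t * indicator {..T} t \<partial>lborel) < \<infinity>" for T :: real
  proof -
    have "(\<integral>\<^sup>+t. indicator {0<..} t * indicator {..T} t \<partial>lborel) = emeasure lborel {0<..T}"
      by (subst nn_integral_indicator[symmetric])
        (auto intro!: nn_integral_cong simp: indicator_inter_arith[symmetric] greaterThanAtMost_def)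
    then show ?thesis by (cases "0 \<le> T") auto
  qed
  then show ?thesis by (simp add: ennreal_version_def)
qed

lemma ennreal_version_laplace:
  assumes F: "ennreal_version f F" and fin: "nnlap F x < \<infinity>"
  shows "laplace_convergent f x" "laplace f x = enn2real (nnlap F x)"
proof -
  note [measurable] = ennreal_version_measurable[OF F]
  have ae: "AE t in lborel. indicator {0..} t *\<^sub>R (exp (- x * t) * f t) = exp (- x * t) * enn2real (F t)"
    using ennreal_version_AE[OF F] AE_lborel_singleton[of 0]
  proof eventually_elim
    case (elim t)
    then show ?case using ennreal_version_nonpos[OF F, of t] by (cases "t < 0") auto
  qed
  have eq: "(\<integral>\<^sup>+t. ennreal (exp (- x * t) * enn2real (F t)) \<partial>lborel) = nnlap F x"
    unfolding nnlap_def
  proof (intro nn_integral_cong_AE)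
    have "AE t in lborel. F t < \<infinity>" by (rule nnlap_finite_AE[OF _ fin]) simp
    then show "AE t in lborel. ennreal (exp (- x * t) * enn2real (F t)) = ennreal (exp (- x * t)) * F t"
      by eventually_elim (simp add: ennreal_mult' less_top)
  qed
  show "laplace_convergent f x"
    unfolding laplace_convergent_def set_integrable_def
    by (subst lebesgue_AE_eq_borel(2)[OF _ ae], measurable)
      (rule integrableI_nonneg, use eq fin in auto)
  have "laplace f x = (LINT t|lborel. exp (- x * t) * enn2real (F t))"
    unfolding laplace_def set_lebesgue_integral_def
    by (rule lebesgue_AE_eq_borel(3)[OF _ ae]) measurable
  also have "\<dots> = enn2real (nnlap F x)"
    unfolding eq[symmetric] by (rule integral_eq_nn_integral) auto
  finally show "laplace f x = enn2real (nnlap F x)" .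
qed

text \<open>The equation contains only sums of nonnegative terms, so it carries over to
  \<open>ennreal\<close> without any subtraction.\<close>

lemma volterra_solution_iff:
  assumes L: "ennreal_version l L" and F: "ennreal_version f F" and U: "ennreal_version u U" and "0 \<le> \<beta>"
  shows "volterra_solution l \<beta> f u \<longleftrightarrow> (AE t in lborel. U t + ennreal \<beta> * nnconv L U t = F t)"
proof -
  have "(AE t in lborel. 0 < t \<longrightarrow> u t + \<beta> * conv l u t = f t)
      \<longleftrightarrow> (AE t in lborel. U t + ennreal \<beta> * nnconv L U t = F t)"
  proof (rule eventually_subst)
    show "AE t in lborel. (0 < t \<longrightarrow> u t + \<beta> * conv l u t = f t) = (U t + ennreal \<beta> * nnconv L U t = F t)"
      using ennreal_version_AE[OF ennreal_version_conv[OF L U]] ennreal_version_AE[OF U] ennreal_version_AE[OF F]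
    proof eventually_elim
      case (elim t)
      show ?case
      proof (cases "0 < t")
        case True
        with elim have nn: "0 \<le> conv l u t" "0 \<le> u t" "0 \<le> f t"
          and eq: "nnconv L U t = ennreal (conv l u t)" "U t = ennreal (u t)" "F t = ennreal (f t)"
          by auto
        have "U t + ennreal \<beta> * nnconv L U t = ennreal (u t + \<beta> * conv l u t)"
          unfolding eq using nn \<open>0 \<le> \<beta>\<close> by (simp add: ennreal_mult ennreal_plus)
        then show ?thesis using True nn \<open>0 \<le> \<beta>\<close> unfolding eq(3) by (simp add: ennreal_inj del: ennreal_plus)
      next
        case False
        then show ?thesis
          using ennreal_version_nonpos[OF ennreal_version_conv[OF L U], of t] ennreal_version_nonpos[OF F, of t] ennreal_version_nonpos[OF U, of t] by simp
      qed
    qed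
  qed
  then show ?thesis
    using ennreal_version_L1_loc[OF U] by (simp add: volterra_solution_def AE_completion_iff)
qed

section \<open>Bernstein sequences\<close>

definition powker :: "real \<Rightarrow> real \<Rightarrow> real" where
  "powker a t = (if 0 < t then t powr (- a) else 0)"

text \<open>The beta integral, equal to pi / sin (pi a) for 0 < a < 1; it normalizes the integral
  representations of powers.\<close>

definition powker_const :: "real \<Rightarrow> real" where
  "powker_const a = (LINT t|lborel. powker a t / (1 + t))"

lemma powker_nonneg [simp]: "0 \<le> powker a t"
  by (simp add: powker_def)

lemma powker_measurable [measurable]: "powker a \<in> borel_measurable borel"
  unfolding powker_def[abs_def] by measurable

lemma nn_integral_powker_Ioc:
  assumes "a < 1" "0 \<le> T"
  shows "(\<integral>\<^sup>+t. ennreal (powker a t) * indicator {..T} t \<partial>lborel) = ennreal (T powr (1 - a) / (1 - a))"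
proof -
  have "(\<integral>\<^sup>+t. ennreal (powker a t) * indicator {..T} t \<partial>lborel)
      = (\<integral>\<^sup>+t. ennreal (t powr (- a)) * indicator {0..T} t \<partial>lborel)"
    by (intro nn_integral_cong_AE eventually_mono[OF AE_lborel_singleton[of 0]])
      (auto simp: powker_def indicator_def)
  also have "\<dots> = ennreal (T powr (1 - a) / (1 - a))"
  proof -
    have "((\<lambda>t. t powr (- a)) has_integral T powr (- a + 1) / (- a + 1)) {0..T}"
      using assms by (intro has_integral_powr_from_0) auto
    then show ?thesis
      by (intro nn_integral_has_integral_lebesgue') (auto simp: add.commute)
  qed
  finally show ?thesis .
qed

lemma integrable_powker_Ioc:
  assumes "a < 1"
  shows "integrable lborel (\<lambda>t. powker a t * indicator {..real n} t)"
proof (rule integrableI_nonneg)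
  have "(\<integral>\<^sup>+t. ennreal (powker a t * indicator {..real n} t) \<partial>lborel)
      = (\<integral>\<^sup>+t. ennreal (powker a t) * indicator {..real n} t \<partial>lborel)"
    by (intro nn_integral_cong) (auto simp: indicator_def)
  then show "(\<integral>\<^sup>+t. ennreal (powker a t * indicator {..real n} t) \<partial>lborel) < \<infinity>"
    using nn_integral_powker_Ioc[OF assms, of "real n"] by simp
qed auto

text \<open>Comparison with t powr (- a) near 0 uses a < 1, comparison with t powr (- a - 1) near
  infinity uses a > 0.\<close>

lemma integrable_powker_unit:
  assumes "0 < a" "a < 1"
  shows "integrable lborel (\<lambda>t. powker a t / (1 + t))"
proof (rule integrableI_nonneg)
  have "(\<integral>\<^sup>+t. ennreal (powker a t / (1 + t)) \<partial>lborel)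
      \<le> (\<integral>\<^sup>+t. ennreal (powker a t) * indicator {..1} t + ennreal (t powr (- a - 1)) * indicator {1..} t \<partial>lborel)"
  proof (rule nn_integral_mono)
    fix t :: real
    consider "t \<le> 0" | "0 < t" "t \<le> 1" | "1 < t" by linarith
    then show "ennreal (powker a t / (1 + t))
      \<le> ennreal (powker a t) * indicator {..1} t + ennreal (t powr (- a - 1)) * indicator {1..} t"
    proof cases
      case 2
      then have "powker a t / (1 + t) \<le> powker a t"
        by (simp add: divide_le_eq mult_le_cancel_left1 not_less)
      then have "ennreal (powker a t / (1 + t)) \<le> ennreal (powker a t)" by (rule ennreal_leI)
      then show ?thesis using 2 by (auto intro: add_increasing2)
    next
      case 3
      have "t powr (- a - 1) = t powr (- a) / t"
        using 3 by (simp add: powr_diff)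
      then have "powker a t / (1 + t) \<le> t powr (- a - 1)"
        using 3 by (auto simp: powker_def intro!: divide_left_mono)
      then show ?thesis using 3 by (auto intro: ennreal_leI)
    qed (simp add: powker_def)
  qed
  also have "\<dots> = ennreal (1 powr (1 - a) / (1 - a)) + ennreal (0 - (- (1 powr (- a) / a)))"
  proof (subst nn_integral_add)
    have "(\<integral>\<^sup>+t. ennreal (t powr (- a - 1)) * indicator {1..} t \<partial>lborel) = ennreal (0 - (- (1 powr (- a) / a)))"
    proof (rule nn_integral_FTC_atLeast)
      show "((\<lambda>t. - (t powr (- a) / a)) has_real_derivative t powr (- a - 1)) (at t)" if "1 \<le> t" for t
        using that assms by (auto intro!: derivative_eq_intros)
      have "((\<lambda>t. t powr (- a)) \<longlongrightarrow> 0) at_top"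
        using assms by (intro tendsto_neg_powr filterlim_ident) auto
      from tendsto_minus[OF tendsto_divide[OF this tendsto_const[of a]]]
      show "((\<lambda>t. - (t powr (- a) / a)) \<longlongrightarrow> 0) at_top" using assms by simp
    qed auto
    then show "(\<integral>\<^sup>+t. ennreal (powker a t) * indicator {..1} t \<partial>lborel)
        + (\<integral>\<^sup>+t. ennreal (t powr (- a - 1)) * indicator {1..} t \<partial>lborel)
      = ennreal (1 powr (1 - a) / (1 - a)) + ennreal (0 - (- (1 powr (- a) / a)))"
      using nn_integral_powker_Ioc[of a 1] assms by simp
  qed auto
  also have "\<dots> < \<infinity>" by simp
  finally show "(\<integral>\<^sup>+t. ennreal (powker a t / (1 + t)) \<partial>lborel) < \<infinity>" .
qed (auto simp: powker_def)

lemma powker_const_pos: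
  assumes "0 < a" "a < 1"
  shows "0 < powker_const a"
proof -
  have nn: "0 \<le> powker a t / (1 + t)" for t by (auto simp: powker_def)
  have "powker_const a \<noteq> 0"
  proof
    assume "powker_const a = 0"
    then have "AE t in lborel. powker a t / (1 + t) = 0"
      unfolding powker_const_def
      using integral_nonneg_eq_0_iff_AE[OF integrable_powker_unit[OF assms]] nn by auto
    then have "AE t in lborel. t \<notin> {0<..<1::real}"
      by eventually_elim (auto simp: powker_def)
    then have "{0<..<1::real} \<in> null_sets lborel"
      by (subst AE_iff_null_sets) auto
    then show False by (simp add: null_sets_def)
  qed
  moreover have "0 \<le> powker_const a"
    unfolding powker_const_def using nn by (intro Bochner_Integration.integral_nonneg) auto
  ultimately show ?thesis by simp
qed

lemma nn_integral_powker:
  assumes "0 < a" "a < 1" "0 < c"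
  shows "(\<integral>\<^sup>+t. ennreal (powker a t / (c + t)) \<partial>lborel) = ennreal (c powr (- a) * powker_const a)"
proof -
  have "(\<integral>\<^sup>+t. ennreal (powker a t / (c + t)) \<partial>lborel)
      = ennreal c * (\<integral>\<^sup>+v. ennreal (powker a (c * v) / (c + c * v)) \<partial>lborel)"
    using \<open>0 < c\<close> by (subst nn_integral_real_affine[where c=c and t=0]) auto
  also have "\<dots> = (\<integral>\<^sup>+v. ennreal (c powr (- a)) * ennreal (powker a v / (1 + v)) \<partial>lborel)"
  proof (subst nn_integral_cmult[symmetric], measurable, intro nn_integral_cong)
    fix v :: real
    have "c * (powker a (c * v) / (c + c * v)) = c powr (- a) * (powker a v / (1 + v))"
    proof (cases "0 < v")
      case True
      then have "c + c * v = c * (1 + v)" "c * v > 0" using \<open>0 < c\<close> by (auto simp: algebra_simps)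
      then show ?thesis using True \<open>0 < c\<close> by (simp add: powker_def powr_mult)
    next
      case False
      then show ?thesis using \<open>0 < c\<close> by (simp add: powker_def zero_less_mult_iff)
    qed
    then show "ennreal c * ennreal (powker a (c * v) / (c + c * v)) = ennreal (c powr (- a)) * ennreal (powker a v / (1 + v))"
      using \<open>0 < c\<close> by (simp flip: ennreal_mult')
  qed
  also have "\<dots> = ennreal (c powr (- a)) * ennreal (powker_const a)"
    unfolding powker_const_def
    using nn_integral_eq_integral[OF integrable_powker_unit[OF assms(1,2)]]
    by (subst nn_integral_cmult) (auto simp: powker_def)
  finally show ?thesis by (simp add: ennreal_mult')
qed

lemma powker_integral:
  assumes "0 < a" "a < 1" "0 < c"
  shows "integrable lborel (\<lambda>t. powker a t / (c + t))"
    and "(LINT t|lborel. powker a t / (c + t)) = c powr (- a) * powker_const a"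
proof -
  have nn: "0 \<le> powker a t / (c + t)" for t using \<open>0 < c\<close> by (auto simp: powker_def)
  show "integrable lborel (\<lambda>t. powker a t / (c + t))"
    by (rule integrableI_nonneg) (use nn nn_integral_powker[OF assms] in auto)
  show "(LINT t|lborel. powker a t / (c + t)) = c powr (- a) * powker_const a"
    by (subst integral_eq_nn_integral)
      (use nn nn_integral_powker[OF assms] powker_const_pos[OF assms(1,2)] in auto)
qed

text \<open>
  In the application \<open>lam k = x + k\<close> and \<open>\<psi> k = \<Psi> (x + k)\<close>: the two conditions sample the complete
  monotonicity of the Laplace transforms of the resolvents of a kernel with transform \<open>1 / \<Psi>\<close>.
\<close>

definition bernstein_seq :: "(nat \<Rightarrow> real) \<Rightarrow> (nat \<Rightarrow> real) \<Rightarrow> bool" where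
  "bernstein_seq lam \<psi> \<longleftrightarrow> (\<forall>k. 0 < \<psi> k) \<and> (\<forall>t>0. cm_seq (\<lambda>k. 1 / (\<psi> k + t))) \<and> cm_seq (\<lambda>k. \<psi> k / lam k)"

section \<open>Operations that preserve Bernstein sequences\<close>

lemma cm_seq_decreasing: "cm_seq a \<Longrightarrow> a k \<le> a 0"
proof (induction k)
  case (Suc k)
  then show ?case using cm_seqD[of a 1 k] by (simp add: diff_seq_def)
qed simp

text \<open>A geometric series in g / M with nonnegative coefficients. Completely monotone sequences
  decrease, so the bound at index 0 keeps the ratio below 1 at every index.\<close>

lemma cm_seq_inverse_diff:
  assumes g: "cm_seq g" and "g 0 < M"
  shows "cm_seq (\<lambda>k. 1 / (M - g k))"
proof (rule cm_seq_LIMSEQ)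
  have M: "0 < M" using cm_seq_nonneg[OF g, of 0] assms(2) by simp
  show "\<forall>\<^sub>F n in sequentially. cm_seq (\<lambda>k. \<Sum>i<n. (1 / M ^ Suc i) * g k ^ i)"
    using M g by (intro always_eventually allI cm_seq_sum cm_seq_cmult cm_seq_power) auto
  show "(\<lambda>n. \<Sum>i<n. (1 / M ^ Suc i) * g k ^ i) \<longlonglongrightarrow> 1 / (M - g k)" for k
  proof -
    have gk: "0 \<le> g k" "g k < M"
      using cm_seq_nonneg[OF g] cm_seq_decreasing[OF g, of k] assms(2) by auto
    then have "(\<lambda>i. (g k / M) ^ i) sums (1 / (1 - g k / M))"
      using M by (intro geometric_sums) simp
    then have "(\<lambda>i. 1 / M * (g k / M) ^ i) sums (1 / M * (1 / (1 - g k / M)))"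
      by (rule sums_mult)
    moreover have "1 / M * (1 / (1 - g k / M)) = 1 / (M - g k)"
      using M gk by (simp add: field_simps)
    moreover have "1 / M * (g k / M) ^ i = 1 / M ^ Suc i * g k ^ i" for i
      by (simp add: power_divide)
    ultimately show ?thesis by (simp add: sums_def)
  qed
qed

text \<open>Bernstein functions are approached by constants minus completely monotone functions.
  Positivity of the limit at index 0 gives \<open>g n 0 < M n\<close> for large \<open>n\<close>,
  and \<open>t\<close> is absorbed into the constant.\<close>

lemma cm_seq_inverse_limit:
  assumes g: "\<And>n. cm_seq (g n)" and lim: "\<And>k. (\<lambda>n. M n - g n k) \<longlonglongrightarrow> \<psi> k"
    and pos: "\<And>k. 0 < \<psi> k" and t: "0 < (t::real)"
  shows "cm_seq (\<lambda>k. 1 / (\<psi> k + t))"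
proof (rule cm_seq_LIMSEQ)
  have "\<forall>\<^sub>F n in sequentially. 0 < M n - g n 0"
    using order_tendstoD(1)[OF lim pos] .
  then show "\<forall>\<^sub>F n in sequentially. cm_seq (\<lambda>k. 1 / (M n + t - g n k))"
  proof eventually_elim
    case (elim n)
    then show ?case using t by (intro cm_seq_inverse_diff g) auto
  qed
  show "(\<lambda>n. 1 / (M n + t - g n k)) \<longlonglongrightarrow> 1 / (\<psi> k + t)" for k
  proof -
    have "(\<lambda>n. 1 / ((M n - g n k) + t)) \<longlonglongrightarrow> 1 / (\<psi> k + t)"
      using pos[of k] t by (intro tendsto_intros lim) auto
    then show ?thesis by (simp add: algebra_simps)
  qed
qed

lemma cm_seq_integral_weight:
  assumes w: "\<And>t. 0 \<le> w t" "\<And>t. t \<le> 0 \<Longrightarrow> w t = 0"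
    and cm: "\<And>t. 0 < t \<Longrightarrow> cm_seq (a t)" and int: "\<And>k. integrable lborel (\<lambda>t::real. w t * a t k)"
  shows "cm_seq (\<lambda>k. LINT t|lborel. w t * a t k)"
proof (rule cm_seq_integral[OF int])
  fix t :: real
  show "cm_seq (\<lambda>k. w t * a t k)"
  proof (cases "0 < t")
    case True
    then show ?thesis using w cm by (intro cm_seq_cmult) auto
  next
    case False
    then show ?thesis using w by (simp add: cm_seq_const)
  qed
qed

text \<open>
  Uses \<open>\<psi>\<^sup>\<theta> = const * \<integral> t powr (\<theta> - 1) * \<psi> / (\<psi> + t) dt\<close>; truncating the integral writes \<open>\<psi>\<^sup>\<theta>\<close> as
  a limit of constants minus completely monotone sequences.
\<close>

lemma bernstein_seq_powr:
  assumes \<psi>: "bernstein_seq lam \<psi>" and \<theta>: "0 < \<theta>" "\<theta> < 1"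
  shows "bernstein_seq lam (\<lambda>k. \<psi> k powr \<theta>)"
proof -
  define a where "a = 1 - \<theta>"
  have a: "0 < a" "a < 1" using \<theta> by (auto simp: a_def)
  define I where "I = powker_const a"
  have I: "0 < I" using powker_const_pos[OF a] by (simp add: I_def)
  have pos: "0 < \<psi> k" for k using \<psi> by (simp add: bernstein_seq_def)
  have cm1: "cm_seq (\<lambda>k. 1 / (\<psi> k + t))" if "0 < t" for t using \<psi> that by (simp add: bernstein_seq_def)
  have cm2: "cm_seq (\<lambda>k. \<psi> k / lam k)" using \<psi> by (simp add: bernstein_seq_def)
  note K = powker_integral[OF a pos]
  have rep: "\<psi> k powr \<theta> = 1 / I * (LINT t|lborel. powker a t * (\<psi> k / (\<psi> k + t)))" for k
  proof -
    have "(LINT t|lborel. powker a t * (\<psi> k / (\<psi> k + t))) = (LINT t|lborel. \<psi> k * (powker a t / (\<psi> k + t)))"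
      by (simp add: mult_ac)
    also have "\<dots> = \<psi> k * (\<psi> k powr (- a) * I)"
      using K(2)[of k] by (subst integral_mult_right_zero) (simp add: I_def)
    also have "\<psi> k * (\<psi> k powr (- a) * I) = \<psi> k powr \<theta> * I"
      using pos[of k] by (simp add: a_def powr_diff powr_minus field_simps)
    finally show ?thesis using I by simp
  qed
  have int: "integrable lborel (\<lambda>t. powker a t * (\<psi> k / (\<psi> k + t)))" for k
    using integrable_mult_right[OF K(1), of "\<psi> k" k] by (simp add: mult_ac)
  \<comment> \<open>After division by \<open>lam k\<close> the integrand splits into \<psi> / lam
    and 1 / (\<psi> + t), both completely monotone by hypothesis.\<close>
  have "cm_seq (\<lambda>k. 1 / I * (LINT t|lborel. powker a t * (\<psi> k / lam k * (1 / (\<psi> k + t)))))"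
  proof (intro cm_seq_cmult cm_seq_integral_weight cm_seq_mult cm2 cm1)
    show "integrable lborel (\<lambda>t. powker a t * (\<psi> k / lam k * (1 / (\<psi> k + t))))" for k
      using integrable_mult_right[OF K(1), of "\<psi> k / lam k" k] by (simp add: mult_ac)
  qed (use I in \<open>auto simp: powker_def\<close>)
  also have "(\<lambda>k. 1 / I * (LINT t|lborel. powker a t * (\<psi> k / lam k * (1 / (\<psi> k + t))))) = (\<lambda>k. \<psi> k powr \<theta> / lam k)"
  proof
    fix k
    have "(LINT t|lborel. powker a t * (\<psi> k / lam k * (1 / (\<psi> k + t))))
        = (LINT t|lborel. powker a t * (\<psi> k / (\<psi> k + t)) / lam k)"
      by (intro Bochner_Integration.integral_cong) auto
    also have "\<dots> = (LINT t|lborel. powker a t * (\<psi> k / (\<psi> k + t))) / lam k"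
      by (rule integral_divide_zero)
    finally show "1 / I * (LINT t|lborel. powker a t * (\<psi> k / lam k * (1 / (\<psi> k + t)))) = \<psi> k powr \<theta> / lam k"
      by (simp only: rep) simp
  qed
  finally have A: "cm_seq (\<lambda>k. \<psi> k powr \<theta> / lam k)" .
  \<comment> \<open>\<psi> / (\<psi> + t) = 1 - t / (\<psi> + t), but \<open>powker a\<close> is not
    integrable at infinity. The cutoff allows the two terms to be integrated separately.\<close>
  define W where "W n t = powker a t * indicator {..real n} t" for n :: nat and t
  have W: "0 \<le> W n t" "t \<le> 0 \<Longrightarrow> W n t = 0" for n t
    by (auto simp: W_def powker_def)
  have Wint: "integrable lborel (W n)" for n
    unfolding W_def[abs_def] by (rule integrable_powker_Ioc) (use a in auto)
  have [measurable]: "W n \<in> borel_measurable borel" for n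
    unfolding W_def[abs_def] by measurable
  have Wint': "integrable lborel (\<lambda>t. W n t * (t * (1 / (\<psi> k + t))))" for n k
    by (rule Bochner_Integration.integrable_bound[OF Wint[of n]])
      (use W pos[of k] in \<open>auto simp: abs_mult not_le powker_def W_def divide_le_eq indicator_def intro!: mult_left_le\<close>)
  have B: "cm_seq (\<lambda>k. 1 / (\<psi> k powr \<theta> + t))" if "0 < t" for t
  proof (rule cm_seq_inverse_limit[OF _ _ _ that])
    show "cm_seq (\<lambda>k. 1 / I * (LINT t|lborel. W n t * (t * (1 / (\<psi> k + t)))))" for n
      by (intro cm_seq_cmult cm_seq_integral_weight cm1 Wint') (use I W in auto)
    show "0 < \<psi> k powr \<theta>" for k using pos[of k] by simp
    show "(\<lambda>n. 1 / I * (LINT t|lborel. W n t) - 1 / I * (LINT t|lborel. W n t * (t * (1 / (\<psi> k + t))))) \<longlonglongrightarrow> \<psi> k powr \<theta>" for k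
    proof -
      have eq: "1 / I * (LINT t|lborel. W n t) - 1 / I * (LINT t|lborel. W n t * (t * (1 / (\<psi> k + t))))
        = 1 / I * (LINT t|lborel. powker a t * (\<psi> k / (\<psi> k + t)) * indicator {..real n} t)" for n
      proof -
        have "(LINT t|lborel. W n t) - (LINT t|lborel. W n t * (t * (1 / (\<psi> k + t))))
            = (LINT t|lborel. W n t - W n t * (t * (1 / (\<psi> k + t))))"
          using Wint Wint' by simp
        also have "\<dots> = (LINT t|lborel. powker a t * (\<psi> k / (\<psi> k + t)) * indicator {..real n} t)"
        proof (intro Bochner_Integration.integral_cong refl)
          fix t
          show "W n t - W n t * (t * (1 / (\<psi> k + t))) = powker a t * (\<psi> k / (\<psi> k + t)) * indicator {..real n} t"
            using pos[of k] by (cases "0 < t") (auto simp: W_def powker_def indicator_def field_simps)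
        qed
        finally show ?thesis by (simp only: right_diff_distrib[symmetric])
      qed
      have "(\<lambda>n. LINT t|lborel. powker a t * (\<psi> k / (\<psi> k + t)) * indicator {..real n} t)
          \<longlonglongrightarrow> (LINT t|lborel. powker a t * (\<psi> k / (\<psi> k + t)))"
      proof (rule integral_dominated_convergence[OF _ _ int[of k]])
        show "AE t in lborel. (\<lambda>n. powker a t * (\<psi> k / (\<psi> k + t)) * indicator {..real n} t)
            \<longlonglongrightarrow> powker a t * (\<psi> k / (\<psi> k + t))"
        proof (intro AE_I2 tendsto_eventually)
          fix t :: real
          obtain N where "t \<le> real N" using real_arch_simple by blast
          then show "\<forall>\<^sub>F n in sequentially. powker a t * (\<psi> k / (\<psi> k + t)) * indicator {..real n} t = powker a t * (\<psi> k / (\<psi> k + t))"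
            by (intro eventually_sequentiallyI[of N]) auto
        qed
        show "AE t in lborel. norm (powker a t * (\<psi> k / (\<psi> k + t)) * indicator {..real n} t) \<le> powker a t * (\<psi> k / (\<psi> k + t))" for n
          using pos[of k] by (intro AE_I2) (auto simp: powker_def indicator_def)
      qed auto
      then show ?thesis unfolding eq rep[of k] by (rule tendsto_mult_left)
    qed
  qed
  show ?thesis
    using A B pos by (simp add: bernstein_seq_def less_imp_neq[THEN not_sym])
qed

text \<open>
  With \<open>y = x + c\<close>, the mean \<open>x powr p * y powr (1 - p)\<close> is the integral of \<open>t powr (p - 1)\<close> against the
  weighted harmonic means \<open>x * y / (x + t * y)\<close>, each of which is a positive combination of \<open>x\<close> and
  \<open>x / (x + d t)\<close>.
\<close>

lemma bernstein_seq_geometric_mean: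
  assumes x: "bernstein_seq lam x" and p: "0 < p" "p < 1" and c: "0 \<le> c"
  shows "bernstein_seq lam (\<lambda>k. x k powr p * (x k + c) powr (1 - p))"
proof -
  define a where "a = 1 - p"
  have a: "0 < a" "a < 1" using p by (auto simp: a_def)
  define I where "I = powker_const a"
  have I: "0 < I" using powker_const_pos[OF a] by (simp add: I_def)
  have pos: "0 < x k" for k using x by (simp add: bernstein_seq_def)
  have cm1: "cm_seq (\<lambda>k. 1 / (x k + t))" if "0 < t" for t using x that by (simp add: bernstein_seq_def)
  have cm2: "cm_seq (\<lambda>k. x k / lam k)" using x by (simp add: bernstein_seq_def)
  show ?thesis
  \<comment> \<open>For c = 0 the shifts \<open>d t\<close> below would vanish, while
    \<open>cm1\<close> is about positive shifts.\<close>
  proof (cases "c = 0")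
    case True
    have "(\<lambda>k. x k powr p * (x k + c) powr (1 - p)) = x"
      using pos True by (simp add: powr_add[symmetric] less_imp_le)
    with x show ?thesis by simp
  next
    case False
    with c have c: "0 < c" by simp
    \<comment> \<open>Partial fractions: with y = x + c, the quotient x y / (x + t y) equals x / (1
      + t) plus c / (1 + t)^2 times x / (x + d t). The weight \<open>w\<close> collects the
      coefficient of the second term.\<close>
    define d where "d t = t * c / (1 + t)" for t
    define w where "w t = powker a t / (1 + t) * (c / (1 + t))" for t
    have d: "0 < d t" if "0 < t" for t using c that by (auto simp: d_def)
    have w: "0 \<le> w t" "t \<le> 0 \<Longrightarrow> w t = 0" for t
      using c by (auto simp: w_def powker_def)
    have [measurable]: "w \<in> borel_measurable borel" "d \<in> borel_measurable borel"
      unfolding w_def[abs_def] d_def[abs_def] by measurable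
    note unit = integrable_powker_unit[OF a]
    have wint: "integrable lborel (\<lambda>t. w t * q t)"
      if [measurable]: "q \<in> borel_measurable borel" and q: "\<And>t. 0 < t \<Longrightarrow> \<bar>q t\<bar> \<le> Q" for q Q
    proof (rule Bochner_Integration.integrable_bound[OF integrable_mult_right[OF unit, of "c * Q"]])
      show "AE t in lborel. norm (w t * q t) \<le> norm (c * Q * (powker a t / (1 + t)))"
      proof (intro AE_I2)
        fix t :: real
        show "norm (w t * q t) \<le> norm (c * Q * (powker a t / (1 + t)))"
        proof (cases "0 < t")
          case True
          have "c / (1 + t) \<le> c" using True c by (simp add: divide_le_eq)
          moreover have "\<bar>q t\<bar> \<le> \<bar>Q\<bar>" using q[OF True] by simp
          ultimately have "c / (1 + t) * \<bar>q t\<bar> \<le> c * \<bar>Q\<bar>"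
            using c by (intro mult_mono) auto
          then have "powker a t / (1 + t) * (c / (1 + t) * \<bar>q t\<bar>) \<le> powker a t / (1 + t) * (c * \<bar>Q\<bar>)"
            using True by (intro mult_left_mono) auto
          then show ?thesis using True c by (simp add: w_def abs_mult mult_ac)
        qed (simp add: w_def powker_def)
      qed
    qed simp
    have q1: "\<bar>x k / (x k + d t)\<bar> \<le> 1" if "0 < t" for k t
      using pos[of k] d[OF that] by (simp add: divide_le_eq)
    have q2: "\<bar>d t / (x k + d t)\<bar> \<le> 1" if "0 < t" for k t
      using pos[of k] d[OF that] by (simp add: divide_le_eq)
    have rep: "x k powr p * (x k + c) powr (1 - p) = x k + 1 / I * (LINT t|lborel. w t * (x k / (x k + d t)))" for k
    proof -
      have y: "0 < x k + c" using pos[of k] c by simp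
      let ?b = "x k / (x k + c)"
      have b: "0 < ?b" using pos[of k] y by simp
      have "x k * (?b powr (- a) * I) = x k * (LINT t|lborel. powker a t / (?b + t))"
        using powker_integral(2)[OF a b] by (simp add: I_def)
      also have "\<dots> = (LINT t|lborel. x k * (powker a t / (?b + t)))"
        by (rule integral_mult_right_zero[symmetric])
      also have "\<dots> = (LINT t|lborel. x k * (powker a t / (1 + t)) + w t * (x k / (x k + d t)))"
      proof (intro Bochner_Integration.integral_cong refl)
        fix t :: real
        show "x k * (powker a t / (?b + t)) = x k * (powker a t / (1 + t)) + w t * (x k / (x k + d t))"
        proof (cases "0 < t")
          case True
          have D: "(1 + t) * (x k + d t) = x k + t * (x k + c)"
            using True by (simp add: d_def field_simps)
          have ne: "x k + d t > 0" "x k + t * (x k + c) > 0" "1 + t > 0"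
            using pos[of k] d[OF True] True y by (auto intro: add_pos_pos)
          have "1 / (?b + t) = (x k + c) / (x k + t * (x k + c))"
            using y ne by (simp add: field_simps)
          also have "\<dots> = (x k + c) / ((1 + t) * (x k + d t))" by (simp add: D)
          also have "\<dots> = 1 / (1 + t) + 1 / (1 + t) * (c / (1 + t)) * (1 / (x k + d t))"
          proof -
            have "c - d t = c / (1 + t)" using True by (simp add: d_def field_simps)
            then have xc: "x k + c = (x k + d t) + c / (1 + t)" by simp
            have "(x k + c) / (x k + d t) = 1 + c / (1 + t) * (1 / (x k + d t))"
              unfolding xc add_divide_distrib[of "x k + d t"] using ne(1) by simp
            moreover have "(x k + c) / ((1 + t) * (x k + d t)) = 1 / (1 + t) * ((x k + c) / (x k + d t))"
              by simp
            ultimately show ?thesis by (simp only: distrib_left mult_1_right mult.assoc)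
          qed
          finally have "x k * powker a t * (1 / (?b + t)) = x k * powker a t * (1 / (1 + t) + 1 / (1 + t) * (c / (1 + t)) * (1 / (x k + d t)))"
            by simp
          then show ?thesis by (simp add: w_def algebra_simps)
        qed (simp add: powker_def w_def)
      qed
      also have "\<dots> = x k * I + (LINT t|lborel. w t * (x k / (x k + d t)))"
      proof (subst Bochner_Integration.integral_add)
        show "integrable lborel (\<lambda>t. x k * (powker a t / (1 + t)))"
          by (rule integrable_mult_right[OF unit])
        show "integrable lborel (\<lambda>t. w t * (x k / (x k + d t)))"
          using q1 by (intro wint[where Q=1]) auto
        show "(LINT t|lborel. x k * (powker a t / (1 + t))) + (LINT t|lborel. w t * (x k / (x k + d t)))
            = x k * I + (LINT t|lborel. w t * (x k / (x k + d t)))"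
          unfolding I_def powker_const_def by (subst integral_mult_right_zero) simp
      qed
      finally have "x k * ?b powr (- a) = x k + 1 / I * (LINT t|lborel. w t * (x k / (x k + d t)))"
        using I by (simp add: field_simps)
      moreover have "x k * ?b powr (- a) = x k powr p * (x k + c) powr (1 - p)"
      proof -
        have "?b powr (- a) = x k powr (- a) * (x k + c) powr a"
          using pos[of k] y by (simp add: powr_divide powr_minus field_simps)
        moreover have "x k * x k powr (- a) = x k powr p"
          using pos[of k] by (simp add: a_def powr_diff powr_minus field_simps)
        ultimately show ?thesis by (simp add: a_def mult.assoc[symmetric])
      qed
      ultimately show ?thesis by simp
    qed
    have A: "cm_seq (\<lambda>k. x k powr p * (x k + c) powr (1 - p) / lam k)"
    proof -
      have "cm_seq (\<lambda>k. x k / lam k + 1 / I * (LINT t|lborel. w t * (x k / lam k * (1 / (x k + d t)))))"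
      proof (intro cm_seq_add cm_seq_cmult cm_seq_integral_weight cm_seq_mult cm2 cm1 d)
        show "integrable lborel (\<lambda>t. w t * (x k / lam k * (1 / (x k + d t))))" for k
          using integrable_mult_right[OF wint[of "\<lambda>t. x k / (x k + d t)" 1], of "1 / lam k"] q1
          by (simp add: mult_ac)
      qed (use I w in auto)
      also have "(\<lambda>k. x k / lam k + 1 / I * (LINT t|lborel. w t * (x k / lam k * (1 / (x k + d t)))))
          = (\<lambda>k. x k powr p * (x k + c) powr (1 - p) / lam k)"
      proof
        fix k
        have "(LINT t|lborel. w t * (x k / lam k * (1 / (x k + d t))))
            = (LINT t|lborel. w t * (x k / (x k + d t)) / lam k)"
          by (intro Bochner_Integration.integral_cong) auto
        also have "\<dots> = (LINT t|lborel. w t * (x k / (x k + d t))) / lam k"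
          by (rule integral_divide_zero)
        finally show "x k / lam k + 1 / I * (LINT t|lborel. w t * (x k / lam k * (1 / (x k + d t))))
            = x k powr p * (x k + c) powr (1 - p) / lam k"
          by (simp only: rep add_divide_distrib) simp
      qed
      finally show ?thesis .
    qed
    have B: "cm_seq (\<lambda>k. 1 / (x k powr p * (x k + c) powr (1 - p) + t))" if "0 < t" for t
    proof (rule cm_seq_inverse_limit[OF _ _ _ that])
      \<comment> \<open>The linear term \<open>x\<close> is the limit of n x / (x + n) = n - n^2 /
        (x + n), taken along \<open>Suc n\<close> to avoid n = 0. The integral term needs no cutoff,
        as x / (x + d) = 1 - d / (x + d) and \<open>w\<close> is integrable.\<close>
      show "cm_seq (\<lambda>k. real (Suc n) * real (Suc n) * (1 / (x k + real (Suc n))) + 1 / I * (LINT t|lborel. w t * (d t * (1 / (x k + d t)))))" for n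
      proof (intro cm_seq_add cm_seq_cmult cm_seq_integral_weight cm1 d)
        show "integrable lborel (\<lambda>t. w t * (d t * (1 / (x k + d t))))" for k
          using wint[of "\<lambda>t. d t / (x k + d t)" 1] q2 by simp
      qed (use I w d in \<open>auto intro: less_imp_le\<close>)
      show "0 < x k powr p * (x k + c) powr (1 - p)" for k
        using pos[of k] c by simp
      show "(\<lambda>n. (real (Suc n) + 1 / I * (LINT t|lborel. w t)) - (real (Suc n) * real (Suc n) * (1 / (x k + real (Suc n)))
          + 1 / I * (LINT t|lborel. w t * (d t * (1 / (x k + d t))))))
        \<longlonglongrightarrow> x k powr p * (x k + c) powr (1 - p)" for k
      proof -
        have e1: "real (Suc n) - real (Suc n) * real (Suc n) * (1 / (x k + real (Suc n))) = x k / (1 + x k * inverse (real (Suc n)))" for n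
        proof -
          have "x k + real (Suc n) > 0" "real (Suc n) > 0" using pos[of k] by auto
          then show ?thesis by (simp add: divide_simps del: of_nat_Suc) (simp add: algebra_simps)
        qed
        have "(LINT t|lborel. w t) - (LINT t|lborel. w t * (d t * (1 / (x k + d t))))
            = (LINT t|lborel. w t - w t * (d t * (1 / (x k + d t))))"
          using wint[of "\<lambda>_. 1" 1] wint[of "\<lambda>t. d t / (x k + d t)" 1] q2 by simp
        also have "\<dots> = (LINT t|lborel. w t * (x k / (x k + d t)))"
        proof (intro Bochner_Integration.integral_cong refl)
          fix t :: real
          show "w t - w t * (d t * (1 / (x k + d t))) = w t * (x k / (x k + d t))"
          proof (cases "0 < t")
            case True
            then have "x k + d t > 0" using pos[of k] d by (simp add: add_pos_pos)
            then show ?thesis by (simp add: field_simps)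
          qed (simp add: w(2))
        qed
        finally have e2: "1 / I * (LINT t|lborel. w t) - 1 / I * (LINT t|lborel. w t * (d t * (1 / (x k + d t))))
            = 1 / I * (LINT t|lborel. w t * (x k / (x k + d t)))"
          by (simp only: right_diff_distrib[symmetric])
        have "(\<lambda>n. x k / (1 + x k * inverse (real (Suc n))) + 1 / I * (LINT t|lborel. w t * (x k / (x k + d t))))
          \<longlonglongrightarrow> x k / (1 + x k * 0) + 1 / I * (LINT t|lborel. w t * (x k / (x k + d t)))"
          by (intro tendsto_intros LIMSEQ_inverse_real_of_nat) auto
        then show ?thesis
          unfolding rep[of k] by (simp only: e1[symmetric] e2[symmetric]) (simp add: algebra_simps)
      qed
    qed
    have "0 < x k powr p * (x k + c) powr (1 - p)" for k
      using pos[of k] c by simp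
    with A B show ?thesis unfolding bernstein_seq_def by blast
  qed
qed

text \<open>The product is the power a + b of the geometric mean with weights a / (a + b) and b / (a
  + b). If a + b = 1 it is the mean itself; otherwise the lemma on powers below 1 applies.\<close>

lemma bernstein_seq_powr_mult:
  assumes x: "bernstein_seq lam x" and ab: "0 < a" "0 < b" "a + b \<le> 1" and c: "0 \<le> c"
  shows "bernstein_seq lam (\<lambda>k. x k powr a * (x k + c) powr b)"
proof -
  define \<theta> p where "\<theta> = a + b" and "p = a / \<theta>"
  have \<theta>: "0 < \<theta>" "\<theta> \<le> 1" and p: "0 < p" "p < 1" and pq: "p * \<theta> = a" "(1 - p) * \<theta> = b"
    using ab by (auto simp: \<theta>_def p_def field_simps)
  have pos: "0 < x k" for k using x by (simp add: bernstein_seq_def)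
  have eq: "(x k powr p * (x k + c) powr (1 - p)) powr \<theta> = x k powr a * (x k + c) powr b" for k
    using pos[of k] c by (simp add: powr_mult powr_powr pq)
  note G = bernstein_seq_geometric_mean[OF x p c]
  show ?thesis
  proof (cases "\<theta> = 1")
    case True
    then show ?thesis using G pq by simp
  next
    case False
    then show ?thesis using bernstein_seq_powr[OF G, of \<theta>] \<theta> by (simp add: eq)
  qed
qed

section \<open>Resolvents of a completely positive kernel\<close>

text \<open>The type \<open>ennreal\<close> builds in the nonnegativity of the resolvents. They come
  for each \<open>u\<close> separately, without measurability in \<open>u\<close>, since complete
  positivity only asserts their existence.\<close>

locale cp_kernel =
  fixes l :: "real \<Rightarrow> ennreal" and r s :: "real \<Rightarrow> real \<Rightarrow> ennreal"
  assumes l_measurable [measurable]: "l \<in> borel_measurable borel"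
    and r_measurable [measurable]: "\<And>u. r u \<in> borel_measurable borel"
    and s_measurable [measurable]: "\<And>u. s u \<in> borel_measurable borel"
    and l_nonpos: "\<And>t. t \<le> 0 \<Longrightarrow> l t = 0"
    and r_nonpos: "\<And>u t. t \<le> 0 \<Longrightarrow> r u t = 0"
    and s_nonpos: "\<And>u t. t \<le> 0 \<Longrightarrow> s u t = 0"
    and l_nonzero: "\<not> (AE t in lborel. l t = 0)"
    and r_eq: "\<And>u. 0 \<le> u \<Longrightarrow> AE t in lborel. r u t + ennreal u * nnconv l (r u) t = l t"
    and s_eq: "\<And>u. 0 \<le> u \<Longrightarrow> AE t in lborel. s u t + ennreal u * nnconv l (s u) t = indicator {0<..} t"
begin

section \<open>Laplace transforms of the resolvents\<close>

lemma nnlap_s_eq: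
  assumes "0 \<le> u" "0 < x"
  shows "nnlap (s u) x + ennreal u * (nnlap l x * nnlap (s u) x) = ennreal (1 / x)"
proof -
  have "nnlap (s u) x + ennreal u * (nnlap l x * nnlap (s u) x)
      = nnlap (\<lambda>t. s u t + ennreal u * nnconv l (s u) t) x"
    by (simp add: nnlap_add nnlap_cmult nnlap_nnconv)
  also have "\<dots> = ennreal (1 / x)"
    unfolding nnlap_cong_AE[OF s_eq[OF assms(1)]] by (rule nnlap_indicator[OF assms(2)])
  finally show ?thesis .
qed

lemma nnlap_r_eq:
  assumes "0 \<le> u"
  shows "nnlap (r u) x + ennreal u * (nnlap l x * nnlap (r u) x) = nnlap l x"
proof -
  have "nnlap (r u) x + ennreal u * (nnlap l x * nnlap (r u) x)
      = nnlap (\<lambda>t. r u t + ennreal u * nnconv l (r u) t) x"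
    by (simp add: nnlap_add nnlap_cmult nnlap_nnconv)
  also have "\<dots> = nnlap l x"
    by (rule nnlap_cong_AE[OF r_eq[OF assms]])
  finally show ?thesis .
qed

lemma nnlap_l_pos: "nnlap l x \<noteq> 0"
  using l_nonzero by (subst nnlap_eq_0_iff) simp_all

text \<open>Local integrability does not limit growth, but the equation of \<open>s 1\<close> does:
  the transform of \<open>s 1\<close> cannot be 0, and its product with that of \<open>l\<close> is
  at most 1 / x.\<close>

lemma nnlap_l_finite:
  assumes "0 < x"
  shows "nnlap l x < \<infinity>"
proof -
  note eq = nnlap_s_eq[of 1 x, simplified, OF assms]
  have "nnlap (s 1) x \<noteq> 0"
  proof
    assume "nnlap (s 1) x = 0"
    with eq assms show False by (simp add: ennreal_eq_0_iff)
  qed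
  moreover have "nnlap l x * nnlap (s 1) x < \<infinity>"
    using eq by (metis ennreal_add_less_top ennreal_less_top infinity_ennreal_def)
  ultimately show ?thesis
    by (auto simp: ennreal_mult_less_top)
qed

definition phi :: "real \<Rightarrow> real" where
  "phi x = 1 / enn2real (nnlap l x)"

lemma phi_pos:
  assumes "0 < x" shows "0 < phi x"
  using nnlap_l_pos[of x] nnlap_l_finite[OF assms] by (simp add: phi_def enn2real_positive_iff zero_less_iff_neq_zero)

lemma nnlap_l:
  assumes "0 < x" shows "nnlap l x = ennreal (1 / phi x)"
  using nnlap_l_finite[OF assms] by (simp add: phi_def less_top)

lemma nnlap_s:
  assumes "0 \<le> u" "0 < x"
  shows "nnlap (s u) x = ennreal (phi x / (x * (phi x + u)))"
proof -
  note eq = nnlap_s_eq[OF assms] and ph = phi_pos[OF assms(2)]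
  have "nnlap (s u) x < \<infinity>"
    using eq by (metis ennreal_add_less_top ennreal_less_top infinity_ennreal_def)
  then obtain c where c: "nnlap (s u) x = ennreal c" "0 \<le> c"
    by (cases "nnlap (s u) x") auto
  have "ennreal c + ennreal u * (ennreal (1 / phi x) * ennreal c) = ennreal (1 / x)"
    using eq c by (simp only: nnlap_l[OF assms(2)])
  then have "ennreal (c + u * (1 / phi x * c)) = ennreal (1 / x)"
    using assms ph c by (simp add: ennreal_mult[symmetric] ennreal_plus[symmetric] del: ennreal_plus)
  then have "c + u * (1 / phi x * c) = 1 / x"
    using assms ph c by (subst (asm) ennreal_inj) auto
  then have "c * (x * (phi x + u)) = phi x"
    using ph assms by (simp add: field_simps)
  moreover have "x * (phi x + u) \<noteq> 0" using ph assms by auto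
  ultimately have "c = phi x / (x * (phi x + u))"
    by (metis nonzero_eq_divide_eq)
  then show ?thesis using c by simp
qed

lemma nnlap_r:
  assumes "0 \<le> u" "0 < x"
  shows "nnlap (r u) x = ennreal (1 / (phi x + u))"
proof -
  note eq = nnlap_r_eq[OF assms(1), of x] and ph = phi_pos[OF assms(2)]
  have "nnlap (r u) x < \<infinity>"
    using eq nnlap_l_finite[OF assms(2)] by (metis ennreal_add_less_top infinity_ennreal_def)
  then obtain c where c: "nnlap (r u) x = ennreal c" "0 \<le> c"
    by (cases "nnlap (r u) x") auto
  have "ennreal c + ennreal u * (ennreal (1 / phi x) * ennreal c) = ennreal (1 / phi x)"
    using eq c by (simp only: nnlap_l[OF assms(2)])
  then have "ennreal (c + u * (1 / phi x * c)) = ennreal (1 / phi x)"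
    using assms ph c by (simp add: ennreal_mult[symmetric] ennreal_plus[symmetric] del: ennreal_plus)
  then have "c + u * (1 / phi x * c) = 1 / phi x"
    using assms ph c by (subst (asm) ennreal_inj) auto
  then have "c * (phi x + u) = 1"
    using ph assms by (simp add: field_simps)
  then have "c = 1 / (phi x + u)"
    using ph assms by (simp add: field_simps)
  then show ?thesis using c by simp
qed

text \<open>Both sides have the same transform. The identity makes \<open>s u\<close> nonincreasing
  up to null sets and bounds the mass of \<open>r u\<close> by 1 / u.\<close>

lemma conv_one_r:
  assumes u: "0 \<le> u"
  shows "AE t in lborel. s u t + ennreal u * nnconv (indicator {0<..}) (r u) t = indicator {0<..} t"
proof (rule nnlap_inj[where x=1])
  have eq: "nnlap (\<lambda>t. s u t + ennreal u * nnconv (indicator {0<..}) (r u) t) y = nnlap (indicator {0<..}) y"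
    if y: "1 \<le> y" for y
  proof -
    have y0: "0 < y" using y by simp
    have "phi y / (y * (phi y + u)) + u * (1 / y * (1 / (phi y + u))) = 1 / y"
      using phi_pos[OF y0] u y0 by (simp add: divide_simps)
    then have "ennreal (phi y / (y * (phi y + u))) + ennreal u * (ennreal (1 / y) * ennreal (1 / (phi y + u))) = ennreal (1 / y)"
      using phi_pos[OF y0] u y0 by (simp add: ennreal_mult[symmetric] ennreal_plus[symmetric] del: ennreal_plus)
    then show ?thesis
      using u y0 by (simp add: nnlap_add nnlap_cmult nnlap_nnconv nnlap_s nnlap_r nnlap_indicator)
  qed
  show "nnlap (\<lambda>t. s u t + ennreal u * nnconv (indicator {0<..}) (r u) t) y = nnlap (indicator {0<..}) y"
    if "1 \<le> y" for y
    using eq that .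
  show "nnlap (\<lambda>t. s u t + ennreal u * nnconv (indicator {0<..}) (r u) t) 1 < \<infinity>"
    unfolding eq[of 1, simplified] by (subst nnlap_indicator) auto
  show "s u t + ennreal u * nnconv (indicator {0<..}) (r u) t = 0" if "t \<le> 0" for t
    using that nnconv_nonpos[of "indicator {0<..}" "r u" t] by (simp add: s_nonpos r_nonpos)
qed auto

text \<open>The quotient phi / x is reached as the limit of n phi / (x (phi + n)), the transforms of
  n times \<open>s n\<close>.\<close>

lemma phi_bernstein_seq:
  assumes "0 < x"
  shows "bernstein_seq (\<lambda>k. x + real k) (\<lambda>k. phi (x + real k))"
  unfolding bernstein_seq_def
proof (intro conjI allI impI)
  have pos: "0 < phi (x + real k)" for k using assms by (intro phi_pos) simp
  show "0 < phi (x + real k)" for k by (rule pos)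
  show "cm_seq (\<lambda>k. 1 / (phi (x + real k) + t))" if "0 < t" for t
  proof -
    have "cm_seq (\<lambda>k. enn2real (nnlap (r t) (x + real k)))"
      using assms that by (intro nnlap_cm_seq) (auto simp: r_nonpos nnlap_r)
    also have "(\<lambda>k. enn2real (nnlap (r t) (x + real k))) = (\<lambda>k. 1 / (phi (x + real k) + t))"
    proof
      fix k show "enn2real (nnlap (r t) (x + real k)) = 1 / (phi (x + real k) + t)"
        using assms that pos[of k] by (subst nnlap_r) auto
    qed
    finally show ?thesis .
  qed
  show "cm_seq (\<lambda>k. phi (x + real k) / (x + real k))"
  proof (rule cm_seq_LIMSEQ)
    show "\<forall>\<^sub>F n in sequentially. cm_seq (\<lambda>k. real (Suc n) * enn2real (nnlap (s (real (Suc n))) (x + real k)))"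
      using assms by (intro always_eventually allI cm_seq_cmult nnlap_cm_seq) (auto simp: s_nonpos nnlap_s)
    show "(\<lambda>n. real (Suc n) * enn2real (nnlap (s (real (Suc n))) (x + real k))) \<longlonglongrightarrow> phi (x + real k) / (x + real k)" for k
    proof -
      let ?p = "phi (x + real k)" and ?x = "x + real k"
      have x: "0 < ?x" using assms by simp
      have "real (Suc n) * enn2real (nnlap (s (real (Suc n))) ?x) = ?p / (?x * (?p * inverse (real (Suc n)) + 1))" for n
      proof -
        have "nnlap (s (real (Suc n))) ?x = ennreal (?p / (?x * (?p + real (Suc n))))"
          using x by (intro nnlap_s) auto
        then have "real (Suc n) * enn2real (nnlap (s (real (Suc n))) ?x) = real (Suc n) * (?p / (?x * (?p + real (Suc n))))"
          using pos[of k] x by simp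
        also have "\<dots> = ?p / (?x * ((?p + real (Suc n)) / real (Suc n)))"
          using x by simp
        also have "(?p + real (Suc n)) / real (Suc n) = ?p * inverse (real (Suc n)) + 1"
          by (simp add: field_simps)
        finally show ?thesis .
      qed
      moreover have "(\<lambda>n. ?p / (?x * (?p * inverse (real (Suc n)) + 1))) \<longlonglongrightarrow> ?p / (?x * (?p * 0 + 1))"
        using x by (intro tendsto_intros LIMSEQ_inverse_real_of_nat) auto
      ultimately show ?thesis by simp
    qed
  qed
qed

text \<open>Index \<open>k\<close> denotes the convolution power of order
  \<open>k + 1\<close>.\<close>

primrec rpow :: "nat \<Rightarrow> nat \<Rightarrow> real \<Rightarrow> ennreal" where
  "rpow N 0 = r (real N)"
| "rpow N (Suc k) = nnconv (r (real N)) (rpow N k)"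

lemma rpow_measurable [measurable]: "rpow N k \<in> borel_measurable borel"
  by (induction k) auto

lemma rpow_nonpos: "t \<le> 0 \<Longrightarrow> rpow N k t = 0"
  by (induction k arbitrary: t) (auto simp: r_nonpos intro: nnconv_nonpos)

lemma nnlap_rpow:
  assumes "0 < x"
  shows "nnlap (rpow N k) x = ennreal ((1 / (phi x + real N)) ^ Suc k)"
proof (induction k)
  case 0
  then show ?case using assms by (simp add: nnlap_r)
next
  case (Suc k)
  have "0 < phi x + real N" using phi_pos[OF assms] by (simp add: add_pos_nonneg)
  then show ?case using Suc assms by (simp add: nnlap_nnconv nnlap_r ennreal_mult[symmetric] del: power_Suc) simp
qed

text \<open>
  The resolvents \<open>r u\<close> are only given for each \<open>u\<close> separately and up to null sets. The Neumann
  series around the next integer above \<open>u\<close> selects a version that is jointly measurable.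
\<close>

definition ceil_above :: "real \<Rightarrow> nat" where
  "ceil_above u = nat \<lfloor>u\<rfloor> + 1"

text \<open>The expansion of 1 / (phi + u) in powers of 1 / (phi + N). For u \<ge> 0 the strict
  inequality u < N makes every coefficient positive, which the positivity argument exploits.\<close>

definition res :: "real \<Rightarrow> real \<Rightarrow> ennreal" where
  "res u t = (\<Sum>k. ennreal ((real (ceil_above u) - u) ^ k) * rpow (ceil_above u) k t)"

lemma ceil_above_bounds:
  assumes "0 \<le> u"
  shows "u < real (ceil_above u)" "real (ceil_above u) \<le> u + 1"
  using assms unfolding ceil_above_def by linarith+

lemma res_measurable_pair [measurable]: "(\<lambda>(u, t). res u t) \<in> borel_measurable (borel \<Otimes>\<^sub>M borel)"
proof -
  have "(\<lambda>p. \<Sum>k. ennreal ((real (ceil_above (fst p)) - fst p) ^ k) * rpow (ceil_above (fst p)) k (snd p))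
      \<in> borel_measurable (borel \<Otimes>\<^sub>M borel)"
    by (rule measurable_compose_countable[where f="\<lambda>N p. \<Sum>k. ennreal ((real N - fst p) ^ k) * rpow N k (snd p)"])
      (auto simp: ceil_above_def)
  then show ?thesis by (simp add: res_def case_prod_beta')
qed

lemma res_measurable [measurable]: "res u \<in> borel_measurable borel"
  unfolding res_def[abs_def] by measurable

lemma res_nonpos: "t \<le> 0 \<Longrightarrow> res u t = 0"
  by (simp add: res_def rpow_nonpos)

lemma nnlap_res:
  assumes u: "0 \<le> u" and x: "0 < x"
  shows "nnlap (res u) x = ennreal (1 / (phi x + u))"
proof -
  define N where "N = ceil_above u"
  have N: "u < real N" using ceil_above_bounds(1)[OF u] by (simp add: N_def)
  have ph: "0 < phi x" using phi_pos[OF x] .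
  define q where "q = (real N - u) / (phi x + real N)"
  have q: "0 \<le> q" "q < 1" using N u ph by (auto simp: q_def)
  have "nnlap (res u) x = (\<Sum>k. nnlap (\<lambda>t. ennreal ((real N - u) ^ k) * rpow N k t) x)"
    unfolding res_def[abs_def] N_def by (rule nnlap_suminf) measurable
  also have "\<dots> = (\<Sum>k. ennreal (1 / (phi x + real N) * q ^ k))"
  proof (rule suminf_cong)
    fix k
    have "nnlap (\<lambda>t. ennreal ((real N - u) ^ k) * rpow N k t) x
        = ennreal ((real N - u) ^ k) * ennreal ((1 / (phi x + real N)) ^ Suc k)"
      by (simp only: nnlap_cmult[OF rpow_measurable] nnlap_rpow[OF x])
    also have "\<dots> = ennreal ((real N - u) ^ k * (1 / (phi x + real N)) ^ Suc k)"
      using N by (intro ennreal_mult'[symmetric]) auto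
    also have "(real N - u) ^ k * (1 / (phi x + real N)) ^ Suc k = 1 / (phi x + real N) * q ^ k"
      by (simp add: q_def power_divide)
    finally show "nnlap (\<lambda>t. ennreal ((real N - u) ^ k) * rpow N k t) x = ennreal (1 / (phi x + real N) * q ^ k)" .
  qed
  also have "\<dots> = ennreal (1 / (phi x + real N) * (1 / (1 - q)))"
  proof (rule suminf_ennreal_eq)
    show "0 \<le> 1 / (phi x + real N) * q ^ k" for k using q ph by auto
    show "(\<lambda>k. 1 / (phi x + real N) * q ^ k) sums (1 / (phi x + real N) * (1 / (1 - q)))"
      using q by (intro sums_mult geometric_sums) auto
  qed
  also have "1 / (phi x + real N) * (1 / (1 - q)) = 1 / (phi x + u)"
  proof -
    have "phi x + real N > 0" "phi x + u > 0" using N u ph by auto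
    moreover have "1 - q = (phi x + u) / (phi x + real N)"
      using N u ph by (simp add: q_def field_simps)
    ultimately show ?thesis by simp
  qed
  finally show ?thesis .
qed

lemma res_eq_r:
  assumes u: "0 \<le> u"
  shows "AE t in lborel. res u t = r u t"
  by (rule nnlap_inj[where x=1]) (auto simp: res_nonpos r_nonpos nnlap_res nnlap_r u)

text \<open>Partial fractions on the side of the transforms; the order \<open>u \<le> v\<close>
  keeps the coefficient nonnegative.\<close>

lemma resolvent_equation:
  assumes u: "0 \<le> u" "u \<le> v"
  shows "AE t in lborel. res u t = res v t + ennreal (v - u) * nnconv (res u) (res v) t"
proof (rule nnlap_inj[where x=1])
  show "nnlap (res u) y = nnlap (\<lambda>t. res v t + ennreal (v - u) * nnconv (res u) (res v) t) y" if y: "1 \<le> y" for y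
  proof -
    have y0: "0 < y" using y by simp
    have "1 / (phi y + v) + (v - u) * (1 / (phi y + u) * (1 / (phi y + v))) = 1 / (phi y + u)"
    proof -
      have "phi y + v > 0" "phi y + u > 0" using phi_pos[OF y0] u by auto
      then show ?thesis by (simp add: divide_simps)
    qed
    then have "ennreal (1 / (phi y + v)) + ennreal (v - u) * (ennreal (1 / (phi y + u)) * ennreal (1 / (phi y + v))) = ennreal (1 / (phi y + u))"
      using phi_pos[OF y0] u y0 by (simp add: ennreal_mult[symmetric] ennreal_plus[symmetric] del: ennreal_plus)
    then show ?thesis
      using u y0 by (simp add: nnlap_add nnlap_cmult nnlap_nnconv nnlap_res)
  qed
  show "nnlap (res u) 1 < \<infinity>" using u by (simp add: nnlap_res)
  show "res v t + ennreal (v - u) * nnconv (res u) (res v) t = 0" if "t \<le> 0" for t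
    using that nnconv_nonpos[of "res u" "res v" t] by (simp add: res_nonpos)
qed (auto simp: res_nonpos)

text \<open>The weight vanishes for u \<le> 0, where the absolute value merely keeps the parameter
  of \<open>res\<close> nonnegative. The normalization makes the transform exactly (phi + c) powr (-
  a).\<close>

definition mixture :: "real \<Rightarrow> real \<Rightarrow> real \<Rightarrow> ennreal" where
  "mixture a c t = (\<integral>\<^sup>+u. ennreal (powker a u / powker_const a) * res (\<bar>u\<bar> + c) t \<partial>lborel)"

lemma mixture_measurable [measurable]: "mixture a c \<in> borel_measurable borel"
  unfolding mixture_def[abs_def] by measurable

lemma mixture_nonpos: "t \<le> 0 \<Longrightarrow> mixture a c t = 0"
  by (simp add: mixture_def res_nonpos)

lemma nnlap_mixture:
  assumes a: "0 < a" "a < 1" and c: "0 \<le> c" and x: "0 < x"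
  shows "nnlap (mixture a c) x = ennreal ((phi x + c) powr (- a))"
proof -
  have I: "0 < powker_const a" by (rule powker_const_pos[OF a])
  have p: "0 < phi x + c" using phi_pos[OF x] c by simp
  have "nnlap (mixture a c) x = (\<integral>\<^sup>+u. nnlap (\<lambda>t. ennreal (powker a u / powker_const a) * res (\<bar>u\<bar> + c) t) x \<partial>lborel)"
    unfolding mixture_def[abs_def] by (rule nnlap_nn_integral) measurable
  also have "\<dots> = (\<integral>\<^sup>+u. ennreal (1 / powker_const a) * ennreal (powker a u / (phi x + c + u)) \<partial>lborel)"
  proof (intro nn_integral_cong)
    fix u :: real
    have "nnlap (\<lambda>t. ennreal (powker a u / powker_const a) * res (\<bar>u\<bar> + c) t) x
        = ennreal (powker a u / powker_const a) * ennreal (1 / (phi x + (\<bar>u\<bar> + c)))"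
      using c x by (simp only: nnlap_cmult[OF res_measurable]) (simp add: nnlap_res)
    also have "\<dots> = ennreal (powker a u / powker_const a * (1 / (phi x + (\<bar>u\<bar> + c))))"
      using I by (intro ennreal_mult'[symmetric]) auto
    also have "powker a u / powker_const a * (1 / (phi x + (\<bar>u\<bar> + c))) = 1 / powker_const a * (powker a u / (phi x + c + u))"
      by (cases "0 < u") (auto simp: powker_def add_ac)
    finally show "nnlap (\<lambda>t. ennreal (powker a u / powker_const a) * res (\<bar>u\<bar> + c) t) x
        = ennreal (1 / powker_const a) * ennreal (powker a u / (phi x + c + u))"
      using I by (simp add: ennreal_mult'[symmetric] del: ennreal_mult')
  qed
  also have "\<dots> = ennreal (1 / powker_const a) * ennreal ((phi x + c) powr (- a) * powker_const a)"
    by (subst nn_integral_cmult) (use nn_integral_powker[OF a p] in auto)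
  also have "\<dots> = ennreal ((phi x + c) powr (- a))"
    using I by (simp add: ennreal_mult'[symmetric])
  finally show ?thesis .
qed

end

section \<open>Volterra equations and complete positivity\<close>

lemma nnlap_eventually_small:
  assumes "H \<in> borel_measurable borel" "\<And>t. t \<le> 0 \<Longrightarrow> H t = 0" "nnlap H 1 < \<infinity>" "0 < c"
  obtains x where "1 \<le> x" "\<And>y. x \<le> y \<Longrightarrow> nnlap H y < c"
proof -
  have "(\<lambda>n. nnlap H (1 + real n)) \<longlonglongrightarrow> 0"
    by (rule nnlap_tendsto_0[OF assms(1-3)])
  from order_tendstoD(2)[OF this assms(4)] obtain n where n: "nnlap H (1 + real n) < c"
    by (auto simp: eventually_sequentially)
  show thesis
  proof (rule that)
    show "nnlap H y < c" if "1 + real n \<le> y" for y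
      using nnlap_antimono[of H "1 + real n" y, OF assms(2) that] n by (rule le_less_trans)
  qed simp
qed

text \<open>
  The even and odd parts of the Neumann series are nonnegative and converge; the hypothesis is the
  complete monotonicity of the Laplace transform of their difference, which is the solution.
\<close>

lemma volterra_nonneg_solution:
  assumes [measurable]: "H \<in> borel_measurable borel" "F \<in> borel_measurable borel"
    and supp: "\<And>t. t \<le> 0 \<Longrightarrow> H t = 0" "\<And>t. t \<le> 0 \<Longrightarrow> F t = 0"
    and fin: "nnlap H 1 < \<infinity>" "nnlap F 1 < \<infinity>"
    and \<beta>: "0 \<le> \<beta>"
    and cm: "\<And>x. 1 \<le> x \<Longrightarrow> cm_seq (\<lambda>k. enn2real (nnlap F (x + real k)) / (1 + \<beta> * enn2real (nnlap H (x + real k))))"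
  obtains U where "U \<in> borel_measurable borel" "\<And>t. t \<le> 0 \<Longrightarrow> U t = 0"
    "\<And>T. (\<integral>\<^sup>+t. U t * indicator {..T} t \<partial>lborel) < \<infinity>"
    "AE t in lborel. U t + ennreal \<beta> * nnconv H U t = F t"
proof -
  \<comment> \<open>This threshold also makes sense for \<beta> = 0 and forces \<beta> times the
    transform of \<open>H\<close> below 1, so that the transformed Neumann series converges.\<close>
  obtain x where x: "1 \<le> x" "\<And>y. x \<le> y \<Longrightarrow> nnlap H y < ennreal (1 / (\<beta> + 1))"
    using nnlap_eventually_small[OF _ supp(1) fin(1), of "ennreal (1 / (\<beta> + 1))"] \<beta> by auto
  define S where "S n = ((\<lambda>G t. ennreal \<beta> * nnconv H G t) ^^ n) F" for n
  have S0: "S 0 = F" and SS: "S (Suc n) = (\<lambda>t. ennreal \<beta> * nnconv H (S n) t)" for n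
    by (auto simp: S_def)
  have [measurable]: "S n \<in> borel_measurable borel" for n
    by (induction n) (auto simp: S0 SS)
  have Ssupp: "S n t = 0" if "t \<le> 0" for n t
    using that by (induction n arbitrary: t) (auto simp: S0 SS supp nnconv_nonpos)
  define e where "e t = (\<Sum>n. S (2 * n) t)" for t
  define d where "d t = (\<Sum>n. S (Suc (2 * n)) t)" for t
  have [measurable]: "e \<in> borel_measurable borel" "d \<in> borel_measurable borel"
    unfolding e_def[abs_def] d_def[abs_def] by measurable
  have esupp: "e t = 0" and dsupp: "d t = 0" if "t \<le> 0" for t
    using Ssupp that by (auto simp: e_def d_def)
  have d_eq: "d t = ennreal \<beta> * nnconv H e t" for t
    unfolding d_def SS e_def[abs_def] by (subst nnconv_suminf) auto
  have e_eq: "e t = F t + ennreal \<beta> * nnconv H d t" for t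
  proof -
    have "e t = (\<Sum>n. S (2 * Suc n) t) + S (2 * 0) t"
      unfolding e_def by (rule sums_unique[symmetric], rule sums_Suc, rule summable_sums) simp
    also have "(\<Sum>n. S (2 * Suc n) t) = ennreal \<beta> * nnconv H d t"
      unfolding d_def[abs_def] by (subst nnconv_suminf) (auto simp: SS[of "Suc _"])
    finally show ?thesis by (simp add: S0 add.commute)
  qed
  \<comment> \<open>With q denoting \<beta> times the transform of \<open>H\<close>, the even part
    sums to f / (1 - q^2) and the odd part to q times that. The difference f / (1 + q) is the
    sequence assumed completely monotone.\<close>
  have lap: "nnlap e y < \<infinity> \<and> nnlap d y < \<infinity> \<and>
      enn2real (nnlap e y) - enn2real (nnlap d y) = enn2real (nnlap F y) / (1 + \<beta> * enn2real (nnlap H y))"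
    if y: "x \<le> y" for y
  proof -
    have "nnlap F y < \<infinity>"
      using nnlap_antimono[of F 1 y, OF supp(2)] x(1) y fin(2) by (auto intro: le_less_trans)
    then obtain f where f: "nnlap F y = ennreal f" "0 \<le> f" by (cases "nnlap F y") auto
    obtain h where h: "nnlap H y = ennreal h" "0 \<le> h"
      using x(2)[OF y] by (cases "nnlap H y") auto
    have "h < 1 / (\<beta> + 1)"
      using x(2)[OF y] h by (simp add: ennreal_less_iff)
    define q where "q = \<beta> * h"
    have "h * (\<beta> + 1) < 1" using \<open>h < 1 / (\<beta> + 1)\<close> \<beta> by (simp add: field_simps)
    then have q: "0 \<le> q" "q < 1" using h \<beta> by (auto simp: q_def algebra_simps)
    have Sn: "nnlap (S n) y = ennreal (f * q ^ n)" for n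
    proof (induction n)
      case (Suc n)
      have "nnlap (S (Suc n)) y = ennreal \<beta> * (ennreal h * ennreal (f * q ^ n))"
        by (simp add: SS nnlap_cmult nnlap_nnconv Suc h)
      also have "\<dots> = ennreal (f * q ^ Suc n)"
        using \<beta> h f q by (simp add: ennreal_mult[symmetric] q_def mult_ac)
      finally show ?case .
    qed (simp add: S0 f)
    have q2: "q\<^sup>2 < 1" using q by (simp add: power_less_one_iff abs_square_less_1)
    have e1: "nnlap e y = ennreal (f * (1 / (1 - q\<^sup>2)))"
    proof -
      have "nnlap e y = (\<Sum>n. nnlap (S (2 * n)) y)"
        unfolding e_def[abs_def] by (rule nnlap_suminf) measurable
      also have "\<dots> = (\<Sum>n. ennreal (f * (q\<^sup>2) ^ n))" by (simp add: Sn power_mult)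
      also have "\<dots> = ennreal (f * (1 / (1 - q\<^sup>2)))"
        using f q q2 by (intro suminf_ennreal_eq sums_mult geometric_sums) auto
      finally show ?thesis .
    qed
    have d1: "nnlap d y = ennreal (q * (f * (1 / (1 - q\<^sup>2))))"
    proof -
      have "nnlap d y = ennreal \<beta> * (ennreal h * ennreal (f * (1 / (1 - q\<^sup>2))))"
        unfolding d_eq[abs_def] by (simp only: nnlap_cmult[OF measurable_nnconv] nnlap_nnconv \<open>H \<in> borel_measurable borel\<close> \<open>e \<in> borel_measurable borel\<close> h e1)
      also have "\<dots> = ennreal (q * (f * (1 / (1 - q\<^sup>2))))"
        using \<beta> h f q2 by (simp add: ennreal_mult[symmetric] q_def mult_ac)
      finally show ?thesis .
    qed
    have "f * (1 / (1 - q\<^sup>2)) - q * (f * (1 / (1 - q\<^sup>2))) = f / (1 + q)"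
    proof -
      have "1 - q\<^sup>2 = (1 - q) * (1 + q)" by (simp add: power2_eq_square algebra_simps)
      then show ?thesis using q by (simp add: divide_simps) (simp add: algebra_simps)
    qed
    then show ?thesis
      using f h q q2 by (simp add: e1 d1 q_def)
  qed
  have de: "AE t in lborel. d t \<le> e t"
  proof (rule nnlap_cm_diff[where x=x])
    have "(\<lambda>k. enn2real (nnlap e (x + real k)) - enn2real (nnlap d (x + real k)))
        = (\<lambda>k. enn2real (nnlap F (x + real k)) / (1 + \<beta> * enn2real (nnlap H (x + real k))))"
      using lap by auto
    then show "cm_seq (\<lambda>k. enn2real (nnlap e (x + real k)) - enn2real (nnlap d (x + real k)))"
      using cm[OF x(1)] by simp
  qed (use lap esupp dsupp in auto)
  define U where "U t = e t - d t" for t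
  have [measurable]: "U \<in> borel_measurable borel" unfolding U_def[abs_def] by measurable
  have Usupp: "U t = 0" if "t \<le> 0" for t using that by (simp add: U_def esupp)
  have "AE t in lborel. e t < \<infinity>" by (rule nnlap_finite_AE[where x=x]) (use lap in auto)
  with de have eU: "AE t in lborel. e t = U t + d t"
    by eventually_elim (auto simp: U_def diff_add_cancel_ennreal)
  have "nnlap U x \<le> nnlap e x"
    by (rule nnlap_mono_AE) (auto simp: U_def intro!: AE_I2 diff_le_self_ennreal)
  then have Ufin: "nnlap U x < \<infinity>" using lap[of x] by (auto intro: le_less_trans)
  have "nnconv H e t = nnconv H U t + nnconv H d t" for t
    unfolding nnconv_cong_AE[OF eU] by (rule nnconv_add) measurable
  note He = this
  have "AE t in lborel. U t + ennreal \<beta> * nnconv H U t = F t"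
    using eU \<open>AE t in lborel. e t < \<infinity>\<close>
  proof eventually_elim
    case (elim t)
    \<comment> \<open>Inserting e = U + d into d = \<beta> (H * e) and e = F + \<beta> (H * d) gives
      the equation for \<open>U\<close> once \<beta> (H * d) is cancelled, which requires this term
      to be finite.\<close>
    have "ennreal \<beta> * nnconv H d t \<noteq> \<infinity>"
      using elim(2) e_eq[of t] by auto
    moreover have "ennreal \<beta> * nnconv H d t + (U t + ennreal \<beta> * nnconv H U t) = ennreal \<beta> * nnconv H d t + F t"
    proof -
      have "ennreal \<beta> * nnconv H d t + (U t + ennreal \<beta> * nnconv H U t)
          = U t + ennreal \<beta> * (nnconv H U t + nnconv H d t)"
        by (simp only: distrib_left add_ac)
      also have "\<dots> = U t + d t" by (simp only: d_eq[of t] He)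
      also have "\<dots> = ennreal \<beta> * nnconv H d t + F t"
        using elim(1) e_eq[of t] by (metis add.commute)
      finally show ?thesis .
    qed
    ultimately show ?case by (metis ennreal_add_left_cancel infinity_ennreal_def)
  qed
  moreover have "(\<integral>\<^sup>+t. U t * indicator {..T} t \<partial>lborel) < \<infinity>" for T
    using x(1) by (intro locally_finite_of_nnlap[OF _ Usupp Ufin]) auto
  ultimately show thesis
    using that[of U] Usupp by auto
qed

text \<open>The resolvents of \<open>h\<close> have the transforms (\<Psi> / x) / (\<Psi> + \<beta>
  G) and G / (\<Psi> + \<beta> G), which are built from the two monotonicity clauses of
  \<open>bernstein_seq\<close>.\<close>

lemma completely_positiveI:
  assumes H: "ennreal_version h H" and G: "0 < G"
    and lap: "\<And>x. 0 < x \<Longrightarrow> nnlap H x = ennreal (G / \<Psi> x)"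
    and \<Psi>: "\<And>x. 0 < x \<Longrightarrow> bernstein_seq (\<lambda>k. x + real k) (\<lambda>k. \<Psi> (x + real k))"
  shows "completely_positive h"
proof -
  note [measurable] = ennreal_version_measurable[OF H]
  have pos: "0 < \<Psi> x" if "0 < x" for x
    using \<Psi>[OF that] unfolding bernstein_seq_def by (metis add.right_neutral of_nat_0)
  have fin: "nnlap H x < \<infinity>" if "0 < x" for x using lap[OF that] by simp
  have nz: "\<not> (AE t in lebesgue. 0 < t \<longrightarrow> h t = 0)"
  proof
    assume "AE t in lebesgue. 0 < t \<longrightarrow> h t = 0"
    then have "AE t in lborel. H t = 0"
      using ennreal_version_AE[OF H] unfolding AE_completion_iff
    proof eventually_elim
      case (elim t)
      then show ?case using ennreal_version_nonpos[OF H, of t] by (cases "t \<le> 0") auto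
    qed
    then have "nnlap H 1 = 0" by (subst nnlap_eq_0_iff) auto
    moreover have "nnlap H 1 > 0" using pos[of 1] G by (simp add: lap)
    ultimately show False by simp
  qed
  have sol: "\<exists>u. volterra_solution h \<beta> f u \<and> (AE t in lebesgue. 0 < t \<longrightarrow> 0 \<le> u t)"
    if F: "ennreal_version f F" and "0 \<le> \<beta>" and Ffin: "nnlap F 1 < \<infinity>"
      and cm: "\<And>x. 1 \<le> x \<Longrightarrow> 0 < \<beta> \<Longrightarrow> cm_seq (\<lambda>k. enn2real (nnlap F (x + real k)) / (1 + \<beta> * enn2real (nnlap H (x + real k))))"
    for f F \<beta>
  proof -
    \<comment> \<open>For \<beta> = 0 the transform of \<open>F\<close> itself is at issue, whereas
      \<open>bernstein_seq\<close> speaks of 1 / (\<psi> + t) for t > 0.\<close>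
    have cm': "cm_seq (\<lambda>k. enn2real (nnlap F (x + real k)) / (1 + \<beta> * enn2real (nnlap H (x + real k))))" if "1 \<le> x" for x
    proof (cases "\<beta> = 0")
      case True
      have "nnlap F x < \<infinity>"
        using nnlap_antimono[of F 1 x, OF ennreal_version_nonpos[OF F] that] Ffin by (auto intro: le_less_trans)
      then show ?thesis
        using nnlap_cm_seq[OF ennreal_version_measurable[OF F] ennreal_version_nonpos[OF F]] True by simp
    next
      case False
      then show ?thesis using cm that \<open>0 \<le> \<beta>\<close> by simp
    qed
    obtain U where U: "U \<in> borel_measurable borel" "\<And>t. t \<le> 0 \<Longrightarrow> U t = 0"
      "\<And>T. (\<integral>\<^sup>+t. U t * indicator {..T} t \<partial>lborel) < \<infinity>"
      "AE t in lborel. U t + ennreal \<beta> * nnconv H U t = F t"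
      using volterra_nonneg_solution[OF ennreal_version_measurable[OF H] ennreal_version_measurable[OF F] ennreal_version_nonpos[OF H] ennreal_version_nonpos[OF F]
        fin[of 1, OF zero_less_one] Ffin \<open>0 \<le> \<beta>\<close> cm'] by metis
    have "ennreal_version (\<lambda>t. enn2real (U t)) U" by (rule ennreal_version_enn2real[OF U(1-3)])
    from volterra_solution_iff[OF H F this \<open>0 \<le> \<beta>\<close>] U(4)
    have "volterra_solution h \<beta> f (\<lambda>t. enn2real (U t))" by simp
    then show ?thesis by (intro exI[of _ "\<lambda>t. enn2real (U t)"]) auto
  qed
  have eqs: "1 / y / (1 + \<beta> * (G / \<Psi> y)) = \<Psi> y / y * (1 / (\<Psi> y + \<beta> * G))"
    "G / \<Psi> y / (1 + \<beta> * (G / \<Psi> y)) = G * (1 / (\<Psi> y + \<beta> * G))" if "0 < y" "0 < \<beta>" for y \<beta>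
  proof -
    have "1 + \<beta> * (G / \<Psi> y) = (\<Psi> y + \<beta> * G) / \<Psi> y" using pos[OF that(1)] by (simp add: field_simps)
    then show "1 / y / (1 + \<beta> * (G / \<Psi> y)) = \<Psi> y / y * (1 / (\<Psi> y + \<beta> * G))"
      "G / \<Psi> y / (1 + \<beta> * (G / \<Psi> y)) = G * (1 / (\<Psi> y + \<beta> * G))"
      using pos[OF that(1)] by auto
  qed
  show ?thesis
    unfolding completely_positive_def
  proof (intro conjI allI impI nz ennreal_version_L1_loc[OF H])
    fix \<beta> :: real assume \<beta>: "0 \<le> \<beta>"
    show "\<exists>s. volterra_solution h \<beta> (\<lambda>_. 1) s \<and> (AE t in lebesgue. 0 < t \<longrightarrow> 0 \<le> s t)"
    proof (rule sol[OF ennreal_version_one \<beta>])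
      show "nnlap (indicator {0<..}) 1 < \<infinity>" by (simp add: nnlap_indicator)
      fix x :: real assume x: "1 \<le> x" and "0 < \<beta>"
      have "cm_seq (\<lambda>k. \<Psi> (x + real k) / (x + real k) * (1 / (\<Psi> (x + real k) + \<beta> * G)))"
        using \<Psi>[of x] x \<open>0 < \<beta>\<close> G by (intro cm_seq_mult) (auto simp: bernstein_seq_def)
      also have "(\<lambda>k. \<Psi> (x + real k) / (x + real k) * (1 / (\<Psi> (x + real k) + \<beta> * G)))
        = (\<lambda>k. enn2real (nnlap (indicator {0<..}) (x + real k)) / (1 + \<beta> * enn2real (nnlap H (x + real k))))"
      proof
        fix k :: nat
        have y: "0 < x + real k" using x by simp
        show "\<Psi> (x + real k) / (x + real k) * (1 / (\<Psi> (x + real k) + \<beta> * G))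
          = enn2real (nnlap (indicator {0<..}) (x + real k)) / (1 + \<beta> * enn2real (nnlap H (x + real k)))"
          unfolding nnlap_indicator[OF y] lap[OF y] eqs(1)[OF y \<open>0 < \<beta>\<close>, symmetric]
          using y pos[OF y] G by simp
      qed
      finally show "cm_seq (\<lambda>k. enn2real (nnlap (indicator {0<..}) (x + real k)) / (1 + \<beta> * enn2real (nnlap H (x + real k))))" .
    qed
    show "\<exists>r. volterra_solution h \<beta> h r \<and> (AE t in lebesgue. 0 < t \<longrightarrow> 0 \<le> r t)"
    proof (rule sol[OF H \<beta>])
      show "nnlap H 1 < \<infinity>" by (rule fin) simp
      fix x :: real assume x: "1 \<le> x" and "0 < \<beta>"
      have "cm_seq (\<lambda>k. G * (1 / (\<Psi> (x + real k) + \<beta> * G)))"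
        using \<Psi>[of x] x \<open>0 < \<beta>\<close> G by (intro cm_seq_cmult) (auto simp: bernstein_seq_def)
      also have "(\<lambda>k. G * (1 / (\<Psi> (x + real k) + \<beta> * G)))
        = (\<lambda>k. enn2real (nnlap H (x + real k)) / (1 + \<beta> * enn2real (nnlap H (x + real k))))"
      proof
        fix k :: nat
        have y: "0 < x + real k" using x by simp
        show "G * (1 / (\<Psi> (x + real k) + \<beta> * G))
          = enn2real (nnlap H (x + real k)) / (1 + \<beta> * enn2real (nnlap H (x + real k)))"
          unfolding lap[OF y] eqs(2)[OF y \<open>0 < \<beta>\<close>, symmetric] using pos[OF y] G by simp
      qed
      finally show "cm_seq (\<lambda>k. enn2real (nnlap H (x + real k)) / (1 + \<beta> * enn2real (nnlap H (x + real k))))" .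
    qed
  qed
qed

lemma completely_positive_kernel:
  assumes "completely_positive l"
  obtains L r s where "ennreal_version l L" "cp_kernel L r s"
proof -
  note cp = assms[unfolded completely_positive_def]
  \<comment> \<open>The resolvent with parameter 0 is \<open>l\<close> itself.\<close>
  have "AE t in lebesgue. 0 < t \<longrightarrow> 0 \<le> l t"
  proof -
    obtain \<rho> where \<rho>: "volterra_solution l 0 l \<rho>" "AE t in lebesgue. 0 < t \<longrightarrow> 0 \<le> \<rho> t"
      using cp by auto
    from \<rho>(1) have "AE t in lebesgue. 0 < t \<longrightarrow> \<rho> t = l t"
      by (simp add: volterra_solution_def)
    with \<rho>(2) show ?thesis by eventually_elim auto
  qed
  then obtain L where L: "ennreal_version l L" using ennreal_version_exists cp by blast
  note [measurable] = ennreal_version_measurable[OF L]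
  have sol: "\<exists>U. U \<in> borel_measurable borel \<and> (\<forall>t\<le>0. U t = 0) \<and> (AE t in lborel. U t + ennreal u * nnconv L U t = F t)"
    if F: "ennreal_version f F" and "0 \<le> u" and ex: "\<exists>\<rho>. volterra_solution l u f \<rho> \<and> (AE t in lebesgue. 0 < t \<longrightarrow> 0 \<le> \<rho> t)" for f F u
  proof -
    obtain \<rho> where \<rho>: "volterra_solution l u f \<rho>" "AE t in lebesgue. 0 < t \<longrightarrow> 0 \<le> \<rho> t"
      using ex by blast
    then obtain U where U: "ennreal_version \<rho> U" using ennreal_version_exists by (auto simp: volterra_solution_def)
    with volterra_solution_iff[OF L F U \<open>0 \<le> u\<close>] \<rho>(1) show ?thesis
      using ennreal_version_measurable[OF U] ennreal_version_nonpos[OF U] by blast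
  qed
  have cpr: "\<exists>\<rho>. volterra_solution l u l \<rho> \<and> (AE t in lebesgue. 0 < t \<longrightarrow> 0 \<le> \<rho> t)"
    and cps: "\<exists>\<rho>. volterra_solution l u (\<lambda>_. 1) \<rho> \<and> (AE t in lebesgue. 0 < t \<longrightarrow> 0 \<le> \<rho> t)" if "0 \<le> u" for u
    using cp that by auto
  have "\<forall>u. \<exists>U. 0 \<le> u \<longrightarrow> U \<in> borel_measurable borel \<and> (\<forall>t\<le>0. U t = 0) \<and> (AE t in lborel. U t + ennreal u * nnconv L U t = L t)"
    using sol[OF L _ cpr] by blast
  then obtain R where R: "\<And>u. 0 \<le> u \<Longrightarrow> R u \<in> borel_measurable borel \<and> (\<forall>t\<le>0. R u t = 0) \<and> (AE t in lborel. R u t + ennreal u * nnconv L (R u) t = L t)"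
    by metis
  have "\<forall>u. \<exists>U. 0 \<le> u \<longrightarrow> U \<in> borel_measurable borel \<and> (\<forall>t\<le>0. U t = 0) \<and> (AE t in lborel. U t + ennreal u * nnconv L U t = indicator {0<..} t)"
    using sol[OF ennreal_version_one _ cps] by blast
  then obtain S where S: "\<And>u. 0 \<le> u \<Longrightarrow> S u \<in> borel_measurable borel \<and> (\<forall>t\<le>0. S u t = 0) \<and> (AE t in lborel. S u t + ennreal u * nnconv L (S u) t = indicator {0<..} t)"
    by metis
  \<comment> \<open>\<open>max 0\<close> extends the families to negative parameters, for which the
    locale still asks for measurability and support.\<close>
  have "cp_kernel L (\<lambda>u. R (max 0 u)) (\<lambda>u. S (max 0 u))"
  proof
    show "\<not> (AE t in lborel. L t = 0)"
    proof
      assume "AE t in lborel. L t = 0"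
      then have "AE t in lebesgue. 0 < t \<longrightarrow> l t = 0"
        using ennreal_version_AE[OF L] unfolding AE_completion_iff by eventually_elim auto
      with cp show False by blast
    qed
    show "R (max 0 u) \<in> borel_measurable borel" "S (max 0 u) \<in> borel_measurable borel" for u
      using R[of "max 0 u"] S[of "max 0 u"] by auto
    show "R (max 0 u) t = 0" "S (max 0 u) t = 0" if "t \<le> 0" for u t
      using R[of "max 0 u"] S[of "max 0 u"] that by auto
    show "AE t in lborel. R (max 0 u) t + ennreal u * nnconv L (R (max 0 u)) t = L t" if "0 \<le> u" for u
      using R[OF that] that by (simp add: max_def)
    show "AE t in lborel. S (max 0 u) t + ennreal u * nnconv L (S (max 0 u)) t = indicator {0<..} t" if "0 \<le> u" for u
      using S[OF that] that by (simp add: max_def)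
  qed (use ennreal_version_nonpos[OF L] in auto)
  with L that show thesis by blast
qed

text \<open>The Bochner integral in \<open>conv\<close> splits over differences where the integrands
  are integrable. Tonelli's theorem for \<open>l\<close> and |g| provides this for almost every
  \<open>t\<close>, also for solutions of arbitrary sign.\<close>

lemma conv_set_integrable:
  assumes L: "ennreal_version l L" and g: "g \<in> L1_loc"
  shows "AE t in lborel. 0 < t \<longrightarrow> set_integrable lebesgue {0..t} (\<lambda>z. l (t - z) * g z)"
proof -
  note [measurable] = ennreal_version_measurable[OF L]
  obtain g' where [measurable]: "g' \<in> borel_measurable borel" and g': "AE t in lborel. 0 < t \<longrightarrow> g t = g' t"
    using L1_loc_AE_eq_borel[OF g] by blast
  have "(\<lambda>t. \<bar>g t\<bar>) \<in> L1_loc"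
    using g by (auto simp: L1_loc_def dest: set_integrable_abs)
  then obtain G where G: "ennreal_version (\<lambda>t. \<bar>g t\<bar>) G" using ennreal_version_exists[of "\<lambda>t. \<bar>g t\<bar>"] by auto
  note [measurable] = ennreal_version_measurable[OF G]
  have fin: "AE t in lborel. nnconv L G t < \<infinity>"
    using ennreal_version_measurable[OF ennreal_version_conv[OF L G]] ennreal_version_locally_finite[OF ennreal_version_conv[OF L G]]
    by (rule AE_finite_of_locally_finite)
  then show ?thesis
  proof eventually_elim
    case (elim t)
    define w where "w z = enn2real (L (t - z)) * (g' z * indicator {0<..} z)" for z
    have [measurable]: "w \<in> borel_measurable borel" unfolding w_def by measurable
    have ae: "AE z in lborel. indicator {0..t} z *\<^sub>R (l (t - z) * g z) = w z"
      using AE_lborel_reflect[OF ennreal_version_AE[OF L], of t] g' AE_lborel_singleton[of 0] AE_lborel_singleton[of t]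
    proof eventually_elim
      case (elim z)
      then show ?case
        using ennreal_version_nonpos[OF L, of "t - z"] by (cases "0 < z \<and> z < t") (auto simp: w_def)
    qed
    have "(\<integral>\<^sup>+z. ennreal (norm (w z)) \<partial>lborel) \<le> nnconv L G t"
      unfolding nnconv_def
    proof (rule nn_integral_mono_AE)
      show "AE z in lborel. ennreal (norm (w z)) \<le> L (t - z) * G z"
        using g' ennreal_version_AE[OF G]
      proof eventually_elim
        case (elim z)
        show ?case
        proof (cases "0 < z")
          case True
          then have "ennreal (norm (w z)) = ennreal (enn2real (L (t - z))) * G z"
            using elim by (simp add: w_def abs_mult ennreal_mult')
          also have "\<dots> \<le> L (t - z) * G z"
            by (intro mult_right_mono) (auto simp: ennreal_enn2real_if)
          finally show ?thesis .
        qed (simp add: w_def)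
      qed
    qed
    also have "\<dots> < \<infinity>" using elim .
    finally have "integrable lborel w" by (simp add: integrable_iff_bounded)
    then show ?case
      unfolding set_integrable_def by (subst lebesgue_AE_eq_borel(2)[OF _ ae]) auto
  qed
qed

text \<open>
  The difference of two solutions satisfies \<open>D \<le> \<gamma> * (l * D)\<close>, a strict contraction for the weight
  \<open>exp (- x * t)\<close> with \<open>x\<close> large.
\<close>

lemma volterra_solution_unique:
  assumes L: "ennreal_version l L" and fin: "nnlap L 1 < \<infinity>" and "0 \<le> \<gamma>"
    and u: "volterra_solution l \<gamma> f u" and v: "volterra_solution l \<gamma> f v"
  shows "AE t in lborel. 0 < t \<longrightarrow> u t = v t"
proof -
  have uL: "u \<in> L1_loc" and vL: "v \<in> L1_loc" using u v by (auto simp: volterra_solution_def)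
  have "(\<lambda>t. \<bar>u t - v t\<bar>) \<in> L1_loc"
    using uL vL by (auto simp: L1_loc_def intro!: set_integrable_abs set_integral_diff)
  then obtain D where D: "ennreal_version (\<lambda>t. \<bar>u t - v t\<bar>) D" using ennreal_version_exists[of "\<lambda>t. \<bar>u t - v t\<bar>"] by auto
  note [measurable] = ennreal_version_measurable[OF L] ennreal_version_measurable[OF D]
  have ae: "AE t in lborel. D t \<le> ennreal \<gamma> * nnconv L D t"
    using u[unfolded volterra_solution_def AE_completion_iff, THEN conjunct2]
      v[unfolded volterra_solution_def AE_completion_iff, THEN conjunct2]
      conv_set_integrable[OF L uL] conv_set_integrable[OF L vL] ennreal_version_AE[OF D] ennreal_version_AE[OF ennreal_version_conv[OF L D]]
      ennreal_version_AE[OF L]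
  proof eventually_elim
    case (elim t)
    show ?case
    proof (cases "0 < t")
      case True
      have iu: "set_integrable lebesgue {0..t} (\<lambda>z. l (t - z) * u z)"
        and iv: "set_integrable lebesgue {0..t} (\<lambda>z. l (t - z) * v z)" using elim True by auto
      have id: "set_integrable lebesgue {0..t} (\<lambda>z. l (t - z) * (u z - v z))"
        using set_integral_diff(1)[OF iu iv] by (simp add: algebra_simps)
      have "conv l u t - conv l v t = (LINT z:{0..t}|lebesgue. l (t - z) * (u z - v z))"
        unfolding conv_def by (subst set_integral_diff(2)[OF iu iv, symmetric]) (simp add: algebra_simps)
      also have "\<bar>\<dots>\<bar> \<le> (LINT z:{0..t}|lebesgue. \<bar>l (t - z) * (u z - v z)\<bar>)"
        using set_integral_norm_bound[OF id] by simp
      also have "\<dots> = conv l (\<lambda>t. \<bar>u t - v t\<bar>) t"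
        unfolding conv_def set_lebesgue_integral_def
      proof (rule integral_cong_AE)
        have ae: "AE z in lborel. indicator {0..t} z *\<^sub>R \<bar>l (t - z) * (u z - v z)\<bar> = indicator {0..t} z *\<^sub>R (l (t - z) * \<bar>u z - v z\<bar>)"
          using AE_lborel_reflect[OF ennreal_version_AE[OF L], of t] AE_lborel_singleton[of t]
          by eventually_elim (auto simp: indicator_def abs_mult)
        then show "AE z in lebesgue. indicator {0..t} z *\<^sub>R \<bar>l (t - z) * (u z - v z)\<bar> = indicator {0..t} z *\<^sub>R (l (t - z) * \<bar>u z - v z\<bar>)"
          by (rule AE_completion)
        show m: "(\<lambda>z. indicator {0..t} z *\<^sub>R \<bar>l (t - z) * (u z - v z)\<bar>) \<in> borel_measurable lebesgue"
          using borel_measurable_integrable[OF set_integrable_abs[OF id, unfolded set_integrable_def]] .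
        show "(\<lambda>z. indicator {0..t} z *\<^sub>R (l (t - z) * \<bar>u z - v z\<bar>)) \<in> borel_measurable lebesgue"
          by (rule borel_measurable_AE[OF m AE_completion[OF ae]])
      qed
      finally have le: "\<bar>conv l u t - conv l v t\<bar> \<le> conv l (\<lambda>t. \<bar>u t - v t\<bar>) t" .
      have "u t - v t = - (\<gamma> * (conv l u t - conv l v t))"
        using elim True by (simp add: algebra_simps)
      then have "\<bar>u t - v t\<bar> \<le> \<gamma> * conv l (\<lambda>t. \<bar>u t - v t\<bar>) t"
        using le \<open>0 \<le> \<gamma>\<close> by (simp add: abs_mult mult_left_mono)
      then have "ennreal \<bar>u t - v t\<bar> \<le> ennreal \<gamma> * ennreal (conv l (\<lambda>t. \<bar>u t - v t\<bar>) t)"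
        using \<open>0 \<le> \<gamma>\<close> by (simp flip: ennreal_mult' add: ennreal_leI)
      then show ?thesis using elim True by simp
    qed (simp add: ennreal_version_nonpos[OF D])
  qed
  obtain x where x: "1 \<le> x" "\<And>y. x \<le> y \<Longrightarrow> nnlap L y < ennreal (1 / (\<gamma> + 1))"
    using nnlap_eventually_small[OF _ ennreal_version_nonpos[OF L] fin, of "ennreal (1 / (\<gamma> + 1))"] \<open>0 \<le> \<gamma>\<close> by auto
  \<comment> \<open>\<open>D\<close> itself might have an infinite transform. Its truncations do
    not, and they inherit the inequality because up to \<open>T\<close> the convolution sees only
    values up to \<open>T\<close>.\<close>
  have "AE t in lborel. D t * indicator {..T} t = 0" for T
  proof -
    let ?D = "\<lambda>t. D t * indicator {..T} t"
    have le: "AE t in lborel. ?D t \<le> ennreal \<gamma> * nnconv L ?D t"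
      using ae
    proof eventually_elim
      case (elim t)
      show ?case
      proof (cases "t \<le> T")
        case True
        have "L (t - z) * D z = L (t - z) * ?D z" for z
          using True ennreal_version_nonpos[OF L, of "t - z"] by (cases "z \<le> T") auto
        then have "nnconv L D t = nnconv L ?D t" by (simp add: nnconv_def)
        then show ?thesis using elim True by simp
      qed simp
    qed
    have Dfin: "nnlap ?D x < \<infinity>"
    proof -
      have "nnlap ?D x \<le> nnlap ?D 0"
        using x(1) by (intro nnlap_antimono) (auto simp: ennreal_version_nonpos[OF D])
      also have "\<dots> < \<infinity>" using ennreal_version_locally_finite[OF D, of T] by (simp add: nnlap_def)
      finally show ?thesis .
    qed
    then obtain c where c: "nnlap ?D x = ennreal c" "0 \<le> c" by (cases "nnlap ?D x") auto
    obtain h where h: "nnlap L x = ennreal h" "0 \<le> h" using x(2)[of x] by (cases "nnlap L x") auto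
    have "nnlap ?D x \<le> nnlap (\<lambda>t. ennreal \<gamma> * nnconv L ?D t) x" by (rule nnlap_mono_AE[OF le])
    also have "\<dots> = ennreal \<gamma> * (nnlap L x * nnlap ?D x)"
      by (subst nnlap_cmult, measurable, subst nnlap_nnconv, measurable)
    finally have "ennreal c \<le> ennreal (\<gamma> * (h * c))"
      using c h \<open>0 \<le> \<gamma>\<close> by (simp add: ennreal_mult)
    then have "c \<le> \<gamma> * h * c" using c h \<open>0 \<le> \<gamma>\<close> by (subst (asm) ennreal_le_iff) (auto simp: mult_ac)
    moreover have "\<gamma> * h < 1"
    proof -
      have "h < 1 / (\<gamma> + 1)" using x(2)[of x] h by (simp add: ennreal_less_iff)
      then have "h * (\<gamma> + 1) < 1" using \<open>0 \<le> \<gamma>\<close> by (simp add: field_simps)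
      then show ?thesis using h by (simp add: algebra_simps)
    qed
    ultimately have "c = 0"
      using c(2) by (metis mult_less_cancel_right2 not_le order_le_less)
    with c have "nnlap ?D x = 0" by simp
    then show ?thesis by (subst (asm) nnlap_eq_0_iff) measurable
  qed
  then have "AE t in lborel. \<forall>n::nat. D t * indicator {..real n} t = 0" unfolding AE_all_countable by blast
  with ennreal_version_AE[OF D] show ?thesis
  proof eventually_elim
    case (elim t)
    obtain n where "t \<le> real n" using real_arch_simple by blast
    with elim(2)[rule_format, of n] have "D t = 0" by simp
    with elim(1) show ?case by (auto simp: ennreal_eq_0_iff)
  qed
qed

section \<open>Positivity of the resolvents\<close>

lemma lborel_compact_subset:
  assumes A: "A \<in> sets borel" and pos: "0 < emeasure lborel (A :: real set)"
  obtains K where "compact K" "K \<subseteq> A" "0 < emeasure lborel K"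
proof -
  define B where "B n = A \<inter> {- real n..real n}" for n :: nat
  have [measurable]: "B n \<in> sets borel" for n using A by (auto simp: B_def)
  have "\<exists>n. 0 < emeasure lborel (B n)"
  proof (rule ccontr)
    assume "\<not> ?thesis"
    then have "(\<Union>n. B n) \<in> null_sets lborel"
      by (intro null_sets_UN) (auto simp: null_sets_def not_less)
    moreover have "(\<Union>n. B n) = A"
    proof -
      have "\<exists>n. x \<in> {- real n..real n}" for x :: real
      proof -
        obtain n where "\<bar>x\<bar> \<le> real n" using real_arch_simple by blast
        then show ?thesis by (intro exI[of _ n]) auto
      qed
      then show ?thesis by (auto simp: B_def)
    qed
    ultimately show False using pos by (simp add: null_sets_def)
  qed
  then obtain n where n: "0 < emeasure lborel (B n)" by blast
  \<comment> \<open>Inner regularity is applied to a finite measure, hence the restriction of length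
    to a bounded interval.\<close>
  define M where "M = density lborel (indicator {- real n..real n})"
  have M: "emeasure M S = emeasure lborel (S \<inter> {- real n..real n})" if "S \<in> sets borel" for S
    unfolding M_def using that
    by (subst emeasure_density) (auto simp: nn_integral_indicator[symmetric] indicator_inter_arith mult.commute
      simp del: nn_integral_indicator intro!: nn_integral_cong)
  have "emeasure M (B n) = (SUP K \<in> {K. K \<subseteq> B n \<and> compact K}. emeasure M K)"
  proof (rule inner_regular)
    show "emeasure M (space M) \<noteq> \<infinity>"
      using M[of UNIV] by (simp add: M_def)
  qed (auto simp: M_def)
  moreover have "0 < emeasure M (B n)"
    using n M[OF \<open>B n \<in> sets borel\<close>] by (simp add: B_def Int_assoc)
  ultimately obtain K where K: "K \<subseteq> B n" "compact K" "0 < emeasure M K"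
    by (auto simp: less_SUP_iff)
  have Kb: "K \<in> sets borel" using K by (simp add: borel_compact)
  have "emeasure M K \<le> emeasure lborel K"
    unfolding M[OF Kb] by (rule emeasure_mono) (use Kb in auto)
  with K show thesis by (intro that[of K]) (auto simp: B_def)
qed

lemma indicator_conv:
  assumes [measurable]: "A \<in> sets borel" "B \<in> sets borel"
  shows "nnconv (indicator A) (indicator B) t = emeasure lborel {z \<in> B. t - z \<in> A}"
proof -
  have [measurable]: "{z \<in> B. t - z \<in> A} \<in> sets borel"
  proof -
    have "{z \<in> space borel. z \<in> B \<and> t - z \<in> A} \<in> sets borel" by measurable
    then show ?thesis by simp
  qed
  have "nnconv (indicator A) (indicator B) t = (\<integral>\<^sup>+z. indicator {z \<in> B. t - z \<in> A} z \<partial>lborel)"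
    unfolding nnconv_def by (intro nn_integral_cong) (auto simp: indicator_def)
  then show ?thesis by simp
qed

text \<open>
  Steinhaus' argument: a compact set of positive measure meets each of its small translates in
  positive measure.
\<close>

lemma open_indicator_conv_pos:
  assumes A [measurable]: "A \<in> sets borel" and B [measurable]: "B \<in> sets borel"
  shows "open {t. 0 < nnconv (indicator A) (indicator B) t}"
proof (rule openI)
  fix t0 assume "t0 \<in> {t. 0 < nnconv (indicator A) (indicator B) t}"
  then have pos: "0 < emeasure lborel {z \<in> B. t0 - z \<in> A}" by (simp add: indicator_conv)
  have m: "{z \<in> B. t - z \<in> A} \<in> sets borel" for t
  proof -
    have "{z \<in> space borel. z \<in> B \<and> t - z \<in> A} \<in> sets borel" by measurable
    then show ?thesis by simp
  qed
  obtain K where K: "compact K" "K \<subseteq> {z \<in> B. t0 - z \<in> A}" "0 < emeasure lborel K"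
    using lborel_compact_subset[OF m pos] by blast
  have Kb [measurable]: "K \<in> sets borel" using K(1) by (simp add: borel_compact)
  have "emeasure lborel K < \<infinity>" using K(1) by (rule emeasure_compact_finite)
  then obtain k where k: "emeasure lborel K = ennreal k" "0 < k"
    using K(3) by (cases "emeasure lborel K") auto
  obtain U where U: "open U" "K \<subseteq> U" "emeasure lborel (U - K) < ennreal k"
    using outer_regular_lborel[OF Kb k(2)] by blast
  obtain e where e: "0 < e" "(\<Union>x\<in>K. ball x e) \<subseteq> U"
    using compact_subset_open_imp_ball_epsilon_subset[OF K(1) U(1,2)] by blast
  have "0 < nnconv (indicator A) (indicator B) t" if t: "t \<in> ball t0 e" for t
  proof -
    \<comment> \<open>This translate of \<open>K\<close> stays in \<open>U\<close>. As
      \<open>U - K\<close> has less measure than \<open>K\<close>, the translate cannot lie outside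
      \<open>K\<close> up to a null set.\<close>
    define K' where "K' = (\<lambda>x. (t - t0) + x) ` K"
    have "compact K'" unfolding K'_def using K(1) by (rule compact_translation)
    then have K'b [measurable]: "K' \<in> sets borel" by (simp add: borel_compact)
    have "K' = {z. t0 - t + z \<in> K}" by (force simp: K'_def image_iff)
    have K'em: "emeasure lborel K' = ennreal k"
    proof -
      have "emeasure lborel K = (\<integral>\<^sup>+z. indicator K z \<partial>lborel)" by simp
      also have "\<dots> = (\<integral>\<^sup>+z. indicator K (z - (t - t0)) \<partial>lborel)"
        by (rule nn_integral_lborel_shift[symmetric]) measurable
      also have "\<dots> = (\<integral>\<^sup>+z. indicator K' z \<partial>lborel)"
        by (intro nn_integral_cong) (force simp: K'_def image_iff indicator_def)
      finally show ?thesis using k by simp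
    qed
    have K'U: "K' \<subseteq> U"
      using e(2) t by (force simp: K'_def dist_real_def)
    have "0 < emeasure lborel (K \<inter> K')"
    proof (rule ccontr)
      assume "\<not> ?thesis"
      then have "emeasure lborel (K \<inter> K') = 0" by simp
      then have "emeasure lborel (K' - K) = ennreal k"
        using emeasure_Un_null_set[of "K' - K" lborel "K \<inter> K'"] K'em
        by (simp add: null_sets_def Un_Diff_Int Int_commute)
      moreover have "emeasure lborel (K' - K) \<le> emeasure lborel (U - K)"
        using K'U U(1) by (intro emeasure_mono) auto
      ultimately show False using U(3) by simp
    qed
    \<comment> \<open>A point z = t - t0 + x of the translate satisfies t - z = t0 - x, which lies
      in \<open>A\<close> as x is in \<open>K\<close>; z lies in \<open>B\<close> because it is in
      \<open>K\<close> as well.\<close>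
    also have "K \<inter> K' \<subseteq> {z \<in> B. t - z \<in> A}"
    proof
      fix z assume "z \<in> K \<inter> K'"
      then obtain x where "x \<in> K" "z = t - t0 + x" "z \<in> K" by (auto simp: K'_def)
      with K(2) show "z \<in> {z \<in> B. t - z \<in> A}" by auto
    qed
    then have "emeasure lborel (K \<inter> K') \<le> emeasure lborel {z \<in> B. t - z \<in> A}"
      using m by (intro emeasure_mono) auto
    finally show ?thesis by (simp add: indicator_conv)
  qed
  with e(1) show "\<exists>e>0. ball t0 e \<subseteq> {t. 0 < nnconv (indicator A) (indicator B) t}" by auto
qed

text \<open>
  The set \<open>E\<close> of points where the convolution is positive is an open subsemigroup with arbitrarily
  small elements. It is therefore dense, and so \<open>E\<close> and \<open>t - E\<close> meet in \<open>(0, t)\<close> for every \<open>t > 0\<close>.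
\<close>

lemma AE_full_of_conv_closed:
  assumes A [measurable]: "A \<in> sets borel" and sub: "A \<subseteq> {0<..}"
    and small: "\<And>e. 0 < e \<Longrightarrow> 0 < emeasure lborel (A \<inter> {..<e})"
    and closed: "AE t in lborel. 0 < nnconv (indicator A) (indicator A) t \<longrightarrow> t \<in> A"
  shows "AE t in lborel. 0 < t \<longrightarrow> t \<in> (A :: real set)"
proof -
  define E where "E = {t. 0 < nnconv (indicator A) (indicator A) t}"
  have E_open: "open E" unfolding E_def by (rule open_indicator_conv_pos) measurable
  have E_pos: "0 < t" if "t \<in> E" for t
  proof (rule ccontr)
    assume "\<not> 0 < t"
    then have "nnconv (indicator A) (indicator A) t = 0"
      using sub by (intro nnconv_nonpos) (auto simp: indicator_def)
    with that show False by (simp add: E_def)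
  qed
  have E_A: "AE t in lborel. t \<in> E \<longrightarrow> t \<in> A" using closed by (simp add: E_def)
  \<comment> \<open>A neighbourhood of \<open>z\<close> lies in both \<open>E\<close> and t - E,
    hence up to a null set in both \<open>A\<close> and t - A.\<close>
  have E_meets: "t \<in> E" if z: "z \<in> E" "t - z \<in> E" for t z
  proof -
    have "open (E \<inter> (\<lambda>z. t - z) -` E)"
      using E_open by (intro open_Int open_vimage continuous_intros) auto
    moreover have "z \<in> E \<inter> (\<lambda>z. t - z) -` E" using z by simp
    ultimately obtain e where e: "0 < e" "ball z e \<subseteq> E \<inter> (\<lambda>z. t - z) -` E"
      by (rule openE)
    have m: "{z \<in> A. t - z \<in> A} \<in> sets borel"
    proof -
      have "{z \<in> space borel. z \<in> A \<and> t - z \<in> A} \<in> sets borel" by measurable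
      then show ?thesis by simp
    qed
    have "0 < emeasure lborel {z - e<..<z + e}" using e(1) by simp
    also have "\<dots> \<le> emeasure lborel {z \<in> A. t - z \<in> A}"
    proof (rule emeasure_mono_AE)
      show "AE x in lborel. x \<in> {z - e<..<z + e} \<longrightarrow> x \<in> {z \<in> A. t - z \<in> A}"
        using E_A AE_lborel_reflect[OF E_A, of t]
      proof eventually_elim
        case (elim x)
        show ?case
        proof
          assume "x \<in> {z - e<..<z + e}"
          then have "x \<in> ball z e" by (auto simp: dist_real_def)
          with e(2) elim show "x \<in> {z \<in> A. t - z \<in> A}" by auto
        qed
      qed
    qed (use m in auto)
    finally show ?thesis by (simp add: E_def indicator_conv)
  qed
  have E_add: "s + t \<in> E" if "s \<in> E" "t \<in> E" for s t
    using E_meets[of s "s + t"] that by simp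
  have E_small: "\<exists>t\<in>E. t < e" if e: "0 < e" for e
  proof (rule ccontr)
    assume no: "\<not> ?thesis"
    \<comment> \<open>If \<open>E\<close> had no point below \<open>e\<close>, the self-convolution
      of \<open>A'\<close> would vanish: below \<open>e\<close> by assumption, beyond because sums
      of two elements of \<open>A'\<close> stay below \<open>e\<close>. But its mass is the square
      of that of \<open>A'\<close>.\<close>
    define A' where "A' = A \<inter> {..<e / 2}"
    have [measurable]: "A' \<in> sets borel" by (simp add: A'_def)
    have "nnconv (indicator A') (indicator A') t = 0" for t
    proof (cases "t < e")
      case True
      then have "t \<notin> E" using no by auto
      moreover have "nnconv (indicator A') (indicator A') t \<le> nnconv (indicator A) (indicator A) t"
        unfolding nnconv_def A'_def by (intro nn_integral_mono) (auto simp: indicator_def)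
      ultimately show ?thesis by (simp add: E_def)
    next
      case False
      then have "{z \<in> A'. t - z \<in> A'} = {}" by (auto simp: A'_def)
      then show ?thesis by (simp only: indicator_conv[OF \<open>A' \<in> sets borel\<close> \<open>A' \<in> sets borel\<close>] emeasure_empty)
    qed
    then have "nnlap (nnconv (indicator A') (indicator A')) 0 = 0" by (simp add: nnlap_def)
    then have "emeasure lborel A' = 0" by (simp add: nnlap_nnconv) (simp add: nnlap_def)
    with small[of "e / 2"] e show False by (simp add: A'_def)
  qed
  have E_mult: "real (Suc n) * t \<in> E" if "t \<in> E" for n t
  proof (induction n)
    case (Suc n)
    have "real (Suc (Suc n)) * t = real (Suc n) * t + t" by (simp add: algebra_simps)
    then show ?case using E_add[OF Suc that] by simp
  qed (use that in simp)
  have E_dense: "\<exists>x\<in>E. t - e < x \<and> x < t + e" if "0 < t" "0 < e" for t e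
  proof -
    have "0 < min e t" using that by simp
    from E_small[OF this] obtain x where x: "x \<in> E" "x < min e t" by blast
    then have x0: "0 < x" using E_pos by auto
    \<comment> \<open>The largest multiple of \<open>x\<close> not exceeding \<open>t\<close> misses
      it by less than x < e; x < t ensures n \<ge> 1.\<close>
    define n where "n = nat \<lfloor>t / x\<rfloor>"
    have "1 \<le> t / x" using x x0 by simp
    then have n: "1 \<le> n" "real n \<le> t / x" "t / x < real n + 1"
      unfolding n_def by linarith+
    then have nx: "real n * x \<le> t" "t < real n * x + x"
      using x0 by (auto simp: field_simps)
    have "real n * x \<in> E" using E_mult[OF x(1), of "n - 1"] n(1) by simp
    then show ?thesis using nx x(2) that by (intro bexI[of _ "real n * x"]) auto
  qed
  have "t \<in> E" if t: "0 < t" for t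
  proof -
    obtain x where x: "x \<in> E" "x < t" using E_small[OF t] by auto
    obtain e where e: "0 < e" "ball x e \<subseteq> E" using E_open x(1) by (auto simp: open_contains_ball)
    obtain z where z: "z \<in> E" "t - x - e < z" "z < t - x + e" using E_dense[of "t - x" e] x e by auto
    then have "t - z \<in> ball x e" by (auto simp: dist_real_def)
    with e(2) z(1) show ?thesis by (intro E_meets[of z t]) auto
  qed
  with E_A show ?thesis by (auto elim: eventually_mono)
qed

lemma AE_interval_exists:
  assumes "AE t in lborel. P t" "a < (b::real)"
  obtains t where "a < t" "t < b" "P t"
proof -
  have "\<exists>t\<in>{a<..<b}. P t"
  proof (rule ccontr)
    assume no: "\<not> ?thesis"
    from assms(1) have "AE t in lborel. t \<notin> {a<..<b}"
      by eventually_elim (use no in auto)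
    then have "{a<..<b} \<in> null_sets lborel" by (subst AE_iff_null_sets) auto
    then show False using assms(2) by (simp add: null_sets_def)
  qed
  then show thesis using that by auto
qed

section \<open>Mass of the kernel and its resolvents near the origin\<close>

abbreviation cum :: "(real \<Rightarrow> ennreal) \<Rightarrow> real \<Rightarrow> ennreal" where
  "cum \<equiv> nnconv (indicator {0<..})"

lemma cum_eq: "cum F t = (\<integral>\<^sup>+z. F z * indicator {..<t} z \<partial>lborel)"
  unfolding nnconv_def by (intro nn_integral_cong) (auto simp: indicator_def)

lemma cum_mono: "s \<le> t \<Longrightarrow> cum F s \<le> cum F t"
  unfolding cum_eq by (intro nn_integral_mono) (auto simp: indicator_def)

context cp_kernel
begin

text \<open>The identity for \<open>s u\<close> holds almost everywhere only. The mass is monotone,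
  so one good point to the right of \<open>t\<close>, on the positive half-line, suffices.\<close>

lemma cum_r_le:
  assumes "0 \<le> u"
  shows "ennreal u * cum (r u) t \<le> 1"
proof -
  obtain t' where t': "max 0 t < t'" "t' < max 0 t + 1"
    "s u t' + ennreal u * cum (r u) t' = indicator {0<..} t'"
    using AE_interval_exists[OF conv_one_r[OF assms], of "max 0 t" "max 0 t + 1"] by auto
  have "ennreal u * cum (r u) t \<le> ennreal u * cum (r u) t'"
    using t' by (intro mult_left_mono cum_mono) auto
  also have "\<dots> \<le> s u t' + ennreal u * cum (r u) t'" by simp
  also have "\<dots> = 1" using t' by simp
  finally show ?thesis .
qed

lemma r_le_l:
  assumes "0 \<le> u"
  shows "AE t in lborel. r u t \<le> l t"
  using r_eq[OF assms] by eventually_elim (metis le_iff_add)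

text \<open>
  If \<open>l\<close> vanishes on \<open>(0, e)\<close>, then \<open>l = r u\<close> on \<open>(0, 2 e)\<close> for every \<open>u\<close>, while the mass of \<open>r u\<close> is at
  most \<open>1 / u\<close>.
\<close>

lemma l_zero_doubling:
  assumes z: "AE t in lborel. t < e \<longrightarrow> l t = 0"
  shows "AE t in lborel. t < 2 * e \<longrightarrow> l t = 0"
proof -
  have eq: "AE t in lborel. t < 2 * e \<longrightarrow> l t = r u t" if u: "0 \<le> u" for u
  proof -
    have rz: "AE t in lborel. t < e \<longrightarrow> r u t = 0"
      using z r_le_l[OF u] by eventually_elim auto
    have "nnconv l (r u) t = 0" if t: "t < 2 * e" for t
    proof -
      have "AE x in lborel. l (t - x) * r u x = 0"
        using AE_lborel_reflect[OF z, of t] rz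
      proof eventually_elim
        case (elim x)
        then show ?case using t by (cases "x < e") auto
      qed
      then show ?thesis unfolding nnconv_def by (subst nn_integral_0_iff_AE) auto
    qed
    with r_eq[OF u] show ?thesis by (auto elim: eventually_mono)
  qed
  have le: "ennreal (real n) * cum l (2 * e) \<le> 1" for n
  proof -
    have "cum l (2 * e) = cum (r (real n)) (2 * e)"
      unfolding cum_eq
      by (intro nn_integral_cong_AE eventually_mono[OF eq[of "real n"]]) (auto simp: indicator_def)
    then show ?thesis using cum_r_le[of "real n"] by simp
  qed
  have "cum l (2 * e) = 0"
  proof (rule ccontr)
    assume nz: "cum l (2 * e) \<noteq> 0"
    have "cum l (2 * e) < \<infinity>" using le[of 1] by (auto intro: le_less_trans)
    then obtain c where c: "cum l (2 * e) = ennreal c" "0 < c"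
      using nz by (cases "cum l (2 * e)") (auto simp: ennreal_eq_0_iff)
    obtain n where "1 < real n * c" using reals_Archimedean3[OF c(2)] by blast
    moreover have "ennreal (real n * c) \<le> ennreal 1"
      using le[of n] c by (simp add: ennreal_mult')
    ultimately show False by (simp add: ennreal_le_iff)
  qed
  then have "AE t in lborel. l t * indicator {..<2 * e} t = 0"
    unfolding cum_eq by (subst (asm) nn_integral_0_iff_AE) auto
  then show ?thesis by eventually_elim (auto simp: indicator_def split: if_splits)
qed

lemma l_mass_near_zero:
  assumes "0 < e"
  shows "\<not> (AE t in lborel. t < e \<longrightarrow> l t = 0)"
proof
  assume *: "AE t in lborel. t < e \<longrightarrow> l t = 0"
  have "AE t in lborel. t < 2 ^ n * e \<longrightarrow> l t = 0" for n
  proof (induction n)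
    case (Suc n)
    from l_zero_doubling[OF this] show ?case by (simp add: mult.assoc)
  qed (use * in simp)
  then have "AE t in lborel. \<forall>n. t < 2 ^ n * e \<longrightarrow> l t = 0"
    unfolding AE_all_countable by blast
  then have "AE t in lborel. l t = 0"
  proof eventually_elim
    case (elim t)
    obtain n where "t / e < 2 ^ n" using real_arch_pow[of 2 "t / e"] by auto
    then have "t < 2 ^ n * e" using assms by (simp add: field_simps)
    with elim show ?case by blast
  qed
  with l_nonzero show False by blast
qed

text \<open>If \<open>r u\<close> vanished near 0, so would its convolution with \<open>l\<close>
  and, by the resolvent equation, \<open>l\<close> itself.\<close>

lemma r_mass_near_zero:
  assumes u: "0 \<le> u" and e: "0 < e"
  shows "\<not> (AE t in lborel. t < e \<longrightarrow> r u t = 0)"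
proof
  assume rz: "AE t in lborel. t < e \<longrightarrow> r u t = 0"
  have conv0: "nnconv l (r u) t = 0" if t: "t < e" for t
  proof -
    have "AE x in lborel. l (t - x) * r u x = 0"
      using rz
    proof eventually_elim
      case (elim x)
      then show ?case using t l_nonpos[of "t - x"] by (cases "x < e") auto
    qed
    then show ?thesis unfolding nnconv_def by (subst nn_integral_0_iff_AE) auto
  qed
  have "AE t in lborel. t < e \<longrightarrow> l t = 0"
    using r_eq[OF u] rz by eventually_elim (use conv0 in auto)
  with l_mass_near_zero[OF e] show False by blast
qed

text \<open>On [M, M + 1) all resolvents combine the same powers with positive coefficients.
  Positivity at a given \<open>t\<close> thus holds for a whole interval of parameters at once, with
  no null set depending on \<open>u\<close>.\<close>

lemma res_eq_0_iff:
  assumes "real M \<le> u" "u < real M + 1"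
  shows "res u t = 0 \<longleftrightarrow> (\<forall>k. rpow (Suc M) k t = 0)"
proof -
  have "\<lfloor>u\<rfloor> = int M" using assms by (intro floor_unique) auto
  then have N: "ceil_above u = Suc M" by (simp add: ceil_above_def)
  have "ennreal ((real (Suc M) - u) ^ k) \<noteq> 0" for k
    using assms by (simp add: ennreal_eq_0_iff not_le)
  then show ?thesis by (simp add: res_def N suminf_eq_zero_iff del: of_nat_Suc)
qed

text \<open>
  Both \<open>res M\<close> and \<open>res (M + 1 / 2)\<close> are power series in the same convolution powers, so they have the
  same zeros; the resolvent equation then makes the positivity set closed under convolution.
\<close>

lemma res_pos_AE: "AE t in lborel. 0 < t \<longrightarrow> 0 < res (real M) t"
proof -
  define A where "A = {t. 0 < res (real M) t}"
  have A [measurable]: "A \<in> sets borel"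
  proof -
    have "{t \<in> space borel. 0 < res (real M) t} \<in> sets borel" by measurable
    then show ?thesis by (simp add: A_def)
  qed
  have A_half: "t \<in> A \<longleftrightarrow> 0 < res (real M + 1 / 2) t" for t
    using res_eq_0_iff[of M "real M" t] res_eq_0_iff[of M "real M + 1 / 2" t]
    by (simp add: A_def zero_less_iff_neq_zero)
  have "AE t in lborel. 0 < t \<longrightarrow> t \<in> A"
  proof (rule AE_full_of_conv_closed[OF A])
    show "A \<subseteq> {0<..}"
    proof
      fix t assume "t \<in> A"
      then show "t \<in> {0<..}" using res_nonpos[of t "real M"] by (cases "t \<le> 0") (auto simp: A_def)
    qed
    fix e :: real assume e: "0 < e"
    show "0 < emeasure lborel (A \<inter> {..<e})"
    proof (rule ccontr)
      assume "\<not> ?thesis"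
      then have "A \<inter> {..<e} \<in> null_sets lborel" by (auto simp: null_sets_def)
      then have "AE t in lborel. t \<notin> A \<inter> {..<e}" by (rule AE_not_in)
      with res_eq_r[of "real M"] have "AE t in lborel. t < e \<longrightarrow> r (real M) t = 0"
        by (auto simp: A_def elim: eventually_elim2)
      with r_mass_near_zero[of "real M" e] e show False by simp
    qed
  next
    have "AE t in lborel. res (real M) t = res (real M + 1 / 2) t
        + ennreal (1 / 2) * nnconv (res (real M)) (res (real M + 1 / 2)) t"
      using resolvent_equation[of "real M" "real M + 1 / 2"] by simp
    then show "AE t in lborel. 0 < nnconv (indicator A) (indicator A) t \<longrightarrow> t \<in> A"
    proof eventually_elim
      case (elim t)
      show ?case
      proof (rule impI, rule ccontr)
        assume pos: "0 < nnconv (indicator A) (indicator A) t" and "t \<notin> A"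
        then have "res (real M) t = 0" by (simp add: A_def)
        with elim have "ennreal (1 / 2) * nnconv (res (real M)) (res (real M + 1 / 2)) t = 0"
          by simp
        then have "nnconv (res (real M)) (res (real M + 1 / 2)) t = 0"
          by (simp add: ennreal_eq_0_iff)
        then have "AE z in lborel. res (real M) (t - z) * res (real M + 1 / 2) z = 0"
          unfolding nnconv_def by (subst (asm) nn_integral_0_iff_AE) auto
        then have "AE z in lborel. indicator A (t - z) * indicator A z = (0::ennreal)"
        proof eventually_elim
          case (elim z)
          show ?case
          proof (cases "t - z \<in> A \<and> z \<in> A")
            case True
            then have "0 < res (real M) (t - z)" "0 < res (real M + 1 / 2) z"
              using A_half by (auto simp: A_def)
            with elim show ?thesis by auto
          qed auto
        qed
        then have "nnconv (indicator A) (indicator A) t = 0"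
          unfolding nnconv_def by (subst nn_integral_0_iff_AE) auto
        with pos show False by simp
      qed
    qed
  qed
  then show ?thesis by (simp add: A_def)
qed

text \<open>A zero at \<open>t\<close> forces \<open>res (u + c) t = 0\<close> for almost every u >
  0. One such u with u + c below the next integer already contradicts positivity of
  \<open>res (real M) t\<close>.\<close>

lemma mixture_pos_AE:
  assumes a: "0 < a" "a < 1" and c: "0 \<le> c"
  shows "AE t in lborel. 0 < t \<longrightarrow> 0 < mixture a c t"
proof -
  define M where "M = nat \<lfloor>c\<rfloor>"
  have M: "real M \<le> c" "c < real M + 1" using c unfolding M_def by linarith+
  note I = powker_const_pos[OF a]
  show ?thesis
    using res_pos_AE[of M]
  proof eventually_elim
    case (elim t)
    show ?case
    proof (rule impI, rule ccontr)
      assume t: "0 < t" and "\<not> 0 < mixture a c t"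
      then have "mixture a c t = 0" by simp
      then have "AE u in lborel. ennreal (powker a u / powker_const a) * res (\<bar>u\<bar> + c) t = 0"
        unfolding mixture_def by (subst (asm) nn_integral_0_iff_AE) auto
      moreover have "0 < real M + 1 - c" using M by simp
      ultimately obtain u where u: "0 < u" "u < real M + 1 - c"
        and z: "ennreal (powker a u / powker_const a) * res (\<bar>u\<bar> + c) t = 0"
        by (rule AE_interval_exists)
      have "0 < powker a u / powker_const a" using u I by (simp add: powker_def)
      with z have "res (u + c) t = 0" using u by (auto simp: ennreal_eq_0_iff)
      then have "res (real M) t = 0"
        using res_eq_0_iff[of M "u + c" t] res_eq_0_iff[of M "real M" t] u M by simp
      with elim t show False by simp
    qed
  qed
qed

text \<open>Positivity almost everywhere becomes positivity at every \<open>t\<close>: the integrand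
  is positive almost everywhere on (0, t).\<close>

lemma conv_mixture_pos:
  assumes "0 < a" "a < 1" "0 < b" "b < 1" "0 \<le> c" "0 \<le> d" and t: "0 < t"
  shows "0 < nnconv (mixture a c) (mixture b d) t"
proof (rule ccontr)
  assume "\<not> ?thesis"
  then have "AE z in lborel. mixture a c (t - z) * mixture b d z = 0"
    unfolding nnconv_def by (simp add: nn_integral_0_iff_AE)
  with AE_lborel_reflect[OF mixture_pos_AE[OF assms(1,2,5)], of t] mixture_pos_AE[OF assms(3,4,6)]
  have "AE z in lborel. \<not> (0 < z \<and> z < t)"
    by eventually_elim auto
  then obtain z where "0 < z" "z < t" "\<not> (0 < z \<and> z < t)"
    using AE_interval_exists[OF _ t] by blast
  then show False by simp
qed

end

section \<open>The bound for nonincreasing kernels\<close>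

text \<open>The hypothesis is X u \<le> K / (1 + u c) = (K / c) / (1 / c + u) without a division in
  \<open>ennreal\<close>. It is applied both to values and to masses of resolvents.\<close>

lemma nn_integral_powker_le:
  assumes a: "0 < a" "a < 1" and c: "0 < c" and K: "0 \<le> K"
    and X: "AE u in lborel. 0 < u \<longrightarrow> X u * (1 + ennreal u * ennreal c) \<le> ennreal K"
  shows "(\<integral>\<^sup>+u. ennreal (powker a u / powker_const a) * X u \<partial>lborel) \<le> ennreal (K * c powr (a - 1))"
proof -
  define I where "I = powker_const a"
  have I: "0 < I" using powker_const_pos[OF a] by (simp add: I_def)
  have "(\<integral>\<^sup>+u. ennreal (powker a u / I) * X u \<partial>lborel)
      \<le> (\<integral>\<^sup>+u. ennreal (K / (I * c)) * ennreal (powker a u / (1 / c + u)) \<partial>lborel)"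
  proof (rule nn_integral_mono_AE)
    show "AE u in lborel. ennreal (powker a u / I) * X u \<le> ennreal (K / (I * c)) * ennreal (powker a u / (1 / c + u))"
      using X
    proof eventually_elim
      case (elim u)
      show ?case
      proof (cases "0 < u")
        case True
        have D: "1 + ennreal u * ennreal c = ennreal (1 + u * c)"
          using True c by (simp add: ennreal_mult)
        have Dpos: "0 < 1 + u * c" using True c by (simp add: add_pos_pos)
        have le: "X u * ennreal (1 + u * c) \<le> ennreal K" using elim True D by simp
        have "X u \<noteq> \<infinity>"
        proof
          assume "X u = \<infinity>"
          with le Dpos show False by (simp add: ennreal_top_mult top_unique)
        qed
        then obtain y where y: "X u = ennreal y" "0 \<le> y" by (cases "X u") auto
        have "y * (1 + u * c) \<le> K"
          using le y Dpos K by (simp add: ennreal_mult[symmetric] ennreal_le_iff)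
        then have "y \<le> K / (1 + u * c)" using Dpos by (simp add: pos_le_divide_eq)
        then have "powker a u / I * y \<le> powker a u / I * (K / (1 + u * c))"
          using I by (intro mult_left_mono) auto
        also have "\<dots> = K / (I * c) * (powker a u / (1 / c + u))"
        proof -
          have "1 + u * c = c * (1 / c + u)" using c by (simp add: field_simps)
          then show ?thesis by (simp only:) (simp add: mult_ac)
        qed
        finally have "ennreal (powker a u / I * y) \<le> ennreal (K / (I * c) * (powker a u / (1 / c + u)))"
          by (rule ennreal_leI)
        moreover have "ennreal (powker a u / I * y) = ennreal (powker a u / I) * ennreal y"
          "ennreal (K / (I * c) * (powker a u / (1 / c + u))) = ennreal (K / (I * c)) * ennreal (powker a u / (1 / c + u))"
          by (rule ennreal_mult; use I c K y True in simp)+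
        ultimately show ?thesis by (simp only: y)
      qed (simp add: powker_def)
    qed
  qed
  also have "\<dots> = ennreal (K / (I * c)) * ennreal ((1 / c) powr (- a) * I)"
    using nn_integral_powker[OF a, of "1 / c"] c by (subst nn_integral_cmult) (auto simp: I_def)
  also have "\<dots> = ennreal (K / (I * c) * ((1 / c) powr (- a) * I))"
    using I c K by (intro ennreal_mult'[symmetric]) auto
  also have "K / (I * c) * ((1 / c) powr (- a) * I) = K * c powr (a - 1)"
    using I c by (simp add: powr_divide powr_minus powr_diff)
  finally show ?thesis by (simp add: I_def)
qed

context cp_kernel
begin

lemma cum_l_finite: "cum l t < \<infinity>"
proof -
  have "cum l t \<le> (\<integral>\<^sup>+z. l z * indicator {..t} z \<partial>lborel)"
    unfolding cum_eq by (intro nn_integral_mono) (auto simp: indicator_def)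
  also have "\<dots> < \<infinity>"
    by (rule locally_finite_of_nnlap[OF _ _ nnlap_l_finite[OF zero_less_one]]) (auto simp: l_nonpos)
  finally show ?thesis .
qed

lemma cum_l_pos:
  assumes "0 < t"
  shows "0 < cum l t"
proof (rule ccontr)
  assume "\<not> ?thesis"
  then have "AE z in lborel. l z * indicator {..<t} z = 0"
    unfolding cum_eq by (simp add: nn_integral_0_iff_AE)
  then have "AE z in lborel. z < t \<longrightarrow> l z = 0"
    by eventually_elim (auto simp: indicator_def split: if_splits)
  with l_mass_near_zero[OF assms] show False by blast
qed

lemma cum_r_le_cum_l:
  assumes "0 \<le> u"
  shows "cum (r u) t \<le> cum l t"
  by (rule nnconv_mono_AE[OF r_le_l[OF assms]])

text \<open>By \<open>conv_one_r\<close>, \<open>s u\<close> is 1 minus a nondecreasing function off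
  a null set, which both points have to avoid.\<close>

lemma s_antimono:
  assumes u: "0 \<le> u"
  shows "AE t in lborel. AE z in lborel. 0 < z \<and> z < t \<longrightarrow> s u t \<le> s u z"
  using conv_one_r[OF u]
proof eventually_elim
  case t: (elim t)
  show ?case
    using conv_one_r[OF u]
  proof eventually_elim
    case (elim z)
    show ?case
    proof
      assume z: "0 < z \<and> z < t"
      let ?x = "ennreal u * cum (r u) z" and ?y = "ennreal u * cum (r u) t"
      have "?x + s u t \<le> ?y + s u t"
        using z by (intro add_right_mono mult_left_mono cum_mono) auto
      also have "\<dots> = ?x + s u z" using t elim z by (simp add: add.commute)
      finally have "?x + s u t \<le> ?x + s u z" .
      moreover have "?x \<noteq> \<infinity>"
        using cum_r_le[OF u, of z] by (metis ennreal_one_neq_top infinity_ennreal_def top_unique)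
      ultimately show "s u t \<le> s u z" by (simp add: ennreal_add_left_cancel_le)
    qed
  qed
qed

text \<open>
  For nonincreasing \<open>l\<close>, \<open>l * r \<ge> l (t) (1 * r)\<close> gives \<open>r \<le> l s\<close>, and since \<open>s\<close> is nonincreasing,
  \<open>1 \<ge> s (1 + u (1 * l))\<close>.
\<close>

lemma r_le_antimono:
  assumes f: "ennreal_version f l" and anti: "antimono_on {0<..} f" and u: "0 \<le> u"
  shows "AE t in lborel. 0 < t \<longrightarrow> r u t * (1 + ennreal u * cum l t) \<le> l t"
  using s_antimono[OF u] conv_one_r[OF u] r_eq[OF u] s_eq[OF u] ennreal_version_AE[OF f]
proof eventually_elim
  case (elim t)
  show ?case
  proof
    assume t: "0 < t"
    have lt: "l t = ennreal (f t)" using elim t by simp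
    have "l t * cum (r u) t = (\<integral>\<^sup>+z. l t * (indicator {0<..} (t - z) * r u z) \<partial>lborel)"
      unfolding nnconv_def by (rule nn_integral_cmult[symmetric]) measurable
    also have "\<dots> \<le> nnconv l (r u) t"
      unfolding nnconv_def
    proof (rule nn_integral_mono_AE)
      show "AE z in lborel. l t * (indicator {0<..} (t - z) * r u z) \<le> l (t - z) * r u z"
        using AE_lborel_reflect[OF ennreal_version_AE[OF f], of t]
      proof eventually_elim
        case (elim z)
        show ?case
        proof (cases "0 < z \<and> z < t")
          case True
          have "f t \<le> f (t - z)" using anti True by (auto simp: monotone_on_def)
          then have "l t \<le> l (t - z)" using lt elim True by (auto intro: ennreal_leI)
          then show ?thesis using True by (auto intro: mult_right_mono)
        next
          case False
          then show ?thesis using r_nonpos[of z u] by (auto simp: indicator_def)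
        qed
      qed
    qed
    finally have lr: "l t * cum (r u) t \<le> nnconv l (r u) t" .
    have "s u t * cum l t = s u t * nnconv l (indicator {0<..}) t"
      by (subst nnconv_commute[of l]) auto
    also have "\<dots> = (\<integral>\<^sup>+z. s u t * (l (t - z) * indicator {0<..} z) \<partial>lborel)"
      unfolding nnconv_def by (rule nn_integral_cmult[symmetric]) measurable
    also have "\<dots> \<le> nnconv l (s u) t"
      unfolding nnconv_def
    proof (rule nn_integral_mono_AE)
      show "AE z in lborel. s u t * (l (t - z) * indicator {0<..} z) \<le> l (t - z) * s u z"
        using elim(1)
      proof eventually_elim
        case (elim z)
        show ?case
        proof (cases "0 < z \<and> z < t")
          case True
          with elim have "l (t - z) * s u t \<le> l (t - z) * s u z" by (intro mult_left_mono) auto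
          then show ?thesis using True by (simp add: mult.commute)
        next
          case False
          then show ?thesis using l_nonpos[of "t - z"] by (auto simp: indicator_def)
        qed
      qed
    qed
    finally have ls: "s u t * cum l t \<le> nnconv l (s u) t" .
    have "s u t * (1 + ennreal u * cum l t) = s u t + ennreal u * (s u t * cum l t)"
      by (simp add: distrib_left mult.left_commute)
    also have "\<dots> \<le> s u t + ennreal u * nnconv l (s u) t"
      using ls by (intro add_left_mono mult_left_mono) auto
    finally have s1: "s u t * (1 + ennreal u * cum l t) \<le> 1" using elim(4) t by simp
    \<comment> \<open>Multiplying s + u (1 * r) = 1 by \<open>l t\<close> rewrites the right side of
      the resolvent equation; \<open>?x\<close> is the common term to be cancelled.\<close>
    let ?x = "ennreal u * (l t * cum (r u) t)"
    have "?x + r u t \<le> r u t + ennreal u * nnconv l (r u) t"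
      unfolding add.commute[of ?x] using lr by (intro add_left_mono mult_left_mono) auto
    also have "\<dots> = l t * (s u t + ennreal u * cum (r u) t)"
      using elim(2,3) t by simp
    also have "\<dots> = ?x + l t * s u t"
      by (simp add: distrib_left mult.left_commute add.commute)
    finally have "?x + r u t \<le> ?x + l t * s u t" .
    moreover have "?x \<noteq> \<infinity>"
      using cum_r_le_cum_l[OF u, of t] cum_l_finite[of t] lt
      by (auto simp: ennreal_mult_eq_top_iff top_unique)
    ultimately have "r u t \<le> l t * s u t" by (simp add: ennreal_add_left_cancel_le)
    then have "r u t * (1 + ennreal u * cum l t) \<le> l t * s u t * (1 + ennreal u * cum l t)"
      by (intro mult_right_mono) auto
    also have "\<dots> = l t * (s u t * (1 + ennreal u * cum l t))" by (simp add: mult.assoc)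
    also have "\<dots> \<le> l t * 1" using s1 by (intro mult_left_mono) auto
    finally show "r u t * (1 + ennreal u * cum l t) \<le> l t" by simp
  qed
qed

definition cumr :: "real \<Rightarrow> real" where
  "cumr t = enn2real (cum l t)"

lemma cumr: "cum l t = ennreal (cumr t)"
  using cum_l_finite[of t] by (simp add: cumr_def less_top)

lemma cumr_pos: "0 < t \<Longrightarrow> 0 < cumr t"
  using cum_l_pos[of t] by (simp add: cumr)

lemma cumr_mono: "x \<le> y \<Longrightarrow> cumr x \<le> cumr y"
  unfolding cumr_def using cum_l_finite[of y] by (intro enn2real_mono cum_mono) auto

text \<open>The exceptional set of \<open>t\<close> depends on \<open>u\<close>; joint measurability
  of \<open>res\<close> allows the quantifiers to be exchanged before integrating in
  \<open>u\<close>. Replacing u + c by u in the factor makes the bound independent of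
  \<open>c\<close>.\<close>

lemma mixture_le:
  assumes f: "ennreal_version f l" and anti: "antimono_on {0<..} f" and a: "0 < a" "a < 1" and c: "0 \<le> c"
  shows "AE t in lborel. 0 < t \<longrightarrow> mixture a c t \<le> ennreal (f t * cumr t powr (a - 1))"
proof -
  have "AE t in lborel. 0 < t \<longrightarrow> res (\<bar>u\<bar> + c) t * (1 + ennreal \<bar>u\<bar> * cum l t) \<le> l t" for u
  proof -
    have v: "0 \<le> \<bar>u\<bar> + c" using c by simp
    show ?thesis
      using r_le_antimono[OF f anti v] res_eq_r[OF v]
    proof eventually_elim
      case (elim t)
      have "r (\<bar>u\<bar> + c) t * (1 + ennreal \<bar>u\<bar> * cum l t) \<le> r (\<bar>u\<bar> + c) t * (1 + ennreal (\<bar>u\<bar> + c) * cum l t)"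
        using c by (intro mult_left_mono add_left_mono mult_right_mono ennreal_leI) auto
      with elim show ?case by auto
    qed
  qed
  then have "AE u in lborel. AE t in lborel. 0 < t \<longrightarrow> res (\<bar>u\<bar> + c) t * (1 + ennreal \<bar>u\<bar> * cum l t) \<le> l t"
    by simp
  then have "AE t in lborel. AE u in lborel. 0 < t \<longrightarrow> res (\<bar>u\<bar> + c) t * (1 + ennreal \<bar>u\<bar> * cum l t) \<le> l t"
    by (subst (asm) lborel_pair.AE_commute) measurable
  then show ?thesis
    using ennreal_version_AE[OF f]
  proof eventually_elim
    case (elim t)
    show ?case
    proof
      assume t: "0 < t"
      with elim have lt: "l t = ennreal (f t)" "0 \<le> f t" by auto
      show "mixture a c t \<le> ennreal (f t * cumr t powr (a - 1))"
        unfolding mixture_def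
      proof (rule nn_integral_powker_le[OF a cumr_pos[OF t] lt(2)])
        show "AE u in lborel. 0 < u \<longrightarrow> res (\<bar>u\<bar> + c) t * (1 + ennreal u * ennreal (cumr t)) \<le> ennreal (f t)"
          using elim(1) by eventually_elim (use t in \<open>auto simp: lt cumr\<close>)
      qed
    qed
  qed
qed

text \<open>The factor 2 arises because 1 * r \<le> 1 * l handles the summand 1 of 1 + u (1 * l),
  and u (1 * r) \<le> 1 handles the other.\<close>

lemma cum_mixture_le:
  assumes a: "0 < a" "a < 1" and c: "0 \<le> c" and t: "0 < t"
  shows "cum (mixture a c) t \<le> ennreal (2 * cumr t powr a)"
proof -
  have "cum (mixture a c) t
      = (\<integral>\<^sup>+z. (\<integral>\<^sup>+u. indicator {0<..} (t - z) * (ennreal (powker a u / powker_const a) * res (\<bar>u\<bar> + c) z) \<partial>lborel) \<partial>lborel)"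
    unfolding nnconv_def mixture_def by (intro nn_integral_cong nn_integral_cmult[symmetric]) measurable
  also have "\<dots> = (\<integral>\<^sup>+u. (\<integral>\<^sup>+z. indicator {0<..} (t - z) * (ennreal (powker a u / powker_const a) * res (\<bar>u\<bar> + c) z) \<partial>lborel) \<partial>lborel)"
    by (intro lborel_pair.Fubini') measurable
  also have "\<dots> = (\<integral>\<^sup>+u. ennreal (powker a u / powker_const a) * cum (res (\<bar>u\<bar> + c)) t \<partial>lborel)"
    unfolding nnconv_def
    by (intro nn_integral_cong, subst nn_integral_cmult[symmetric]) (auto simp: mult.left_commute)
  also have "\<dots> \<le> ennreal (2 * cumr t * cumr t powr (a - 1))"
  proof (rule nn_integral_powker_le[OF a cumr_pos[OF t]])
    show "0 \<le> 2 * cumr t" using cumr_pos[OF t] by simp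
    show "AE u in lborel. 0 < u \<longrightarrow> cum (res (\<bar>u\<bar> + c)) t * (1 + ennreal u * ennreal (cumr t)) \<le> ennreal (2 * cumr t)"
    proof (intro AE_I2 impI)
      fix u :: real assume u: "0 < u"
      have v: "0 \<le> u + c" using u c by simp
      have eq: "cum (res (\<bar>u\<bar> + c)) t = cum (r (u + c)) t"
        using u nnconv_cong_AE[OF res_eq_r[OF v]] by simp
      have "ennreal u * cum (r (u + c)) t \<le> ennreal (u + c) * cum (r (u + c)) t"
        using c by (intro mult_right_mono ennreal_leI) auto
      also have "\<dots> \<le> 1" by (rule cum_r_le[OF v])
      finally have 1: "ennreal u * cum (r (u + c)) t \<le> 1" .
      have "cum (r (u + c)) t * (1 + ennreal u * cum l t) = cum (r (u + c)) t + (ennreal u * cum (r (u + c)) t) * cum l t"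
        by (simp add: distrib_left mult_ac)
      also have "\<dots> \<le> cum l t + 1 * cum l t"
        using cum_r_le_cum_l[OF v] 1 by (intro add_mono mult_right_mono) auto
      also have "\<dots> = ennreal (2 * cumr t)"
        using cumr_pos[OF t] by (simp add: cumr ennreal_plus[symmetric] del: ennreal_plus)
      finally show "cum (res (\<bar>u\<bar> + c)) t * (1 + ennreal u * ennreal (cumr t)) \<le> ennreal (2 * cumr t)"
        by (simp add: eq cumr)
    qed
  qed
  also have "2 * cumr t * cumr t powr (a - 1) = 2 * cumr t powr a"
    using cumr_pos[OF t] by (simp add: powr_diff)
  finally show ?thesis .
qed

text \<open>In each half one argument exceeds t / 2, where the pointwise bound applies, and the
  other factor contributes its mass up to t / 2. Each half yields twice the same product.\<close>

lemma conv_mixture_le: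
  assumes f: "ennreal_version f l" and anti: "antimono_on {0<..} f"
    and a: "0 < a" "a < 1" and b: "0 < b" "b < 1" and c: "0 \<le> c" and d: "0 \<le> d" and t: "0 < t"
  shows "nnconv (mixture a c) (mixture b d) t \<le> ennreal (4 * f (t / 2) * cumr (t / 2) powr (a + b - 1))"
proof -
  let ?s = "t / 2"
  have s: "0 < ?s" using t by simp
  \<comment> \<open>Nonnegativity is known almost everywhere; a nonincreasing function inherits it
    from points to the right.\<close>
  have f_nonneg: "0 \<le> f w" if w: "0 < w" for w
  proof -
    obtain w' where "w < w'" "w' < w + 1" "0 < w' \<longrightarrow> 0 \<le> f w' \<and> l w' = ennreal (f w')"
      using AE_interval_exists[OF ennreal_version_AE[OF f], of w "w + 1"] by auto
    moreover from this have "f w' \<le> f w" using anti w by (auto simp: monotone_on_def)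
    ultimately show ?thesis using w by auto
  qed
  \<comment> \<open>The bound of \<open>mixture_le\<close> is itself nonincreasing, since
    \<open>cumr\<close> grows and its exponent p - 1 is negative.\<close>
  have up: "AE w in lborel. ?s < w \<longrightarrow> mixture p q w \<le> ennreal (f ?s * cumr ?s powr (p - 1))"
    if p: "0 < p" "p < 1" "0 \<le> q" for p q
    using mixture_le[OF f anti p]
  proof eventually_elim
    case (elim w)
    show ?case
    proof
      assume w: "?s < w"
      have "f w * cumr w powr (p - 1) \<le> f ?s * cumr ?s powr (p - 1)"
      proof (rule mult_mono)
        show "f w \<le> f ?s" using anti w s by (auto simp: monotone_on_def)
        show "cumr w powr (p - 1) \<le> cumr ?s powr (p - 1)"
          using cumr_pos[OF s] cumr_mono[of ?s w] w p by (intro powr_mono2') auto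
      qed (use f_nonneg[OF s] in auto)
      then have "ennreal (f w * cumr w powr (p - 1)) \<le> ennreal (f ?s * cumr ?s powr (p - 1))"
        by (rule ennreal_leI)
      with elim w s show "mixture p q w \<le> ennreal (f ?s * cumr ?s powr (p - 1))" by auto
    qed
  qed
  define A where "A = ennreal (f ?s * cumr ?s powr (a - 1))"
  define B where "B = ennreal (f ?s * cumr ?s powr (b - 1))"
  have "nnconv (mixture a c) (mixture b d) t
      \<le> (\<integral>\<^sup>+z. A * (mixture b d z * indicator {..<?s} z) + B * (mixture a c (t - z) * indicator {..<?s} (t - z)) \<partial>lborel)"
    unfolding nnconv_def
  proof (rule nn_integral_mono_AE)
    show "AE z in lborel. mixture a c (t - z) * mixture b d z
        \<le> A * (mixture b d z * indicator {..<?s} z) + B * (mixture a c (t - z) * indicator {..<?s} (t - z))"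
      using up[OF b d] AE_lborel_reflect[OF up[OF a c], of t] AE_lborel_singleton[of ?s]
    proof eventually_elim
      case (elim z)
      consider "z < ?s" | "?s < z" using elim(3) by linarith
      then show ?case
      proof cases
        case 1
        then have "mixture a c (t - z) * mixture b d z \<le> A * mixture b d z"
          using elim(2) by (intro mult_right_mono) (auto simp: A_def)
        then show ?thesis using 1 by (simp add: add_increasing2)
      next
        case 2
        then have "mixture a c (t - z) * mixture b d z \<le> mixture a c (t - z) * B"
          using elim(1) by (intro mult_left_mono) (auto simp: B_def)
        then show ?thesis using 2 by (simp add: mult.commute)
      qed
    qed
  qed
  also have "\<dots> = A * (\<integral>\<^sup>+z. mixture b d z * indicator {..<?s} z \<partial>lborel)
      + B * (\<integral>\<^sup>+z. mixture a c (t - z) * indicator {..<?s} (t - z) \<partial>lborel)"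
    by (simp add: nn_integral_add nn_integral_cmult)
  also have "(\<integral>\<^sup>+z. mixture a c (t - z) * indicator {..<?s} (t - z) \<partial>lborel) = cum (mixture a c) ?s"
    unfolding cum_eq by (subst nn_integral_real_affine[where c="-1" and t=t]) auto
  also have "(\<integral>\<^sup>+z. mixture b d z * indicator {..<?s} z \<partial>lborel) = cum (mixture b d) ?s"
    by (simp only: cum_eq)
  also have "A * cum (mixture b d) ?s + B * cum (mixture a c) ?s
      \<le> A * ennreal (2 * cumr ?s powr b) + B * ennreal (2 * cumr ?s powr a)"
    using cum_mixture_le[OF a c s] cum_mixture_le[OF b d s] by (intro add_mono mult_left_mono) auto
  also have "\<dots> = ennreal (f ?s * cumr ?s powr (a - 1) * (2 * cumr ?s powr b) + f ?s * cumr ?s powr (b - 1) * (2 * cumr ?s powr a))"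
    using f_nonneg[OF s] by (simp add: A_def B_def ennreal_mult ennreal_plus)
  also have "f ?s * cumr ?s powr (a - 1) * (2 * cumr ?s powr b) + f ?s * cumr ?s powr (b - 1) * (2 * cumr ?s powr a)
      = 4 * f ?s * cumr ?s powr (a + b - 1)"
    using cumr_pos[OF s] by (simp add: powr_diff powr_add field_simps)
  finally show ?thesis .
qed

end

theorem lemmaB1:
  fixes \<delta>\<^sub>1 \<delta>\<^sub>2 :: real
  assumes "0 < \<delta>\<^sub>1" "\<delta>\<^sub>1 < 1" "0 < \<delta>\<^sub>2" "\<delta>\<^sub>2 < 1" "\<delta>\<^sub>1 + \<delta>\<^sub>2 \<ge> 1"
  shows "\<exists>C>0. \<forall>(l :: real \<Rightarrow> real) (\<gamma> :: real) (r :: real \<Rightarrow> real).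
           completely_positive l \<and> 0 \<le> \<gamma> \<and> volterra_solution l \<gamma> l r \<longrightarrow>
           (\<exists>h :: real \<Rightarrow> real.
              (\<forall>t>0. 0 < h t) \<and>
              completely_positive h \<and>
              (\<forall>x>0. laplace_convergent h x \<and>
                 laplace h x = Gamma (1 - \<delta>\<^sub>1) * Gamma (1 - \<delta>\<^sub>2)
                   * laplace l x powr (1 - \<delta>\<^sub>1) * laplace r x powr (1 - \<delta>\<^sub>2)) \<and>
              (antimono_on {0<..} l \<longrightarrow>
                 (\<forall>t>0. h t \<le> C * l (t / 2) * conv (\<lambda>_. 1) l (t / 2) powr (1 - (\<delta>\<^sub>1 + \<delta>\<^sub>2)))))"
proof -
  define a b G where "a = 1 - \<delta>\<^sub>1" and "b = 1 - \<delta>\<^sub>2" and "G = Gamma (1 - \<delta>\<^sub>1) * Gamma (1 - \<delta>\<^sub>2)"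
  have a: "0 < a" "a < 1" and b: "0 < b" "b < 1" and ab: "a + b \<le> 1"
    using assms by (auto simp: a_def b_def)
  have ab_eq: "1 - (\<delta>\<^sub>1 + \<delta>\<^sub>2) = a + b - 1" by (simp add: a_def b_def)
  have G: "0 < G" using assms by (simp add: G_def Gamma_real_pos)
  have main: "\<exists>h :: real \<Rightarrow> real.
      (\<forall>t>0. 0 < h t) \<and> completely_positive h \<and>
      (\<forall>x>0. laplace_convergent h x \<and> laplace h x = G * laplace l x powr a * laplace r x powr b) \<and>
      (antimono_on {0<..} l \<longrightarrow> (\<forall>t>0. h t \<le> 4 * G * l (t / 2) * conv (\<lambda>_. 1) l (t / 2) powr (1 - (\<delta>\<^sub>1 + \<delta>\<^sub>2))))"
    if cp: "completely_positive l" and \<gamma>: "0 \<le> \<gamma>" and r: "volterra_solution l \<gamma> l r" for l r :: "real \<Rightarrow> real" and \<gamma>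
  proof -
    obtain L R S where L: "ennreal_version l L" and ker: "cp_kernel L R S"
      using completely_positive_kernel[OF cp] by blast
    interpret cp_kernel L R S by (rule ker)
    \<comment> \<open>The unshifted mixture supplies the power of the transform of \<open>l\<close>,
      the one shifted by \<gamma> that of \<open>r\<close>.\<close>
    define H where "H = nnconv (mixture a 0) (mixture b \<gamma>)"
    have [measurable]: "H \<in> borel_measurable borel" unfolding H_def by measurable
    have Hpos: "0 < H t" if "0 < t" for t
      unfolding H_def using a b \<gamma> that by (intro conv_mixture_pos) auto
    have Hsupp: "H t = 0" if "t \<le> 0" for t
      unfolding H_def using that by (intro nnconv_nonpos) (auto simp: mixture_nonpos)
    define \<Psi> where "\<Psi> x = phi x powr a * (phi x + \<gamma>) powr b" for x
    have \<Psi>pos: "0 < \<Psi> x" if "0 < x" for x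
      using phi_pos[OF that] \<gamma> by (simp add: \<Psi>_def)
    have Hlap: "nnlap H x = ennreal (1 / \<Psi> x)" if x: "0 < x" for x
    proof -
      have "nnlap H x = ennreal (phi x powr (- a)) * ennreal ((phi x + \<gamma>) powr (- b))"
        using nnlap_mixture[OF a order.refl x] nnlap_mixture[OF b \<gamma> x] by (simp add: H_def nnlap_nnconv)
      also have "\<dots> = ennreal (1 / \<Psi> x)"
        by (simp add: \<Psi>_def powr_minus_divide ennreal_mult'[symmetric])
      finally show ?thesis .
    qed
    \<comment> \<open>\<open>H\<close> may be infinite on a null set; the value 1 keeps
      \<open>h\<close> positive there without affecting its transform. For nonincreasing
      \<open>l\<close> the estimate makes \<open>H\<close> finite everywhere, so the bound holds at
      every t > 0.\<close>
    define h where "h t = (if 0 < t \<and> H t < \<infinity> then G * enn2real (H t) else 1)" for t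
    have hpos: "0 < h t" for t
      using Hpos[of t] G by (simp add: h_def enn2real_positive_iff)
    have GHlap: "nnlap (\<lambda>t. ennreal G * H t) x = ennreal (G / \<Psi> x)" if "0 < x" for x
      using Hlap[OF that] G \<Psi>pos[OF that] by (simp add: nnlap_cmult ennreal_mult'[symmetric])
    have GH_rep: "ennreal_version h (\<lambda>t. ennreal G * H t)"
    proof -
      have "ennreal_version (\<lambda>t. enn2real (ennreal G * H t)) (\<lambda>t. ennreal G * H t)"
        by (intro ennreal_version_enn2real locally_finite_of_nnlap[where x=1]) (auto simp: Hsupp GHlap)
      moreover have "AE t in lborel. H t < \<infinity>"
        by (rule nnlap_finite_AE[where x=1]) (auto simp: Hlap)
      then have "AE t in lborel. 0 < t \<longrightarrow> h t = enn2real (ennreal G * H t)"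
        by eventually_elim (use G in \<open>auto simp: h_def enn2real_mult\<close>)
      ultimately show ?thesis by (rule ennreal_version_cong_AE)
    qed
    have "completely_positive h"
    proof (rule completely_positiveI[OF GH_rep G GHlap])
      show "bernstein_seq (\<lambda>k. x + real k) (\<lambda>k. \<Psi> (x + real k))" if "0 < x" for x
        unfolding \<Psi>_def using a b ab \<gamma> that
        by (intro bernstein_seq_powr_mult[OF phi_bernstein_seq]) auto
    qed
    moreover have "laplace_convergent h x \<and> laplace h x = G * laplace l x powr a * laplace r x powr b" if x: "0 < x" for x
    proof -
      have res_rep: "ennreal_version (\<lambda>t. enn2real (res \<gamma> t)) (res \<gamma>)"
        using \<gamma> by (intro ennreal_version_enn2real locally_finite_of_nnlap[where x=1]) (auto simp: res_nonpos nnlap_res)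
      have "AE t in lborel. res \<gamma> t + ennreal \<gamma> * nnconv L (res \<gamma>) t = L t"
        using r_eq[OF \<gamma>] res_eq_r[OF \<gamma>]
        by eventually_elim (simp add: nnconv_cong_AE[OF res_eq_r[OF \<gamma>]])
      then have "volterra_solution l \<gamma> l (\<lambda>t. enn2real (res \<gamma> t))"
        by (simp add: volterra_solution_iff[OF L L res_rep \<gamma>])
      \<comment> \<open>The given \<open>r\<close> is an arbitrary solution with no sign prescribed;
        uniqueness identifies it with \<open>res \<gamma>\<close> almost everywhere.\<close>
      from volterra_solution_unique[OF L nnlap_l_finite[OF zero_less_one] \<gamma> r this]
      have r_rep: "ennreal_version r (res \<gamma>)" by (rule ennreal_version_cong_AE[OF res_rep])
      have "laplace l x = 1 / phi x"
        using ennreal_version_laplace(2)[OF L nnlap_l_finite[OF x]] phi_pos[OF x] by (simp add: nnlap_l[OF x])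
      moreover have "laplace r x = 1 / (phi x + \<gamma>)"
        using ennreal_version_laplace(2)[OF r_rep, of x] phi_pos[OF x] \<gamma> by (simp add: nnlap_res[OF \<gamma> x])
      moreover have "laplace_convergent h x" "laplace h x = G / \<Psi> x"
        using ennreal_version_laplace[OF GH_rep, of x] GHlap[OF x] G \<Psi>pos[OF x] by auto
      ultimately show ?thesis
        using phi_pos[OF x] \<gamma> by (simp add: \<Psi>_def powr_divide)
    qed
    moreover have "h t \<le> 4 * G * l (t / 2) * conv (\<lambda>_. 1) l (t / 2) powr (1 - (\<delta>\<^sub>1 + \<delta>\<^sub>2))"
      if anti: "antimono_on {0<..} l" and t: "0 < t" for t
    proof -
      have conv: "conv (\<lambda>_. 1) l (t / 2) = cumr (t / 2)"
        unfolding cumr_def using cum_l_finite by (intro conv_eq_nnconv[OF ennreal_version_one L]) auto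
      have le: "H t \<le> ennreal (4 * l (t / 2) * cumr (t / 2) powr (a + b - 1))"
        unfolding H_def using a b \<gamma> t by (intro conv_mixture_le[OF L anti]) auto
      then have fin: "H t < \<infinity>" by (auto intro: le_less_trans)
      \<comment> \<open>\<open>ennreal\<close> sends negative reals to 0, so it is the positivity of
        \<open>H t\<close> that makes the real bound nonnegative.\<close>
      have "0 < ennreal (4 * l (t / 2) * cumr (t / 2) powr (a + b - 1))"
        using Hpos[OF t] le by (rule less_le_trans)
      then have "enn2real (H t) \<le> 4 * l (t / 2) * cumr (t / 2) powr (a + b - 1)"
        using le by (intro enn2real_leI) (auto simp: ennreal_less_zero_iff)
      then have "G * enn2real (H t) \<le> G * (4 * l (t / 2) * cumr (t / 2) powr (a + b - 1))"
        using G by (intro mult_left_mono) auto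
      then show ?thesis
        using fin t unfolding ab_eq by (simp add: h_def conv mult_ac)
    qed
    ultimately show ?thesis using hpos by (intro exI[of _ h]) auto
  qed
  then show ?thesis
    using G unfolding G_def a_def b_def
    by (intro exI[of _ "4 * (Gamma (1 - \<delta>\<^sub>1) * Gamma (1 - \<delta>\<^sub>2))"]) auto
qed

end
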